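(* Let $n\ge 5$ be a fixed integer with $n\equiv 1 \pmod 4$, and let $\Delta_n(a,b)$ denote the discriminant of the trinomial $f_{n,a,b}(t)=t^n+at+b$. For real numbers $A\ge 1$, $B\ge 1$, $C\ge 0$, $D\ge 0$ and a square-free integer $s$, let $T_n(A,B,C,D;s)$ be the number of pairs of integers $(a,b)\in[C,C+A]\times[D,D+B]$ such that $\Delta_n(a,b)=sr^2$ for some integer $r$. Then $$ T_n(A,B,C,D;s) \ll (AB)^{2/3}\log(AB) + A\log(AB) + B\log(AB) + (AB)^{1/3}\left(\frac{\log(ABCD)\,\log(AB)}{\log\log(ABCD)}\right)^2, $$ where the implied constant depends only on $n$ (in particular it is uniform in $s$, $A$, $B$, $C$, $D$).
   Context: For $n\equiv 1\pmod 4$ one has $\Delta_n(a,b)=(n-1)^{n-1}a^n+n^nb^{n-1}$. Notation: $U\ll V$ means $|U|\le cV$ for some constant $c>0$ depending only on $n$. For $x$ real, $\log x$ denotes the maximum of the natural logarithm of $x$ and $1$ (so $\log x\ge 1$ always; in particular this is the convention when $x\le e$, including $x=0$). *)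

theory Defs
  imports Complex_Main "HOL-Computational_Algebra.Squarefree"
begin

text \<open>Logarithm convention of the paper: log x = max(ln x, 1), and log x = 1 whenever x \<le> e.\<close>
definition plog :: "real \<Rightarrow> real" where
  "plog x = (if x \<le> exp 1 then 1 else ln x)"

text \<open>Discriminant of t^n + a t + b for n = 1 mod 4 (formula given in the paper).\<close>
definition Delta :: "nat \<Rightarrow> int \<Rightarrow> int \<Rightarrow> int" where
  "Delta n a b = (int n - 1) ^ (n - 1) * a ^ n + int n ^ n * b ^ (n - 1)"

definition Tn :: "nat \<Rightarrow> real \<Rightarrow> real \<Rightarrow> real \<Rightarrow> real \<Rightarrow> int \<Rightarrow> nat" where
  "Tn n A B C D s = card {(a::int, b::int).
      C \<le> real_of_int a \<and> real_of_int a \<le> C + A \<and>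
      D \<le> real_of_int b \<and> real_of_int b \<le> D + B \<and>
      (\<exists>r::int. Delta n a b = s * r ^ 2)}"

end

theory Submission
  imports Defs "HOL-Number_Theory.Number_Theory" "HOL-Computational_Algebra.Polynomial"
begin

text \<open>
  The square sieve over the primes \<open>p\<close> in a dyadic window \<open>(N, 2N]\<close> with \<open>N\<^sup>3 \<approx> AB\<close>: if
  \<open>\<Delta>(a, b) = s r\<^sup>2 \<noteq> 0\<close> has few prime factors, then \<open>\<Sum>\<^sub>p (s/p) (\<Delta>(a, b)/p)\<close> is about the number of
  these primes. Squaring and summing with a Fejer weight over the box reduces the count to the
  correlations of \<open>(\<Delta>/p)\<close> and \<open>(\<Delta>/q)\<close>, which are completed modulo \<open>pq\<close> and split by the Chinese
  remainder theorem into exponential sums modulo \<open>p\<close>, with the argument dilated by \<open>q\<close>, and vice versa.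

  No Weil bound is needed. As \<open>q\<close> runs over the window its residues modulo \<open>p\<close> are distinct, so by
  Parseval the mean square over \<open>q\<close> of the dilated sums at a fixed frequency \<open>(l, k)\<close> is controlled by the
  second moment of the sums of \<open>(\<Delta>/p)\<close> along the parallel lines \<open>l a + k b = j\<close>. Since \<open>n - 1\<close> is even,
  the blow-up \<open>b = a t\<close> makes \<open>\<Delta>\<close> linear in \<open>a\<close> up to a square, and this second moment becomes a sum of
  correlations of two Legendre symbols of linear polynomials, which are evaluated exactly. Averaging over
  \<open>q\<close> rather than bounding each sum loses no more than the density \<open>1 / log N\<close> of the primes.

  If some \<open>\<Delta>(a, b)\<close> in the box has too many prime factors in the window, it is exponentially large in
  terms of \<open>N\<close>. Then either one of its two terms dominates so strongly that every row or column
  of the box contains at most one solution, or the corner \<open>(C, D)\<close> is so large that the trivial bound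
  suffices.
\<close>

section \<open>Legendre symbols over the residues\<close>

lemma sum_residues_affine:
  fixes f :: "int \<Rightarrow> 'a::comm_monoid_add"
  assumes "m > 0" "coprime \<alpha> m" and per: "\<And>x. f (x mod m) = f x"
  shows "(\<Sum>k\<in>{0..<m}. f (\<alpha> * k + \<beta>)) = (\<Sum>k\<in>{0..<m}. f k)"
proof -
  let ?g = "\<lambda>k. (\<alpha> * k + \<beta>) mod m"
  have inj: "inj_on ?g {0..<m}"
  proof (rule inj_onI)
    fix x y assume xy: "x \<in> {0..<m}" "y \<in> {0..<m}" "?g x = ?g y"
    then have "[\<alpha> * x + \<beta> = \<alpha> * y + \<beta>] (mod m)" by (simp add: cong_def)
    then have "[x = y] (mod m)"
      using assms(2) by (simp add: cong_add_rcancel cong_mult_lcancel)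
    then show "x = y" using xy by (intro cong_less_imp_eq_int) auto
  qed
  have "?g ` {0..<m} \<subseteq> {0..<m}" using assms(1) by auto
  then have "bij_betw ?g {0..<m} {0..<m}"
    using inj by (simp add: bij_betw_def endo_inj_surj)
  from sum.reindex_bij_betw[OF this, of f] show ?thesis by (simp add: per)
qed

text \<open>The parametrisation \<open>q * x + p * y\<close>, without idempotents, reduces to
  \<open>q * x\<close> modulo \<open>p\<close> and to \<open>p * y\<close> modulo \<open>q\<close>.
  This is the source of the dilations in the local exponential sums.\<close>

lemma sum_residues_crt:
  fixes f :: "int \<Rightarrow> 'a::comm_monoid_add"
  assumes "p > 0" "q > 0" "coprime p q" and per: "\<And>x. f (x mod (p * q)) = f x"
  shows "(\<Sum>k\<in>{0..<p * q}. f k) = (\<Sum>x\<in>{0..<p}. \<Sum>y\<in>{0..<q}. f (q * x + p * y))"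
proof -
  let ?g = "\<lambda>(x, y). (q * x + p * y) mod (p * q)"
  let ?S = "{0..<p} \<times> {0..<q}"
  have inj: "inj_on ?g ?S"
  proof (rule inj_onI, clarify)
    fix x y x' y'
    assume *: "x \<in> {0..<p}" "y \<in> {0..<q}" "x' \<in> {0..<p}" "y' \<in> {0..<q}"
      and "(q * x + p * y) mod (p * q) = (q * x' + p * y') mod (p * q)"
    then have c: "[q * x + p * y = q * x' + p * y'] (mod p * q)" by (simp add: cong_def)
    have "[q * x + p * y = q * x' + p * y'] (mod p)"
      using c by (rule cong_modulus_mult)
    then have "[q * x = q * x'] (mod p)" by (simp add: cong_def)
    then have 1: "[x = x'] (mod p)" using assms(3)
      by (simp add: cong_mult_lcancel coprime_commute)
    have "[q * x + p * y = q * x' + p * y'] (mod q)"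
      using c by (metis cong_modulus_mult mult.commute)
    then have "[p * y = p * y'] (mod q)" by (simp add: cong_def)
    then have 2: "[y = y'] (mod q)" using assms(3)
      by (simp add: cong_mult_lcancel)
    show "x = x' \<and> y = y'" using * cong_less_imp_eq_int[OF _ _ _ _ 1] cong_less_imp_eq_int[OF _ _ _ _ 2] by simp
  qed
  have sub: "?g ` ?S \<subseteq> {0..<p * q}" using assms(1,2) by auto
  have "card (?g ` ?S) = card {0..<p * q}"
    using assms(1,2) by (simp add: card_image[OF inj] nat_mult_distrib)
  with sub have "bij_betw ?g ?S {0..<p * q}"
    using inj by (simp add: bij_betw_def card_subset_eq)
  from sum.reindex_bij_betw[OF this, of f] show ?thesis
    by (simp add: per sum.cartesian_product case_prod_beta)
qed

text \<open>Lagrange's bound, by dividing out one root at a time. The hypothesis says that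
  \<open>f\<close> does not vanish identically modulo \<open>p\<close>; the degree is taken over the
  integers, so the leading coefficient may be divisible by \<open>p\<close>.\<close>

lemma card_roots_mod_prime_le:
  fixes f :: "int poly"
  assumes "prime p" "\<not> p dvd coeff f i"
  shows "card {x \<in> {0..<p}. p dvd poly f x} \<le> degree f"
  using assms(2)
proof (induction "degree f" arbitrary: f i)
  case 0
  then have "f = [:coeff f 0:]" by (metis degree_0_id)
  moreover have "i = 0" using 0 by (metis coeff_eq_0 dvd_0_right gr0I)
  ultimately have "\<not> p dvd poly f x" for x using 0
    by (metis mult_zero_right add_0_right poly_0 poly_pCons)
  then have "{x \<in> {0..<p}. p dvd poly f x} = {}" by blast
  then show ?case by (metis card.empty zero_le)
next
  case (Suc d)
  show ?case
  proof (cases "{x \<in> {0..<p}. p dvd poly f x} = {}")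
    case True
    then show ?thesis by (metis card.empty zero_le)
  next
    case False
    then obtain r where r: "r \<in> {0..<p}" "p dvd poly f r" by blast
    define g where "g = synthetic_div f r"
    have fg: "f = [:-r, 1:] * g + [:poly f r:]"
      unfolding g_def using synthetic_div_correct'[of r f] by (simp add: add.commute)
    have dg: "degree g = d" using Suc(2) by (simp add: g_def degree_synthetic_div)
    \<comment> \<open>Since \<open>p\<close> divides \<open>poly f r\<close>, a quotient vanishing
      modulo \<open>p\<close> would make all of \<open>f\<close> vanish modulo
      \<open>p\<close>.\<close>
    obtain j where j: "\<not> p dvd coeff g j"
    proof (rule ccontr)
      assume "\<not> thesis"
      then have *: "p dvd coeff g j" for j using that by blast
      have "p dvd coeff f i"
        apply (subst fg)
        using r(2) * by (auto simp: coeff_pCons split: nat.splits)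
      then show False using Suc.prems by simp
    qed
    have "{x \<in> {0..<p}. p dvd poly f x} \<subseteq> insert r {x \<in> {0..<p}. p dvd poly g x}"
    proof
      fix x assume x: "x \<in> {x \<in> {0..<p}. p dvd poly f x}"
      have "poly f x = (x - r) * poly g x + poly f r"
        by (subst fg) (simp add: algebra_simps)
      then have "p dvd (x - r) * poly g x"
        using x r by (metis (no_types, lifting) dvd_add_left_iff mem_Collect_eq)
      then consider "p dvd x - r" | "p dvd poly g x"
        using assms(1) by (auto simp: prime_dvd_mult_iff)
      then show "x \<in> insert r {x \<in> {0..<p}. p dvd poly g x}"
      proof cases
        case 1
        then have "[x = r] (mod p)" by (simp add: cong_iff_dvd_diff)
        then have "x = r" using x r by (intro cong_less_imp_eq_int) auto
        then show ?thesis by simp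
      qed (use x in auto)
    qed
    then have "card {x \<in> {0..<p}. p dvd poly f x} \<le> card (insert r {x \<in> {0..<p}. p dvd poly g x})"
      by (intro card_mono finite.insertI finite_Collect_conjI) auto
    also have "\<dots> \<le> Suc (card {x \<in> {0..<p}. p dvd poly g x})"
      by (rule card_insert_le_m1) auto
    also have "\<dots> \<le> Suc d" using Suc(1)[of g j] dg j by simp
    finally show ?thesis using Suc(2) by simp
  qed
qed

section \<open>The Legendre symbol: multiplicativity, complete sums, correlations\<close>

lemma Legendre_cong: "[a = b] (mod p) \<Longrightarrow> Legendre a p = Legendre b p"
  unfolding Legendre_def QuadRes_def by (simp add: cong_def)

lemma Legendre_mod: "Legendre (a mod p) p = Legendre a p"
  by (intro Legendre_cong) simp

lemma Legendre_eq_0_iff: "Legendre a p = 0 \<longleftrightarrow> p dvd a"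
  by (simp add: Legendre_def cong_0_iff)

lemma Legendre_cases: "Legendre a p \<in> {-1, 0, 1}"
  by (simp add: Legendre_def)

lemma abs_Legendre_le: "\<bar>Legendre a p\<bar> \<le> 1"
  by (simp add: Legendre_def)

lemma Legendre_square: "\<not> p dvd a \<Longrightarrow> prime p \<Longrightarrow> Legendre (a ^ 2) p = 1"
  by (metis Legendre_def QuadRes_def cong_0_iff cong_refl prime_dvd_power_iff zero_less_numeral)

text \<open>Euler's criterion gives the congruence modulo \<open>p\<close>. Both sides lie in {-1,
  0, 1}, so their difference is at most 2 < p in absolute value and must vanish.\<close>

lemma Legendre_mult:
  assumes "prime p" "p > 2"
  shows "Legendre (a * b) p = Legendre a p * Legendre b p"
proof -
  have P: "prime (nat p)" "2 < nat p" "int (nat p) = p"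
    using assms by (auto simp: prime_nat_iff_prime)
  note E = euler_criterion[OF P(1,2)]
  have "[Legendre (a * b) p = Legendre a p * Legendre b p] (mod p)"
    using E[of "a * b"] cong_mult[OF E[of a] E[of b]] unfolding P(3)
    by (metis cong_sym cong_trans power_mult_distrib)
  then have d: "p dvd Legendre (a * b) p - Legendre a p * Legendre b p"
    by (simp add: cong_iff_dvd_diff)
  have "\<bar>Legendre (a * b) p - Legendre a p * Legendre b p\<bar> \<le> 2"
    using Legendre_cases[of "a * b" p] Legendre_cases[of a p] Legendre_cases[of b p] by auto
  then show ?thesis using d assms(2) zdvd_not_zless[of "\<bar>Legendre (a * b) p - Legendre a p * Legendre b p\<bar>" p]
    by auto
qed

lemma Legendre_self_mult: "prime p \<Longrightarrow> p > 2 \<Longrightarrow> Legendre a p * Legendre a p = (if p dvd a then 0 else 1)"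
  using Legendre_cases[of a p] by (auto simp: Legendre_eq_0_iff)

text \<open>Squaring identifies 1 and \<open>p - 1\<close>, so it is not injective on the residues
  and hence not surjective. A missed residue is a non-residue; it is nonzero because 0 is a
  square.\<close>

lemma ex_Legendre_minus_one:
  assumes "prime p" "p > (2::int)"
  obtains g where "Legendre g p = -1"
proof -
  let ?f = "\<lambda>x. x\<^sup>2 mod p"
  have sub: "?f ` {0..<p} \<subseteq> {0..<p}" using assms by auto
  have "1\<^sup>2 mod p = (p - 1)\<^sup>2 mod p"
  proof -
    have "(p - 1)\<^sup>2 = 1 + p * (p - 2)" by (simp add: power2_eq_square algebra_simps)
    then show ?thesis by (metis mod_mult_self2 power_one)
  qed
  then have "\<not> inj_on ?f {0..<p}"
    using assms inj_onD[of ?f "{0..<p}" 1 "p - 1"] by auto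
  then have "?f ` {0..<p} \<noteq> {0..<p}"
    by (metis eq_card_imp_inj_on finite_atLeastLessThan_int)
  then obtain g where g: "g \<in> {0..<p}" "g \<notin> ?f ` {0..<p}" using sub by blast
  have "\<not> QuadRes p g"
  proof
    assume "QuadRes p g"
    then obtain y where "[y\<^sup>2 = g] (mod p)" by (auto simp: QuadRes_def)
    then have "g = ?f (y mod p)" using g(1) by (simp add: cong_def power_mod)
    then show False using g assms by auto
  qed
  moreover have "\<not> p dvd g"
  proof
    assume "p dvd g"
    then have "g = 0" using g(1) zdvd_imp_le[of p g] by fastforce
    moreover have "0 \<in> ?f ` {0..<p}" using assms by (intro image_eqI[of _ _ 0]) auto
    ultimately show False using g by blast
  qed
  ultimately show ?thesis using that[of g] by (simp add: Legendre_def cong_0_iff)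
qed

text \<open>Multiplication by a non-residue permutes the residues and reverses the sign of the
  sum.\<close>

lemma sum_Legendre:
  assumes "prime p" "p > (2::int)" "\<not> p dvd \<alpha>"
  shows "(\<Sum>k\<in>{0..<p}. Legendre (\<alpha> * k + \<beta>) p) = 0"
proof -
  have cop: "coprime a p" if "\<not> p dvd a" for a
    using that assms(1) by (metis coprime_commute prime_imp_coprime)
  obtain g where g: "Legendre g p = -1" using ex_Legendre_minus_one[OF assms(1,2)] .
  then have ng: "\<not> p dvd g" using Legendre_eq_0_iff[of g p] by auto
  let ?S = "\<Sum>k\<in>{0..<p}. Legendre k p"
  have "(\<Sum>k\<in>{0..<p}. Legendre (g * k + 0) p) = ?S"
    using assms cop[OF ng] by (intro sum_residues_affine) (auto simp: Legendre_mod)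
  then have "Legendre g p * ?S = ?S"
    by (simp add: Legendre_mult[OF assms(1,2)] sum_distrib_left)
  then have "?S = 0" using g by simp
  then show ?thesis
    using sum_residues_affine[of p \<alpha> "\<lambda>k. Legendre k p" \<beta>] assms cop[OF assms(3)]
    by (simp add: Legendre_mod)
qed

text \<open>Rescaling \<open>k\<close> by \<open>w\<close> shows that all nonzero shifts have the
  same correlation. The sum over all shifts is 0 and the zero shift gives \<open>p - 1\<close>, so
  the other \<open>p - 1\<close> shifts give -1 each.\<close>

lemma sum_Legendre_shift:
  assumes p: "prime p" "p > (2::int)" and w: "\<not> p dvd w"
  shows "(\<Sum>k\<in>{0..<p}. Legendre k p * Legendre (k + w) p) = -1"
proof -
  define S where "S = (\<lambda>w. \<Sum>k\<in>{0..<p}. Legendre k p * Legendre (k + w) p)"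
  have Sw: "S w = S 1" if w: "\<not> p dvd w" for w
  proof -
    have cop: "coprime w p" using w p(1) by (metis coprime_commute prime_imp_coprime)
    have "S w = (\<Sum>k\<in>{0..<p}. Legendre (w * k + 0) p * Legendre ((w * k + 0) + w) p)"
      unfolding S_def using p cop
      by (intro sum_residues_affine[symmetric]) (auto intro!: arg_cong2[where f = "(*)"] Legendre_cong simp: Legendre_mod cong_def mod_simps)
    also have "\<dots> = (\<Sum>k\<in>{0..<p}. (Legendre w p * Legendre w p) * (Legendre k p * Legendre (k + 1) p))"
    proof (intro sum.cong refl)
      fix k
      have "w * k + 0 + w = w * (k + 1)" by (simp add: algebra_simps)
      then show "Legendre (w * k + 0) p * Legendre (w * k + 0 + w) p =
          (Legendre w p * Legendre w p) * (Legendre k p * Legendre (k + 1) p)"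
        by (simp only: Legendre_mult[OF p]) (simp add: Legendre_mult[OF p])
    qed
    also have "\<dots> = S 1" using w by (simp add: Legendre_self_mult[OF p] S_def)
    finally show ?thesis .
  qed
  have "(\<Sum>w\<in>{0..<p}. S w) = (\<Sum>k\<in>{0..<p}. Legendre k p * (\<Sum>w\<in>{0..<p}. Legendre (1 * w + k) p))"
    unfolding S_def by (subst sum.swap) (simp add: sum_distrib_left add.commute)
  also have "\<dots> = 0"
    using p not_prime_unit[of p] by (subst sum_Legendre) auto
  finally have "(\<Sum>w\<in>{0..<p}. S w) = 0" .
  moreover have "{0..<p} = insert 0 {1..<p}" using p by auto
  moreover have "(\<Sum>w\<in>{1..<p}. S w) = (\<Sum>w\<in>{1..<p}. S 1)"
    by (intro sum.cong refl Sw) (auto dest: zdvd_imp_le)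
  ultimately have "S 0 + (p - 1) * S 1 = 0" using p by simp
  moreover have "S 0 = p - 1"
  proof -
    have "S 0 = (\<Sum>k\<in>{0..<p}. if p dvd k then 0 else 1)"
      by (simp add: S_def Legendre_self_mult[OF p])
    also have "\<dots> = (\<Sum>k\<in>{1..<p}. 1)"
    proof (rule sum.mono_neutral_cong_right)
      have "i = 0" if "i \<in> {0..<p} - {1..<p}" for i using that by auto
      then show "\<forall>i\<in>{0..<p} - {1..<p}. (if p dvd i then 0 else 1) = 0" by fastforce
    qed (auto dest: zdvd_imp_le)
    finally show ?thesis using p by simp
  qed
  ultimately have "(p - 1) + (p - 1) * S 1 = 0" by metis
  then have "(p - 1) * (S 1 + 1) = 0" by (simp only: distrib_left) simp
  then have "S 1 = -1" using p by simp
  then show ?thesis using Sw[OF w] by (simp add: S_def)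
qed

text \<open>Reindexing by \<open>\<alpha> * k + u\<close> leads to a shift correlation, whose value
  -1 is exact. The trivial bound \<open>p\<close> enters only when \<open>u\<close> and
  \<open>v\<close> agree modulo \<open>p\<close>.\<close>

lemma abs_sum_Legendre_correlation_le:
  assumes p: "prime p" "p > (2::int)" and \<alpha>: "\<not> p dvd \<alpha>"
  shows "\<bar>\<Sum>k\<in>{0..<p}. Legendre (\<alpha> * k + u) p * Legendre (\<alpha> * k + v) p\<bar> \<le> (if p dvd u - v then p else 1)"
proof (cases "p dvd u - v")
  case True
  have "\<bar>\<Sum>k\<in>{0..<p}. Legendre (\<alpha> * k + u) p * Legendre (\<alpha> * k + v) p\<bar> \<le> (\<Sum>k\<in>{0..<p}. 1)"
    by (intro order_trans[OF sum_abs] sum_mono) (auto simp: abs_mult abs_Legendre_le intro: mult_le_one)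
  then show ?thesis using True p by simp
next
  case False
  have cop: "coprime \<alpha> p" using \<alpha> p(1) by (metis coprime_commute prime_imp_coprime)
  have "(\<Sum>k\<in>{0..<p}. Legendre (\<alpha> * k + u) p * Legendre (\<alpha> * k + v) p)
      = (\<Sum>k\<in>{0..<p}. Legendre (\<alpha> * k + u) p * Legendre ((\<alpha> * k + u) + (v - u)) p)"
    by simp
  also have "\<dots> = (\<Sum>k\<in>{0..<p}. Legendre k p * Legendre (k + (v - u)) p)"
    using p cop by (intro sum_residues_affine[where f = "\<lambda>k. Legendre k p * Legendre (k + (v - u)) p"])
      (auto intro!: arg_cong2[where f = "(*)"] Legendre_cong simp: Legendre_mod cong_def mod_simps)
  also have "\<dots> = -1"
    using False p by (intro sum_Legendre_shift) (auto simp: dvd_diff_commute)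
  finally show ?thesis using False by simp
qed

section \<open>Sums of the discriminant symbol along lines\<close>

text \<open>Modulo a prime this is the finite Radon transform of the discriminant symbol. The line
  enters as an indicator, so that all directions \<open>(l, m)\<close> share one formula.\<close>

definition line_sum :: "nat \<Rightarrow> int \<Rightarrow> int \<Rightarrow> int \<Rightarrow> int \<Rightarrow> int" where
  "line_sum n p l m k = (\<Sum>a\<in>{0..<p}. \<Sum>b\<in>{0..<p}.
     if p dvd l * a + m * b - k then Legendre (Delta n a b) p else 0)"

lemma sum_if_unique:
  assumes "finite A" "x \<in> A" "P x" "\<And>y. y \<in> A \<Longrightarrow> P y \<Longrightarrow> y = x"
  shows "(\<Sum>y\<in>A. if P y then f y else 0) = f x"
proof -
  have "(\<Sum>y\<in>A. if P y then f y else 0) = (\<Sum>y\<in>A. if y = x then f y else 0)"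
    using assms by (intro sum.cong refl) metis
  then show ?thesis using assms(1,2) by simp
qed

text \<open>The root \<open>x\<close> is fixed before \<open>f\<close>, so that one \<open>x\<close>
  evaluates the sum for every summand.\<close>

lemma sum_over_linear_solution:
  fixes u k p :: int
  assumes "prime p" "\<not> p dvd u"
  obtains x where "p dvd u * x - k"
    and "\<And>f :: int \<Rightarrow> int. (\<Sum>y\<in>{0..<p}. if p dvd u * y - k then f y else 0) = f x"
proof -
  have p: "p > 0" using assms(1) by (simp add: prime_gt_0_int)
  have cop: "coprime u p" using assms by (metis coprime_commute prime_imp_coprime)
  then obtain z where z: "[u * z = 1] (mod p)" using cong_solve_coprime_int by blast
  define x where "x = (z * k) mod p"
  have "[u * x = u * (z * k)] (mod p)" unfolding x_def by (simp add: cong_def mod_simps)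
  also have "[u * (z * k) = 1 * k] (mod p)"
    using cong_scalar_right[OF z, of k] by (simp add: mult.assoc)
  finally have x: "[u * x = k] (mod p)" by simp
  have x0: "x \<in> {0..<p}" using p by (simp add: x_def)
  have uniq: "y = x" if y: "y \<in> {0..<p}" "p dvd u * y - k" for y
  proof -
    have "[u * y = k] (mod p)" using y(2) by (simp add: cong_iff_dvd_diff)
    then have "[u * y = u * x] (mod p)" using x by (metis cong_sym cong_trans)
    then have "[y = x] (mod p)" using cop by (simp add: cong_mult_lcancel)
    then show "y = x" using y(1) x0 by (intro cong_less_imp_eq_int) auto
  qed
  have d: "p dvd u * x - k" using x by (simp add: cong_iff_dvd_diff)
  show thesis
    by (rule that[OF d], rule sum_if_unique[where P = "\<lambda>y. p dvd u * y - k", OF _ x0 d uniq]) auto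
qed

section \<open>The blow-up of the discriminant and the second moment over parallel lines\<close>

context
  fixes n :: nat and p :: int
  assumes n: "n \<ge> 5" "odd n" and p: "prime p" "p > int n"
begin

private lemma p2: "p > 2" using n p by linarith

text \<open>As \<open>p > n\<close>, neither \<open>n\<close> nor \<open>n - 1\<close> vanishes
  modulo \<open>p\<close>, and both coefficients of \<open>Delta\<close> are invertible.\<close>

private lemma not_dvd_nn: "\<not> p dvd int n ^ n" "\<not> p dvd (int n - 1) ^ (n - 1)"
proof -
  have "\<not> p dvd int n" "\<not> p dvd int n - 1"
    using p n zdvd_imp_le[of p "int n"] zdvd_imp_le[of p "int n - 1"] by linarith+
  then show "\<not> p dvd int n ^ n" "\<not> p dvd (int n - 1) ^ (n - 1)"
    using p(1) prime_dvd_power by blast+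
qed

private lemma Legendre_even_power:
  assumes "even k" "\<not> p dvd a"
  shows "Legendre (a ^ k) p = 1"
proof -
  have "a ^ k = (a ^ (k div 2))\<^sup>2" using assms(1) by (simp flip: power_mult)
  moreover have "\<not> p dvd a ^ (k div 2)" using assms(2) p(1) prime_dvd_power by blast
  ultimately show ?thesis using Legendre_square p(1) by metis
qed

text \<open>For \<open>b = a * t\<close> both terms of \<open>Delta\<close> contain
  \<open>a ^ (n - 1)\<close>, a nonzero square modulo \<open>p\<close> because \<open>n - 1\<close>
  is even. What remains is linear in \<open>a\<close>.\<close>

lemma Legendre_Delta_blowup:
  assumes "\<not> p dvd a"
  shows "Legendre (Delta n a (a * t)) p
    = Legendre ((int n - 1) ^ (n - 1) * a + int n ^ n * t ^ (n - 1)) p"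
proof -
  have "a ^ n = a ^ (n - 1) * a" using n by (cases n) auto
  then have "Delta n a (a * t) = a ^ (n - 1) * ((int n - 1) ^ (n - 1) * a + int n ^ n * t ^ (n - 1))"
    by (simp add: Delta_def power_mult_distrib algebra_simps)
  then show ?thesis
    using assms n by (simp add: Legendre_mult[OF p(1) p2] Legendre_even_power)
qed

lemma Delta_cong: "[a = a'] (mod m) \<Longrightarrow> [b = b'] (mod m) \<Longrightarrow> [Delta n a b = Delta n a' b'] (mod m)"
  unfolding Delta_def by (intro cong_add cong_mult cong_pow cong_refl)

private lemma residues_split: "(\<Sum>a\<in>{0..<p}. f a) = f 0 + (\<Sum>a\<in>{1..<p}. f a)" for f :: "int \<Rightarrow> int"
proof -
  have "{0..<p} = insert 0 {1..<p}" using p by auto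
  then show ?thesis by simp
qed

private lemma not_dvd_residue: "a \<in> {1..<p} \<Longrightarrow> \<not> p dvd a"
  by (auto dest: zdvd_imp_le)

text \<open>After the blow-up, for fixed \<open>t\<close>, the sum over nonzero \<open>a\<close> of
  the symbol of a linear polynomial is minus its value at \<open>a = 0\<close>. These values add up
  over \<open>t\<close> to the row \<open>a = 0\<close> of the original sum, which they
  cancel.\<close>

lemma sum_Legendre_Delta: "(\<Sum>a\<in>{0..<p}. \<Sum>b\<in>{0..<p}. Legendre (Delta n a b) p) = 0"
proof -
  let ?N1 = "(int n - 1) ^ (n - 1)" and ?N = "int n ^ n"
  have 1: "(\<Sum>b\<in>{0..<p}. Legendre (Delta n a b) p) = (\<Sum>t\<in>{0..<p}. Legendre (?N1 * a + ?N * t ^ (n - 1)) p)"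
    if a: "a \<in> {1..<p}" for a
  proof -
    have nd: "\<not> p dvd a" using a by (rule not_dvd_residue)
    then have cop: "coprime a p" using p(1) by (metis coprime_commute prime_imp_coprime)
    have "(\<Sum>b\<in>{0..<p}. Legendre (Delta n a b) p) = (\<Sum>t\<in>{0..<p}. Legendre (Delta n a (a * t + 0)) p)"
      using cop p2 by (intro sum_residues_affine[symmetric]) (auto intro!: Legendre_cong Delta_cong)
    then show ?thesis by (simp add: Legendre_Delta_blowup[OF nd])
  qed
  have 2: "(\<Sum>a\<in>{1..<p}. Legendre (?N1 * a + c) p) = - Legendre c p" for c
    using sum_Legendre[OF p(1) p2 not_dvd_nn(2), of c] by (simp add: residues_split)
  have "(\<Sum>a\<in>{1..<p}. \<Sum>b\<in>{0..<p}. Legendre (Delta n a b) p)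
      = (\<Sum>a\<in>{1..<p}. \<Sum>t\<in>{0..<p}. Legendre (?N1 * a + ?N * t ^ (n - 1)) p)"
    using 1 by (rule sum.cong[OF refl])
  also have "\<dots> = (\<Sum>t\<in>{0..<p}. - Legendre (?N * t ^ (n - 1)) p)"
    by (subst sum.swap) (simp add: 2 del: One_nat_def)
  also have "\<dots> = - (\<Sum>b\<in>{0..<p}. Legendre (Delta n 0 b) p)"
    using n by (simp add: sum_negf Delta_def zero_power)
  finally show ?thesis by (simp add: residues_split[of "\<lambda>a. \<Sum>b\<in>{0..<p}. Legendre (Delta n a b) p"])
qed

text \<open>This handles the row \<open>a = 0\<close>, which the blow-up leaves out: for nonzero
  \<open>k\<close> the line misses that row if \<open>p\<close> divides \<open>m\<close> and meets
  it in one point otherwise.\<close>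

private lemma sum_solution_le_1:
  assumes "\<not> p dvd k"
  shows "\<bar>\<Sum>b\<in>{0..<p}. if p dvd m * b - k then Legendre (f b) p else 0\<bar> \<le> 1"
proof (cases "p dvd m")
  case True
  then have "\<not> p dvd m * b - k" for b using assms by (metis dvd_diff_right_iff dvd_mult2)
  then show ?thesis by simp
next
  case False
  obtain x where "(\<Sum>b\<in>{0..<p}. if p dvd m * b - k then Legendre (f b) p else 0) = Legendre (f x) p"
    using sum_over_linear_solution[OF p(1) False, of k] by metis
  then show ?thesis by (simp add: abs_Legendre_le)
qed

text \<open>For \<open>k \<noteq> 0\<close>, the part of \<^const>\<open>line_sum\<close> with \<open>a \<noteq> 0\<close>: along \<open>b = a t\<close> the line is met at
  \<open>a = k / (l + m t)\<close>, and the denominator is cleared by a square.\<close>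

private definition G :: "int \<Rightarrow> int \<Rightarrow> int \<Rightarrow> int" where
  "G l m k = (\<Sum>t\<in>{0..<p}. Legendre (l + m * t) p *
     Legendre ((int n - 1) ^ (n - 1) * k + int n ^ n * (t ^ (n - 1) * (l + m * t))) p)"

text \<open>For invertible \<open>u\<close> the only solution is \<open>a = k / u\<close>; inserting
  the square of \<open>Legendre u p\<close>, which is 1, clears the denominator. If \<open>p\<close>
  divides \<open>u\<close>, both sides vanish. Starting at \<open>a = 1\<close> loses nothing, since
  \<open>a = 0\<close> would force \<open>k\<close> to vanish modulo \<open>p\<close>.\<close>

private lemma sum_unique_solution:
  assumes k: "\<not> p dvd k"
  shows "(\<Sum>a\<in>{1..<p}. if p dvd u * a - k then Legendre (N1 * a + c) p else 0)
    = Legendre u p * Legendre (N1 * k + c * u) p"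
proof (cases "p dvd u")
  case True
  then have "\<not> p dvd u * a - k" for a using k by (metis dvd_diff_right_iff dvd_mult2)
  then show ?thesis using True by (simp add: Legendre_eq_0_iff[THEN iffD2])
next
  case False
  obtain x where x: "p dvd u * x - k"
    and sum: "\<And>f :: int \<Rightarrow> int. (\<Sum>y\<in>{0..<p}. if p dvd u * y - k then f y else 0) = f x"
    using sum_over_linear_solution[OF p(1) False, of k] by blast
  have x: "[u * x = k] (mod p)" using x by (simp add: cong_iff_dvd_diff)
  have "(\<Sum>a\<in>{1..<p}. if p dvd u * a - k then Legendre (N1 * a + c) p else 0) = Legendre (N1 * x + c) p"
    using sum[of "\<lambda>a. Legendre (N1 * a + c) p"] k
    by (simp add: residues_split[of "\<lambda>a. if p dvd u * a - k then Legendre (N1 * a + c) p else 0"])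
  also have "\<dots> = Legendre u p * (Legendre u p * Legendre (N1 * x + c) p)"
    using False by (simp add: Legendre_self_mult[OF p(1) p2] flip: mult.assoc)
  also have "Legendre u p * Legendre (N1 * x + c) p = Legendre (N1 * (u * x) + c * u) p"
    by (simp add: Legendre_mult[OF p(1) p2, symmetric] algebra_simps)
  also have "\<dots> = Legendre (N1 * k + c * u) p"
    by (intro Legendre_cong cong_add cong_mult x cong_refl)
  finally show ?thesis .
qed

private lemma line_sum_eq:
  assumes k: "\<not> p dvd k"
  shows "line_sum n p l m k = (\<Sum>b\<in>{0..<p}. if p dvd m * b - k then Legendre (Delta n 0 b) p else 0) + G l m k"
proof -
  let ?N1 = "(int n - 1) ^ (n - 1)" and ?N = "int n ^ n"
  let ?g = "\<lambda>a b. if p dvd l * a + m * b - k then Legendre (Delta n a b) p else 0"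
  have 1: "(\<Sum>b\<in>{0..<p}. ?g a b) = (\<Sum>t\<in>{0..<p}. if p dvd (l + m * t) * a - k then Legendre (?N1 * a + ?N * t ^ (n - 1)) p else 0)"
    if a: "a \<in> {1..<p}" for a
  proof -
    have nd: "\<not> p dvd a" using a by (rule not_dvd_residue)
    then have cop: "coprime a p" using p(1) by (metis coprime_commute prime_imp_coprime)
    have per: "?g a (b mod p) = ?g a b" for b
    proof -
      have "[l * a + m * (b mod p) - k = l * a + m * b - k] (mod p)"
        by (intro cong_diff cong_add cong_mult cong_refl) simp
      then have "p dvd l * a + m * (b mod p) - k \<longleftrightarrow> p dvd l * a + m * b - k"
        by (simp add: cong_dvd_iff)
      moreover have "Legendre (Delta n a (b mod p)) p = Legendre (Delta n a b) p"
        by (intro Legendre_cong Delta_cong) auto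
      ultimately show ?thesis by simp
    qed
    have "(\<Sum>b\<in>{0..<p}. ?g a b) = (\<Sum>t\<in>{0..<p}. ?g a (a * t + 0))"
      using cop p2 per by (intro sum_residues_affine[symmetric]) auto
    also have "\<dots> = (\<Sum>t\<in>{0..<p}. if p dvd (l + m * t) * a - k then Legendre (?N1 * a + ?N * t ^ (n - 1)) p else 0)"
    proof (intro sum.cong refl)
      fix t
      have "l * a + m * (a * t + 0) - k = (l + m * t) * a - k" by (simp add: algebra_simps)
      then show "?g a (a * t + 0) = (if p dvd (l + m * t) * a - k then Legendre (?N1 * a + ?N * t ^ (n - 1)) p else 0)"
        using Legendre_Delta_blowup[OF nd, of t] by simp
    qed
    finally show ?thesis .
  qed
  have "(\<Sum>a\<in>{1..<p}. \<Sum>b\<in>{0..<p}. ?g a b) =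
      (\<Sum>a\<in>{1..<p}. \<Sum>t\<in>{0..<p}. if p dvd (l + m * t) * a - k then Legendre (?N1 * a + ?N * t ^ (n - 1)) p else 0)"
    using 1 by (rule sum.cong[OF refl])
  also have "\<dots> = G l m k"
    unfolding G_def by (subst sum.swap) (simp add: sum_unique_solution[OF k] mult.assoc)
  finally show ?thesis
    by (simp add: line_sum_def residues_split[of "\<lambda>a. \<Sum>b\<in>{0..<p}. ?g a b"])
qed

text \<open>The fibre consists of the roots of a polynomial whose coefficients of degree
  \<open>n\<close> and \<open>n - 1\<close> are \<open>m\<close> and \<open>l\<close>, not both zero
  modulo \<open>p\<close>.\<close>

private lemma card_fibre_le:
  assumes lm: "\<not> (p dvd l \<and> p dvd m)"
  shows "card {t \<in> {0..<p}. p dvd c - t ^ (n - 1) * (l + m * t)} \<le> n"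
proof -
  let ?f = "monom l (n - 1) + monom m n - [:c:]"
  have ev: "poly ?f t = t ^ (n - 1) * (l + m * t) - c" for t
  proof -
    have "t ^ n = t ^ (n - 1) * t" using n by (cases n) auto
    then show ?thesis by (simp add: poly_monom algebra_simps)
  qed
  have "coeff ?f n = m" "coeff ?f (n - 1) = l"
    using n by (auto simp: coeff_pCons split: nat.splits)
  then obtain i where "\<not> p dvd coeff ?f i" using lm by metis
  from card_roots_mod_prime_le[OF p(1) this]
  have "card {t \<in> {0..<p}. p dvd t ^ (n - 1) * (l + m * t) - c} \<le> degree ?f" by (simp only: ev)
  also have "degree ?f \<le> n"
    by (intro degree_diff_le degree_add_le order_trans[OF degree_monom_le]) auto
  finally show ?thesis by (simp add: dvd_diff_commute)
qed

text \<open>Expanding the square and summing over \<open>k\<close> first leaves correlations of two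
  linear polynomials in \<open>k\<close>. For each \<open>t\<close> at most \<open>n\<close> values
  of \<open>s\<close> give a correlation as large as \<open>p\<close>; the others give at most 1
  each.\<close>

private lemma sum_G_square_le:
  assumes lm: "\<not> (p dvd l \<and> p dvd m)"
  shows "(\<Sum>k\<in>{0..<p}. (G l m k)\<^sup>2) \<le> (int n + 1) * p\<^sup>2"
proof -
  let ?N1 = "(int n - 1) ^ (n - 1)" and ?N = "int n ^ n"
  let ?u = "\<lambda>t. Legendre (l + m * t) p" and ?h = "\<lambda>t. t ^ (n - 1) * (l + m * t)"
  let ?C = "\<lambda>t s. \<Sum>k\<in>{0..<p}. Legendre (?N1 * k + ?N * ?h t) p * Legendre (?N1 * k + ?N * ?h s) p"
  have C: "\<bar>?C t s\<bar> \<le> (if p dvd ?h t - ?h s then p else 1)" for t s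
  proof -
    have "p dvd ?N * ?h t - ?N * ?h s \<longleftrightarrow> p dvd ?h t - ?h s"
      using not_dvd_nn p by (simp add: prime_dvd_mult_iff flip: right_diff_distrib)
    then show ?thesis
      using abs_sum_Legendre_correlation_le[OF p(1) p2 not_dvd_nn(2), of "?N * ?h t" "?N * ?h s"] by simp
  qed
  have "(\<Sum>k\<in>{0..<p}. (G l m k)\<^sup>2) = (\<Sum>k\<in>{0..<p}. \<Sum>t\<in>{0..<p}. \<Sum>s\<in>{0..<p}.
      (?u t * Legendre (?N1 * k + ?N * ?h t) p) * (?u s * Legendre (?N1 * k + ?N * ?h s) p))"
    unfolding G_def power2_eq_square sum_product ..
  also have "\<dots> = (\<Sum>t\<in>{0..<p}. \<Sum>s\<in>{0..<p}. \<Sum>k\<in>{0..<p}.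
      (?u t * Legendre (?N1 * k + ?N * ?h t) p) * (?u s * Legendre (?N1 * k + ?N * ?h s) p))"
    by (subst sum.swap, rule sum.cong[OF refl], rule sum.swap)
  also have "\<dots> = (\<Sum>t\<in>{0..<p}. \<Sum>s\<in>{0..<p}. (?u t * ?u s) * ?C t s)"
    by (intro sum.cong refl, subst sum_distrib_left, intro sum.cong refl) (simp add: mult_ac)
  also have "\<dots> \<le> (\<Sum>t\<in>{0..<p}. \<Sum>s\<in>{0..<p}. if p dvd ?h t - ?h s then p else 1)"
  proof (intro sum_mono)
    fix t s
    have "\<bar>(?u t * ?u s) * ?C t s\<bar> \<le> 1 * \<bar>?C t s\<bar>"
      unfolding abs_mult by (intro mult_right_mono mult_le_one) (auto simp: abs_Legendre_le)
    then show "(?u t * ?u s) * ?C t s \<le> (if p dvd ?h t - ?h s then p else 1)"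
      using C[of t s] by linarith
  qed
  also have "\<dots> \<le> (\<Sum>t\<in>{0..<p}. int n * p + p)"
  proof (intro sum_mono)
    fix t
    have "(\<Sum>s\<in>{0..<p}. if p dvd ?h t - ?h s then p else 1) \<le> (\<Sum>s\<in>{0..<p}. (if p dvd ?h t - ?h s then p else 0) + 1)"
      by (intro sum_mono) auto
    also have "\<dots> = int (card {s \<in> {0..<p}. p dvd ?h t - ?h s}) * p + p"
      using p2 by (simp add: sum.distrib sum.inter_filter[symmetric])
    also have "\<dots> \<le> int n * p + p"
      using card_fibre_le[OF lm, of "?h t"] p2 by (intro add_right_mono mult_right_mono) auto
    finally show "(\<Sum>s\<in>{0..<p}. if p dvd ?h t - ?h s then p else 1) \<le> int n * p + p" .
  qed
  also have "\<dots> = (int n + 1) * p\<^sup>2" using p2 by (simp add: power2_eq_square algebra_simps)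
  finally show ?thesis .
qed

text \<open>A line has \<open>p\<close> points. This suffices for \<open>k = 0\<close>, where
  \<open>line_sum_eq\<close> does not apply.\<close>

private lemma abs_line_sum_le:
  assumes lm: "\<not> (p dvd l \<and> p dvd m)"
  shows "\<bar>line_sum n p l m k\<bar> \<le> p"
proof -
  let ?g = "\<lambda>a b. if p dvd l * a + m * b - k then Legendre (Delta n a b) p else 0"
  have one: "\<bar>\<Sum>x\<in>{0..<p}. if p dvd u * x - c then Legendre (f x) p else 0\<bar> \<le> 1"
    if "\<not> p dvd u" for u c f
  proof -
    obtain x where "(\<Sum>x\<in>{0..<p}. if p dvd u * x - c then Legendre (f x) p else 0) = Legendre (f x) p"
      using sum_over_linear_solution[OF p(1) \<open>\<not> p dvd u\<close>, of c] by metis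
    then show ?thesis by (simp add: abs_Legendre_le)
  qed
  have le: "\<bar>\<Sum>a\<in>{0..<p}. F a\<bar> \<le> p" if "\<And>a. \<bar>F a\<bar> \<le> 1" for F :: "int \<Rightarrow> int"
  proof -
    have "\<bar>\<Sum>a\<in>{0..<p}. F a\<bar> \<le> (\<Sum>a\<in>{0..<p}. 1)" by (intro order_trans[OF sum_abs] sum_mono that)
    then show ?thesis using p2 by simp
  qed
  show ?thesis
  proof (cases "p dvd m")
    case False
    have "\<bar>\<Sum>b\<in>{0..<p}. ?g a b\<bar> \<le> 1" for a
      using one[OF False, of "k - l * a" "Delta n a"] by (simp add: algebra_simps)
    then show ?thesis unfolding line_sum_def by (rule le)
  next
    case True
    then have l: "\<not> p dvd l" using lm by simp
    have "\<bar>\<Sum>a\<in>{0..<p}. ?g a b\<bar> \<le> 1" for b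
      using one[OF l, of "k - m * b" "\<lambda>a. Delta n a b"] by (simp add: algebra_simps)
    then show ?thesis unfolding line_sum_def by (subst sum.swap) (rule le)
  qed
qed

text \<open>Bounding each line trivially would give \<open>p ^ 3\<close>; the gain of a factor
  \<open>p\<close> is square-root cancellation on average over parallel lines. The constant collects
  1 from \<open>k = 0\<close>, \<open>2 * (n + 1)\<close> from \<open>G\<close> and 2 from the row
  \<open>a = 0\<close>.\<close>

lemma sum_line_sum_square_le:
  assumes lm: "\<not> (p dvd l \<and> p dvd m)"
  shows "(\<Sum>k\<in>{0..<p}. (line_sum n p l m k)\<^sup>2) \<le> (2 * int n + 5) * p\<^sup>2"
proof -
  let ?V = "line_sum n p l m"
  have 1: "(?V k)\<^sup>2 \<le> 2 * (G l m k)\<^sup>2 + 2" if "k \<in> {1..<p}" for k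
  proof -
    define x where "x = (\<Sum>b\<in>{0..<p}. if p dvd m * b - k then Legendre (Delta n 0 b) p else 0)"
    have nd: "\<not> p dvd k" using that by (rule not_dvd_residue)
    have x: "x\<^sup>2 \<le> 1" using sum_solution_le_1[OF nd, of m "Delta n 0"] by (simp add: x_def abs_square_le_1)
    have "(x - G l m k)\<^sup>2 \<ge> 0" by simp
    then have "(x + G l m k)\<^sup>2 \<le> 2 * x\<^sup>2 + 2 * (G l m k)\<^sup>2" by (simp add: power2_eq_square algebra_simps)
    then show ?thesis using x line_sum_eq[OF nd, of l m] by (simp add: x_def)
  qed
  have "(\<Sum>k\<in>{0..<p}. (?V k)\<^sup>2) = (?V 0)\<^sup>2 + (\<Sum>k\<in>{1..<p}. (?V k)\<^sup>2)" by (rule residues_split)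
  also have "(?V 0)\<^sup>2 \<le> p\<^sup>2"
    using power_mono[OF abs_line_sum_le[OF lm, of 0], of 2] by simp
  also have "(\<Sum>k\<in>{1..<p}. (?V k)\<^sup>2) \<le> (\<Sum>k\<in>{1..<p}. 2 * (G l m k)\<^sup>2 + 2)"
    by (intro sum_mono 1)
  also have "\<dots> \<le> (\<Sum>k\<in>{0..<p}. 2 * (G l m k)\<^sup>2 + 2)"
    by (intro sum_mono2) auto
  also have "\<dots> = 2 * (\<Sum>k\<in>{0..<p}. (G l m k)\<^sup>2) + 2 * p"
    using p2 by (simp add: sum.distrib sum_distrib_left)
  also have "\<dots> \<le> 2 * ((int n + 1) * p\<^sup>2) + 2 * p\<^sup>2"
  proof -
    have "p \<le> p\<^sup>2" using p2 by (simp add: power2_eq_square)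
    then show ?thesis using sum_G_square_le[OF lm] by linarith
  qed
  finally show ?thesis by (simp add: algebra_simps)
qed

end

section \<open>Completion of sums over boxes\<close>

definition addchar :: "int \<Rightarrow> int \<Rightarrow> complex" where
  "addchar m x = cis (2 * pi * real_of_int x / real_of_int m)"

lemma addchar_add: "addchar m (x + y) = addchar m x * addchar m y"
  by (simp add: addchar_def cis_mult add_divide_distrib distrib_left)

lemma addchar_0 [simp]: "addchar m 0 = 1"
  by (simp add: addchar_def)

lemma norm_addchar [simp]: "norm (addchar m x) = 1"
  by (simp add: addchar_def)

lemma cnj_addchar: "cnj (addchar m x) = addchar m (- x)"
  by (simp add: addchar_def cis_cnj)

lemma addchar_mult_cancel: "q \<noteq> 0 \<Longrightarrow> addchar (p * q) (q * x) = addchar p x"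
  by (simp add: addchar_def field_simps)

lemma addchar_dvd: "m dvd x \<Longrightarrow> addchar m x = 1"
proof (cases "m = 0")
  case False
  assume "m dvd x"
  then obtain k where "x = m * k" by blast
  then have "2 * pi * real_of_int x / real_of_int m = 2 * pi * of_int k" using False by simp
  then show ?thesis unfolding addchar_def by (metis Ints_of_int cis_multiple_2pi)
qed auto

lemma addchar_cong: "[x = y] (mod m) \<Longrightarrow> addchar m x = addchar m y"
  using addchar_dvd[of m "x - y"] addchar_add[of m "x - y" y] by (simp add: cong_iff_dvd_diff)

text \<open>Up to \<open>pi / 3\<close> the derivative of \<open>sin y - y / 4\<close> is at least
  1/4. Beyond, \<open>sin y\<close> is at least 1/2, while \<open>y / 4\<close> is below
  1/2.\<close>

lemma sin_ge_quarter:
  assumes "0 \<le> y" "y \<le> pi / 2"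
  shows "sin y \<ge> y / 4"
proof (cases "y \<le> pi / 3")
  case True
  have "(\<lambda>y. sin y - y / 4) 0 \<le> (\<lambda>y. sin y - y / 4) y"
  proof (rule DERIV_nonneg_imp_nondecreasing[OF assms(1)])
    fix x assume "0 \<le> x" "x \<le> y"
    then have "cos x \<ge> cos (pi / 3)" using True by (intro cos_monotone_0_pi_le) auto
    then show "\<exists>z. ((\<lambda>y. sin y - y / 4) has_real_derivative z) (at x) \<and> 0 \<le> z"
      by (intro exI[of _ "cos x - 1 / 4"]) (auto intro!: derivative_eq_intros simp: cos_60)
  qed
  then show ?thesis by simp
next
  case False
  then have "sin y \<ge> sin (pi / 6)" using assms by (intro sin_monotone_2pi_le) auto
  then show ?thesis using assms(2) pi_less_4 by (simp add: sin_30)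
qed

text \<open>The norm equals \<open>2 * \<bar>sin (pi * x / m)\<bar>\<close>, and in the symmetric
  range of \<open>x\<close> the angle is at most \<open>pi / 2\<close> in absolute value.\<close>

lemma norm_addchar_diff_ge:
  assumes "m > 0" "2 * \<bar>x\<bar> \<le> m"
  shows "norm (addchar m x - 1) \<ge> \<bar>real_of_int x\<bar> / real_of_int m"
proof -
  define y where "y = pi * \<bar>real_of_int x\<bar> / real_of_int m"
  have "2 * \<bar>real_of_int x\<bar> \<le> real_of_int m"
    using assms(2) by linarith
  then have y: "0 \<le> y" "y \<le> pi / 2" using assms(1) by (auto simp: y_def field_simps)
  have "(norm (cis t - 1))\<^sup>2 = (2 * sin (t / 2))\<^sup>2" for t
  proof -
    have "(norm (cis t - 1))\<^sup>2 = (cos t - 1)\<^sup>2 + (sin t)\<^sup>2" by (simp add: cmod_power2)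
    also have "\<dots> = 2 - 2 * cos t"
      using sin_cos_squared_add[of t] by (simp add: power2_eq_square algebra_simps)
    also have "cos t = 1 - 2 * (sin (t / 2))\<^sup>2" using cos_double_sin[of "t / 2"] by simp
    finally show ?thesis by (simp add: power2_eq_square)
  qed
  then have n: "norm (cis t - 1) = \<bar>2 * sin (t / 2)\<bar>" for t
    by (metis norm_ge_zero power2_abs abs_ge_zero power2_eq_imp_eq)
  have "norm (addchar m x - 1) = \<bar>2 * sin (pi * real_of_int x / real_of_int m)\<bar>"
    by (simp add: addchar_def n)
  also have "\<dots> = 2 * \<bar>sin y\<bar>"
    by (cases "x \<ge> 0") (auto simp: y_def abs_mult)
  also have "\<dots> \<ge> y / 2" using sin_ge_quarter[OF y] y by linarith
  moreover have "\<bar>real_of_int x\<bar> / real_of_int m \<le> y / 2"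
    unfolding y_def using assms(1) mult_right_mono[OF pi_ge_two abs_ge_zero, of "real_of_int x"]
    by (simp add: field_simps)
  ultimately show ?thesis by linarith
qed

text \<open>For the representative of least absolute value, \<open>norm_addchar_diff_ge\<close>
  applies and forces it to be 0.\<close>

lemma addchar_eq_1_iff:
  assumes "m > 0"
  shows "addchar m x = 1 \<longleftrightarrow> m dvd x"
proof
  assume 1: "addchar m x = 1"
  define r where "r = (if 2 * (x mod m) \<le> m then x mod m else x mod m - m)"
  have c: "[r = x] (mod m)" by (simp add: r_def cong_def)
  have "x mod m \<ge> 0" "x mod m < m" using assms by auto
  then have "2 * \<bar>r\<bar> \<le> m" unfolding r_def by auto
  from norm_addchar_diff_ge[OF assms this] have "\<bar>real_of_int r\<bar> / real_of_int m \<le> 0"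
    using addchar_cong[OF c] 1 by simp
  then have "r = 0" using assms by (simp add: field_simps)
  then show "m dvd x" using c by (metis cong_0_iff cong_sym_eq)
qed (rule addchar_dvd)

lemma sum_addchar:
  assumes "m > 0"
  shows "(\<Sum>k\<in>{0..<m}. addchar m (k * x)) = (if m dvd x then of_int m else 0)"
proof (cases "m dvd x")
  case True
  then have "(\<Sum>k\<in>{0..<m}. addchar m (k * x)) = (\<Sum>k\<in>{0..<m}. 1)"
    by (intro sum.cong refl addchar_dvd) auto
  then show ?thesis using True assms by simp
next
  case False
  let ?S = "\<Sum>k\<in>{0..<m}. addchar m (k * x)"
  have "(\<Sum>k\<in>{0..<m}. addchar m ((1 * k + 1) * x)) = ?S"
    using assms by (intro sum_residues_affine) (auto intro!: addchar_cong simp: cong_def mod_simps)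
  moreover have "(1 * k + 1) * x = x + k * x" for k by (simp add: algebra_simps)
  ultimately have "addchar m x * ?S = ?S"
    by (simp only: sum_distrib_left addchar_add)
  then have "?S = 0" using False by (simp add: addchar_eq_1_iff[OF assms])
  then show ?thesis using False by simp
qed

text \<open>Centred residues are the frequencies for which the geometric sums obey the bound by
  \<open>1 / \<bar>k\<bar>\<close>. They form the interval \<open>{-h..h}\<close> because the
  modulus is odd.\<close>

lemma sum_symmetric_residues:
  fixes f :: "int \<Rightarrow> 'a::comm_monoid_add"
  assumes "m = 2 * h + 1" "h \<ge> 0" "\<And>x. f (x mod m) = f x"
  shows "(\<Sum>k\<in>{-h..h}. f k) = (\<Sum>k\<in>{0..<m}. f k)"
proof -
  have "(\<Sum>k\<in>{-h..h}. f k) = (\<Sum>k\<in>{0..<m}. f (1 * k + (- h)))"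
    using assms(1) by (intro sum.reindex_bij_witness[of _ "\<lambda>k. k - h" "\<lambda>k. k + h"]) auto
  also have "\<dots> = (\<Sum>k\<in>{0..<m}. f k)" using assms by (intro sum_residues_affine) auto
  finally show ?thesis .
qed

text \<open>Multiplied by \<open>addchar m k - 1\<close>, the geometric sum telescopes to a
  difference of two numbers of norm 1.\<close>

lemma norm_sum_addchar_interval_le:
  assumes "m > 0" "2 * \<bar>k\<bar> \<le> m" "k \<noteq> 0"
  shows "norm (\<Sum>u\<in>{c..<c + int L}. addchar m (k * u)) \<le> 2 * real_of_int m / \<bar>real_of_int k\<bar>"
proof -
  let ?S = "\<Sum>u\<in>{c..<c + int L}. addchar m (k * u)"
  have "?S * (addchar m k - 1) = addchar m (k * (c + int L)) - addchar m (k * c)"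
  proof (induction L)
    case (Suc L)
    have "{c..<c + int (Suc L)} = insert (c + int L) {c..<c + int L}" by auto
    then have "(\<Sum>u\<in>{c..<c + int (Suc L)}. addchar m (k * u))
        = addchar m (k * (c + int L)) + (\<Sum>u\<in>{c..<c + int L}. addchar m (k * u))"
      by simp
    then show ?case using Suc by (simp add: distrib_left addchar_add algebra_simps)
  qed simp
  then have "norm ?S * norm (addchar m k - 1) \<le> 2"
    using norm_triangle_ineq4[of "addchar m (k * (c + int L))" "addchar m (k * c)"]
    by (simp flip: norm_mult)
  moreover have "norm ?S * (\<bar>real_of_int k\<bar> / real_of_int m) \<le> norm ?S * norm (addchar m k - 1)"
    using norm_addchar_diff_ge[OF assms(1,2)] by (intro mult_left_mono) auto
  ultimately have "norm ?S * (\<bar>real_of_int k\<bar> / real_of_int m) \<le> 2" by linarith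
  then show ?thesis using assms by (simp add: field_simps)
qed

section \<open>Two-dimensional Fourier inversion and completion\<close>

definition dft2 :: "(int \<Rightarrow> int \<Rightarrow> complex) \<Rightarrow> int \<Rightarrow> int \<Rightarrow> int \<Rightarrow> complex" where
  "dft2 F m l k = (\<Sum>a\<in>{0..<m}. \<Sum>b\<in>{0..<m}. F a b * addchar m (- (l * a + k * b)))"

lemma sum_residue_class:
  fixes f :: "int \<Rightarrow> complex"
  assumes "m > 0" "\<And>x. f (x mod m) = f x"
  shows "(\<Sum>a\<in>{0..<m}. if m dvd x - a then f a else 0) = f x"
proof -
  have "(\<Sum>a\<in>{0..<m}. if m dvd x - a then f a else 0) = f (x mod m)"
  proof (rule sum_if_unique)
    fix y assume y: "y \<in> {0..<m}" "m dvd x - y"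
    then have "[x = y] (mod m)" by (simp add: cong_iff_dvd_diff)
    then show "y = x mod m" using y(1) by (simp add: cong_def)
  qed (use assms(1) in \<open>auto simp: mod_eq_dvd_iff[symmetric]\<close>)
  then show ?thesis by (simp add: assms)
qed

lemma sum_swap2:
  "(\<Sum>x\<in>A. \<Sum>y\<in>B. \<Sum>z\<in>C. f x y z) = (\<Sum>z\<in>C. \<Sum>x\<in>A. \<Sum>y\<in>B. f x y z)"
  by (rule trans[OF sum.cong[OF refl sum.swap] sum.swap])

lemma dft2_inversion:
  assumes m: "m = 2 * h + 1" "h \<ge> 0"
    and per: "\<And>x y. F (x mod m) y = F x y" "\<And>x y. F x (y mod m) = F x y"
  shows "of_int m ^ 2 * F x y = (\<Sum>l\<in>{-h..h}. \<Sum>k\<in>{-h..h}. dft2 F m l k * (addchar m (l * x) * addchar m (k * y)))"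
proof -
  have m0: "m > 0" using m by simp
  have D: "(\<Sum>l\<in>{-h..h}. addchar m (l * z)) = (if m dvd z then of_int m else 0)" for z
    using m0 by (subst sum_symmetric_residues[OF m])
      (auto simp: sum_addchar intro!: addchar_cong simp: cong_def mod_simps)
  have "(\<Sum>l\<in>{-h..h}. \<Sum>k\<in>{-h..h}. dft2 F m l k * (addchar m (l * x) * addchar m (k * y)))
     = (\<Sum>l\<in>{-h..h}. \<Sum>k\<in>{-h..h}. \<Sum>a\<in>{0..<m}. \<Sum>b\<in>{0..<m}.
         F a b * (addchar m (l * (x - a)) * addchar m (k * (y - b))))"
    unfolding dft2_def sum_distrib_right
    by (intro sum.cong refl) (simp add: algebra_simps flip: addchar_add)
  also have "\<dots> = (\<Sum>a\<in>{0..<m}. \<Sum>b\<in>{0..<m}. \<Sum>l\<in>{-h..h}. \<Sum>k\<in>{-h..h}.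
         F a b * (addchar m (l * (x - a)) * addchar m (k * (y - b))))"
    \<comment> \<open>Each round moves the next inner summation in front of the two outer
      ones.\<close>
    by ((rule trans[OF sum_swap2], rule sum.cong, rule refl)+, rule refl)
  also have "\<dots> = (\<Sum>a\<in>{0..<m}. \<Sum>b\<in>{0..<m}. F a b *
      ((\<Sum>l\<in>{-h..h}. addchar m (l * (x - a))) * (\<Sum>k\<in>{-h..h}. addchar m (k * (y - b)))))"
    by (intro sum.cong refl, simp only: sum_distrib_right) (simp only: sum_distrib_left)
  also have "\<dots> = (\<Sum>a\<in>{0..<m}. if m dvd x - a then
      of_int m ^ 2 * (\<Sum>b\<in>{0..<m}. if m dvd y - b then F a b else 0) else 0)"
    by (intro sum.cong refl) (auto simp: D sum_distrib_left power2_eq_square intro!: sum.cong)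
  also have "\<dots> = of_int m ^ 2 * (\<Sum>b\<in>{0..<m}. if m dvd y - b then F x b else 0)"
    using m0 by (rule sum_residue_class) (simp add: per cong: if_cong)
  also have "\<dots> = of_int m ^ 2 * F x y"
    using sum_residue_class[OF m0, of "F x" y] by (simp add: per)
  finally show ?thesis ..
qed

text \<open>The weight of a difference \<open>u - v\<close> is a convolution of two indicators, so
  its transform is a product of two exponential sums. For intervals this product decays like
  \<open>1 / l ^ 2\<close>, and summing over frequencies costs no logarithm.\<close>

lemma completion_inequality:
  assumes m: "m = 2 * h + 1" "h \<ge> 0"
    and per: "\<And>x y. F (x mod m) y = F x y" "\<And>x y. F x (y mod m) = F x y"
  shows "norm (\<Sum>u\<in>I. \<Sum>v\<in>J. \<Sum>u'\<in>I'. \<Sum>v'\<in>J'. F (u - v) (u' - v')) * real_of_int m ^ 2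
    \<le> (\<Sum>l\<in>{-h..h}. \<Sum>k\<in>{-h..h}. norm (dft2 F m l k)
        * (norm (\<Sum>u\<in>I. addchar m (l * u)) * norm (\<Sum>v\<in>J. addchar m (l * v)))
        * (norm (\<Sum>u\<in>I'. addchar m (k * u)) * norm (\<Sum>v\<in>J'. addchar m (k * v))))"
proof -
  let ?S = "\<lambda>A l. \<Sum>u\<in>A. addchar m (l * u)"
  have sep: "(\<Sum>u\<in>A. \<Sum>v\<in>B. addchar m (l * (u - v))) = ?S A l * cnj (?S B l)" for A B l
    by (simp add: sum_product cnj_addchar right_diff_distrib flip: addchar_add)
  have "of_int m ^ 2 * (\<Sum>u\<in>I. \<Sum>v\<in>J. \<Sum>u'\<in>I'. \<Sum>v'\<in>J'. F (u - v) (u' - v'))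
    = (\<Sum>u\<in>I. \<Sum>v\<in>J. \<Sum>u'\<in>I'. \<Sum>v'\<in>J'. \<Sum>l\<in>{-h..h}. \<Sum>k\<in>{-h..h}.
        dft2 F m l k * (addchar m (l * (u - v)) * addchar m (k * (u' - v'))))"
    by (simp add: sum_distrib_left dft2_inversion[where F = F, OF m per])
  also have "\<dots> = (\<Sum>l\<in>{-h..h}. \<Sum>k\<in>{-h..h}. \<Sum>u\<in>I. \<Sum>v\<in>J. \<Sum>u'\<in>I'. \<Sum>v'\<in>J'.
        dft2 F m l k * (addchar m (l * (u - v)) * addchar m (k * (u' - v'))))"
    by (rule sym) ((rule trans[OF sum_swap2], rule sum.cong, rule refl)+, rule refl)
  also have "\<dots> = (\<Sum>l\<in>{-h..h}. \<Sum>k\<in>{-h..h}. dft2 F m l k *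
      ((\<Sum>u\<in>I. \<Sum>v\<in>J. addchar m (l * (u - v))) * (\<Sum>u\<in>I'. \<Sum>v\<in>J'. addchar m (k * (u - v)))))"
    by (intro sum.cong refl, simp only: sum_distrib_right) (simp only: sum_distrib_left)
  finally have eq: "of_int m ^ 2 * (\<Sum>u\<in>I. \<Sum>v\<in>J. \<Sum>u'\<in>I'. \<Sum>v'\<in>J'. F (u - v) (u' - v'))
    = (\<Sum>l\<in>{-h..h}. \<Sum>k\<in>{-h..h}. dft2 F m l k * ((?S I l * cnj (?S J l)) * (?S I' k * cnj (?S J' k))))"
    by (simp only: sep)
  have "norm (\<Sum>u\<in>I. \<Sum>v\<in>J. \<Sum>u'\<in>I'. \<Sum>v'\<in>J'. F (u - v) (u' - v')) * real_of_int m ^ 2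
    = norm (\<Sum>l\<in>{-h..h}. \<Sum>k\<in>{-h..h}. dft2 F m l k * ((?S I l * cnj (?S J l)) * (?S I' k * cnj (?S J' k))))"
  proof -
    have "0 \<le> m" using m by simp
    then show ?thesis unfolding eq[symmetric] by (simp add: norm_mult norm_power)
  qed
  also have "\<dots> \<le> (\<Sum>l\<in>{-h..h}. \<Sum>k\<in>{-h..h}. norm (dft2 F m l k * ((?S I l * cnj (?S J l)) * (?S I' k * cnj (?S J' k)))))"
    by (intro order_trans[OF norm_sum] sum_mono norm_sum)
  finally show ?thesis by (simp only: norm_mult complex_mod_cnj mult.assoc)
qed

section \<open>Mean square of the dilated exponential sums\<close>

text \<open>Under \<open>a = q * x + p * y\<close> the character modulo \<open>p * q\<close> splits
  into characters modulo \<open>p\<close> and \<open>q\<close>. The frequency \<open>(l, k)\<close>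
  stays the same in both factors; the dilation by the other modulus falls on the arguments of
  \<open>f\<close> and \<open>g\<close>.\<close>

lemma dft2_crt:
  assumes pq: "p > 0" "q > 0" "coprime p q"
    and f: "\<And>a b a' b'. [a = a'] (mod p) \<Longrightarrow> [b = b'] (mod p) \<Longrightarrow> f a b = f a' b'"
    and g: "\<And>a b a' b'. [a = a'] (mod q) \<Longrightarrow> [b = b'] (mod q) \<Longrightarrow> g a b = g a' b'"
  shows "dft2 (\<lambda>a b. f a b * g a b) (p * q) l k
    = dft2 (\<lambda>a b. f (q * a) (q * b)) p l k * dft2 (\<lambda>a b. g (p * a) (p * b)) q l k"
proof -
  let ?T = "\<lambda>a b. f a b * g a b * addchar (p * q) (- (l * a + k * b))"
  have T: "?T a b = ?T a' b'" if "[a = a'] (mod p * q)" "[b = b'] (mod p * q)" for a b a' b'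
  proof -
    have "[a = a'] (mod p)" "[b = b'] (mod p)" using that cong_modulus_mult by blast+
    moreover have "[a = a'] (mod q)" "[b = b'] (mod q)"
      using that cong_modulus_mult[of _ _ q p] by (simp_all add: mult.commute)
    moreover have "[- (l * a + k * b) = - (l * a' + k * b')] (mod p * q)"
      using that by (intro cong_uminus cong_add cong_mult cong_refl)
    ultimately show ?thesis using f g addchar_cong by metis
  qed
  have val: "?T (q * x + p * y) (q * x' + p * y')
    = (f (q * x) (q * x') * addchar p (- (l * x + k * x'))) * (g (p * y) (p * y') * addchar q (- (l * y + k * y')))" for x y x' y'
  proof -
    have "- (l * (q * x + p * y) + k * (q * x' + p * y')) = q * (- (l * x + k * x')) + p * (- (l * y + k * y'))"
      by (simp add: algebra_simps)
    moreover have "addchar (p * q) (q * z) = addchar p z" "addchar (p * q) (p * z) = addchar q z" for z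
      using pq addchar_mult_cancel[of q p z] addchar_mult_cancel[of p q z] by (simp_all add: mult.commute)
    ultimately have "addchar (p * q) (- (l * (q * x + p * y) + k * (q * x' + p * y')))
      = addchar p (- (l * x + k * x')) * addchar q (- (l * y + k * y'))"
      by (simp only: addchar_add)
    moreover have "f (q * x + p * y) (q * x' + p * y') = f (q * x) (q * x')"
      by (intro f) (auto simp: cong_def)
    moreover have "g (q * x + p * y) (q * x' + p * y') = g (p * y) (p * y')"
      by (intro g) (auto simp: cong_def)
    ultimately show ?thesis by simp
  qed
  have "dft2 (\<lambda>a b. f a b * g a b) (p * q) l k = (\<Sum>a\<in>{0..<p * q}. \<Sum>b\<in>{0..<p * q}. ?T a b)"
    by (simp add: dft2_def)
  also have "\<dots> = (\<Sum>a\<in>{0..<p * q}. \<Sum>x'\<in>{0..<p}. \<Sum>y'\<in>{0..<q}. ?T a (q * x' + p * y'))"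
    by (intro sum.cong refl sum_residues_crt[OF pq]) (rule T, auto)
  also have "\<dots> = (\<Sum>x\<in>{0..<p}. \<Sum>y\<in>{0..<q}. \<Sum>x'\<in>{0..<p}. \<Sum>y'\<in>{0..<q}. ?T (q * x + p * y) (q * x' + p * y'))"
    by (intro sum_residues_crt[OF pq] sum.cong refl) (rule T, auto)
  also have "\<dots> = (\<Sum>x\<in>{0..<p}. \<Sum>y\<in>{0..<q}. \<Sum>x'\<in>{0..<p}. \<Sum>y'\<in>{0..<q}.
      (f (q * x) (q * x') * addchar p (- (l * x + k * x'))) * (g (p * y) (p * y') * addchar q (- (l * y + k * y'))))"
    by (simp only: val)
  also have "\<dots> = (\<Sum>x\<in>{0..<p}. \<Sum>x'\<in>{0..<p}. \<Sum>y\<in>{0..<q}. \<Sum>y'\<in>{0..<q}.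
      (f (q * x) (q * x') * addchar p (- (l * x + k * x'))) * (g (p * y) (p * y') * addchar q (- (l * y + k * y'))))"
    by (rule sum.cong[OF refl sum.swap])
  also have "\<dots> = dft2 (\<lambda>a b. f (q * a) (q * b)) p l k * dft2 (\<lambda>a b. g (p * a) (p * b)) q l k"
    unfolding dft2_def by (simp only: sum_distrib_right) (simp only: sum_distrib_left)
  finally show ?thesis .
qed

lemma parseval_residues:
  assumes "p > 0"
  shows "(\<Sum>y\<in>{0..<p}. (norm (\<Sum>j\<in>{0..<p}. complex_of_real (V j) * addchar p (- (y * j))))\<^sup>2)
    = real_of_int p * (\<Sum>j\<in>{0..<p}. (V j)\<^sup>2)"
proof -
  let ?z = "\<lambda>y. \<Sum>j\<in>{0..<p}. complex_of_real (V j) * addchar p (- (y * j))"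
  have "complex_of_real (\<Sum>y\<in>{0..<p}. (norm (?z y))\<^sup>2) = (\<Sum>y\<in>{0..<p}. ?z y * cnj (?z y))"
    by (simp only: of_real_sum complex_norm_square)
  also have "\<dots> = (\<Sum>y\<in>{0..<p}. \<Sum>j\<in>{0..<p}. \<Sum>i\<in>{0..<p}. complex_of_real (V j * V i) * addchar p (y * (i - j)))"
  proof -
    have "addchar p (y * (i - j)) = addchar p (- (y * j)) * cnj (addchar p (- (y * i)))" for y i j
      by (simp add: cnj_addchar right_diff_distrib flip: addchar_add)
    then show ?thesis by (simp add: sum_product mult_ac)
  qed
  also have "\<dots> = (\<Sum>j\<in>{0..<p}. \<Sum>i\<in>{0..<p}. \<Sum>y\<in>{0..<p}. complex_of_real (V j * V i) * addchar p (y * (i - j)))"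
    by (subst sum.swap, rule sum.cong[OF refl], rule sum.swap)
  also have "\<dots> = (\<Sum>j\<in>{0..<p}. \<Sum>i\<in>{0..<p}. if i = j then complex_of_real (V j * V i) * of_int p else 0)"
  proof (intro sum.cong refl)
    fix j i assume "j \<in> {0..<p}" "i \<in> {0..<p}"
    then have "p dvd i - j \<longleftrightarrow> i = j"
      by (auto simp: mod_eq_dvd_iff[symmetric])
    then show "(\<Sum>y\<in>{0..<p}. complex_of_real (V j * V i) * addchar p (y * (i - j)))
        = (if i = j then complex_of_real (V j * V i) * of_int p else 0)"
      using sum_addchar[OF assms, of "i - j"] by (simp flip: sum_distrib_left)
  qed
  also have "\<dots> = complex_of_real (real_of_int p * (\<Sum>j\<in>{0..<p}. (V j)\<^sup>2))"
    by (simp add: sum_distrib_left power2_eq_square mult.commute)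
  finally show ?thesis using of_real_eq_iff by blast
qed

section \<open>From dilated transforms to line sums\<close>

definition Legendre_Delta :: "nat \<Rightarrow> int \<Rightarrow> int \<Rightarrow> int \<Rightarrow> complex" where
  "Legendre_Delta n p a b = of_int (Legendre (Delta n a b) p)"

context
  fixes n :: nat and p :: int
  assumes n: "n \<ge> 5" "odd n" and p: "prime p" "p > int n"
begin

private lemma p0: "p > 0" using n p by linarith

lemma Legendre_Delta_cong:
  "[a = a'] (mod p) \<Longrightarrow> [b = b'] (mod p) \<Longrightarrow> Legendre_Delta n p a b = Legendre_Delta n p a' b'"
  unfolding Legendre_Delta_def by (intro arg_cong[where f = of_int] Legendre_cong Delta_cong[OF n p])

text \<open>Scaling the summation variables by the inverse \<open>y\<close> of \<open>x\<close>
  moves the dilation from the symbol to the frequency.\<close>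

private lemma dft2_dilate:
  assumes xy: "[x * y = 1] (mod p)"
  shows "dft2 (\<lambda>a b. Legendre_Delta n p (x * a) (x * b)) p l k
    = (\<Sum>a\<in>{0..<p}. \<Sum>b\<in>{0..<p}. Legendre_Delta n p a b * addchar p (- (y * (l * a + k * b))))"
proof -
  let ?T = "\<lambda>a b. Legendre_Delta n p (x * a) (x * b) * addchar p (- (l * a + k * b))"
  have cop: "coprime y p" using xy
    by (metis coprime_iff_invertible_int mult.commute)
  have T: "?T a b = ?T a' b'" if "[a = a'] (mod p)" "[b = b'] (mod p)" for a b a' b'
  proof -
    have "[- (l * a + k * b) = - (l * a' + k * b')] (mod p)"
      using that by (intro cong_uminus cong_add cong_mult cong_refl)
    moreover have "[x * a = x * a'] (mod p)" "[x * b = x * b'] (mod p)"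
      using that by (auto intro: cong_mult cong_refl)
    ultimately show ?thesis using Legendre_Delta_cong addchar_cong by metis
  qed
  have "dft2 (\<lambda>a b. Legendre_Delta n p (x * a) (x * b)) p l k = (\<Sum>a\<in>{0..<p}. \<Sum>b\<in>{0..<p}. ?T a b)"
    by (simp add: dft2_def)
  also have "\<dots> = (\<Sum>a\<in>{0..<p}. \<Sum>b\<in>{0..<p}. ?T a (y * b + 0))"
  proof (rule sum.cong[OF refl])
    fix a
    show "(\<Sum>b\<in>{0..<p}. ?T a b) = (\<Sum>b\<in>{0..<p}. ?T a (y * b + 0))"
      using p0 cop by (intro sum_residues_affine[symmetric, where f = "?T a"] T) auto
  qed
  also have "\<dots> = (\<Sum>a\<in>{0..<p}. \<Sum>b\<in>{0..<p}. ?T (y * a + 0) (y * b + 0))"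
    by (rule sum_residues_affine[symmetric, where f = "\<lambda>a. \<Sum>b\<in>{0..<p}. ?T a (y * b + 0)"],
      rule p0, rule cop, rule sum.cong[OF refl], rule T, auto)
  also have "\<dots> = (\<Sum>a\<in>{0..<p}. \<Sum>b\<in>{0..<p}. Legendre_Delta n p a b * addchar p (- (y * (l * a + k * b))))"
  proof (intro sum.cong refl)
    fix a b
    have "[x * y * c = 1 * c] (mod p)" for c by (intro cong_mult xy cong_refl)
    then have "[x * (y * c) = c] (mod p)" for c by (simp add: mult.assoc)
    then have "Legendre_Delta n p (x * (y * a)) (x * (y * b)) = Legendre_Delta n p a b"
      by (intro Legendre_Delta_cong)
    then show "?T (y * a + 0) (y * b + 0) = Legendre_Delta n p a b * addchar p (- (y * (l * a + k * b)))"
      by (simp add: algebra_simps)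
  qed
  finally show ?thesis .
qed

text \<open>Grouping the points by \<open>j = l * a + k * b\<close> is the projection-slice
  principle: along the ray through \<open>(l, k)\<close> the transform is the one-dimensional
  transform of the line sums.\<close>

private lemma dft2_dilate_line_sum:
  assumes xy: "[x * y = 1] (mod p)"
  shows "dft2 (\<lambda>a b. Legendre_Delta n p (x * a) (x * b)) p l k
    = (\<Sum>j\<in>{0..<p}. complex_of_real (real_of_int (line_sum n p l k j)) * addchar p (- (y * j)))"
proof -
  have "(\<Sum>j\<in>{0..<p}. complex_of_real (real_of_int (line_sum n p l k j)) * addchar p (- (y * j)))
      = (\<Sum>j\<in>{0..<p}. \<Sum>a\<in>{0..<p}. \<Sum>b\<in>{0..<p}. if p dvd l * a + k * b - j then
          Legendre_Delta n p a b * addchar p (- (y * j)) else 0)"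
    by (simp add: line_sum_def sum_distrib_right Legendre_Delta_def if_distrib if_distribR cong: if_cong)
  also have "\<dots> = (\<Sum>a\<in>{0..<p}. \<Sum>b\<in>{0..<p}. \<Sum>j\<in>{0..<p}. if p dvd l * a + k * b - j then
          Legendre_Delta n p a b * addchar p (- (y * j)) else 0)"
    by (subst sum.swap, rule sum.cong[OF refl], rule sum.swap)
  also have "\<dots> = (\<Sum>a\<in>{0..<p}. \<Sum>b\<in>{0..<p}. Legendre_Delta n p a b * addchar p (- (y * (l * a + k * b))))"
  proof (intro sum.cong refl)
    fix a b
    show "(\<Sum>j\<in>{0..<p}. if p dvd l * a + k * b - j then Legendre_Delta n p a b * addchar p (- (y * j)) else 0)
        = Legendre_Delta n p a b * addchar p (- (y * (l * a + k * b)))"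
    proof (rule sum_residue_class[OF p0, where f = "\<lambda>j. Legendre_Delta n p a b * addchar p (- (y * j))"])
      fix j
      have "[- (y * (j mod p)) = - (y * j)] (mod p)" by (intro cong_uminus cong_mult cong_refl) simp
      then show "Legendre_Delta n p a b * addchar p (- (y * (j mod p))) = Legendre_Delta n p a b * addchar p (- (y * j))"
        using addchar_cong by metis
    qed
  qed
  finally show ?thesis using dft2_dilate[OF xy, of l k] by simp
qed

text \<open>Distinct dilations have distinct inverses, so the left side is part of the Parseval sum
  over all \<open>y\<close>, which is \<open>p\<close> times the second moment of the line sums. If
  \<open>(l, k)\<close> is zero modulo \<open>p\<close> there are no parallel lines, but then each
  term is the complete sum of the symbol, which is 0.\<close>

lemma sum_norm_dft2_dilate_square_le:
  assumes X: "finite X" "\<And>x. x \<in> X \<Longrightarrow> coprime x p"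
    and inj: "\<And>x x'. x \<in> X \<Longrightarrow> x' \<in> X \<Longrightarrow> [x = x'] (mod p) \<Longrightarrow> x = x'"
  shows "(\<Sum>x\<in>X. (norm (dft2 (\<lambda>a b. Legendre_Delta n p (x * a) (x * b)) p l k))\<^sup>2)
    \<le> (2 * real n + 5) * real_of_int p ^ 3"
proof -
  have "\<exists>y. y \<in> {0..<p} \<and> [x * y = 1] (mod p)" if "x \<in> X" for x
  proof -
    obtain z where "[x * z = 1] (mod p)" using cong_solve_coprime_int X(2)[OF \<open>x \<in> X\<close>] by blast
    then have "[x * (z mod p) = 1] (mod p)" by (simp add: cong_def mod_simps)
    then show ?thesis using p0 by (intro exI[of _ "z mod p"]) auto
  qed
  then obtain y where y: "\<And>x. x \<in> X \<Longrightarrow> y x \<in> {0..<p} \<and> [x * y x = 1] (mod p)" by metis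
  have injy: "inj_on y X"
  proof (rule inj_onI)
    fix x x' assume x: "x \<in> X" "x' \<in> X" "y x = y x'"
    have "[x * (x' * y x') = x * 1] (mod p)" using y[OF x(2)] by (intro cong_mult cong_refl) auto
    moreover have "[x' * (x * y x) = x' * 1] (mod p)" using y[OF x(1)] by (intro cong_mult cong_refl) auto
    ultimately have "[x = x'] (mod p)" using x(3)
      by (simp add: mult.left_commute[of x']) (metis cong_sym cong_trans)
    then show "x = x'" using inj x by blast
  qed
  show ?thesis
  proof (cases "p dvd l \<and> p dvd k")
    case True
    have "dft2 (\<lambda>a b. Legendre_Delta n p (x * a) (x * b)) p l k = 0" if "x \<in> X" for x
    proof -
      have "dft2 (\<lambda>a b. Legendre_Delta n p (x * a) (x * b)) p l k
        = (\<Sum>a\<in>{0..<p}. \<Sum>b\<in>{0..<p}. Legendre_Delta n p a b * addchar p (- (y x * (l * a + k * b))))"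
        using y[OF that] by (intro dft2_dilate) auto
      also have "\<dots> = (\<Sum>a\<in>{0..<p}. \<Sum>b\<in>{0..<p}. Legendre_Delta n p a b)"
        using True by (intro sum.cong refl) (simp add: addchar_dvd)
      also have "\<dots> = of_int (\<Sum>a\<in>{0..<p}. \<Sum>b\<in>{0..<p}. Legendre (Delta n a b) p)"
        by (simp add: Legendre_Delta_def)
      finally show ?thesis by (simp only: sum_Legendre_Delta[OF n p]) simp
    qed
    then show ?thesis using p0 by simp
  next
    case False
    let ?V = "\<lambda>j. real_of_int (line_sum n p l k j)"
    let ?z = "\<lambda>y. (norm (\<Sum>j\<in>{0..<p}. complex_of_real (?V j) * addchar p (- (y * j))))\<^sup>2"
    have "(\<Sum>x\<in>X. (norm (dft2 (\<lambda>a b. Legendre_Delta n p (x * a) (x * b)) p l k))\<^sup>2) = (\<Sum>x\<in>X. ?z (y x))"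
    proof (rule sum.cong[OF refl])
      fix x assume "x \<in> X"
      then show "(norm (dft2 (\<lambda>a b. Legendre_Delta n p (x * a) (x * b)) p l k))\<^sup>2 = ?z (y x)"
        using dft2_dilate_line_sum[of x "y x" l k] y by simp
    qed
    also have "\<dots> = (\<Sum>y\<in>y ` X. ?z y)" using injy by (simp add: sum.reindex)
    also have "\<dots> \<le> (\<Sum>y\<in>{0..<p}. ?z y)" using y by (intro sum_mono2) auto
    also have "\<dots> = real_of_int p * (\<Sum>j\<in>{0..<p}. (?V j)\<^sup>2)" by (rule parseval_residues[OF p0])
    also have "(\<Sum>j\<in>{0..<p}. (?V j)\<^sup>2) = real_of_int (\<Sum>j\<in>{0..<p}. (line_sum n p l k j)\<^sup>2)" by simp
    also have "real_of_int p * \<dots> \<le> real_of_int p * real_of_int ((2 * int n + 5) * p\<^sup>2)"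
      using sum_line_sum_square_le[OF n p False] p0 by (intro mult_left_mono) (simp_all only: of_int_le_iff of_int_0_le_iff)
    also have "\<dots> = (2 * real n + 5) * real_of_int p ^ 3"
      by (simp add: power2_eq_square power3_eq_cube)
    finally show ?thesis .
  qed
qed

end

section \<open>The square sieve\<close>

text \<open>The last term on the right is what makes the induction telescope, through
  \<open>1 / (x + 1) ^ 2 \<le> 1 / x - 1 / (x + 1)\<close>.\<close>

lemma sum_inverse_square_shift_le:
  fixes s :: real
  assumes "s > 0"
  shows "(\<Sum>l\<in>{- int L..int L}. 1 / (\<bar>real_of_int l\<bar> + s)\<^sup>2) \<le> 1 / s\<^sup>2 + 2 / s - 2 / (real L + s)"
proof (induction L)
  case (Suc L)
  have "{- int (Suc L)..int (Suc L)} = insert (int (Suc L)) (insert (- int (Suc L)) {- int L..int L})"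
    by auto
  then have "(\<Sum>l\<in>{- int (Suc L)..int (Suc L)}. 1 / (\<bar>real_of_int l\<bar> + s)\<^sup>2)
      = 2 / (real (Suc L) + s)\<^sup>2 + (\<Sum>l\<in>{- int L..int L}. 1 / (\<bar>real_of_int l\<bar> + s)\<^sup>2)"
    by (simp add: add.commute[of "real L"])
  moreover have "2 / (real (Suc L) + s)\<^sup>2 \<le> 2 / (real L + s) - 2 / (real (Suc L) + s)"
  proof -
    define x where "x = real L + s"
    have x: "x > 0" using assms by (simp add: x_def add_nonneg_pos)
    have "2 / (x + 1)\<^sup>2 \<le> 2 / (x * (x + 1))"
      using x by (intro divide_left_mono) (auto simp: power2_eq_square intro!: mult_pos_pos)
    also have "\<dots> = 2 / x - 2 / (x + 1)" using x by (simp add: field_simps)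
    finally show ?thesis by (simp add: x_def algebra_simps)
  qed
  ultimately show ?case using Suc by linarith
qed (use assms in simp)

text \<open>A multiple of \<open>min(H, M / \<bar>l\<bar>)\<^sup>2\<close>, in a form whose sum over \<open>l\<close> telescopes.\<close>

definition fejer_majorant :: "real \<Rightarrow> nat \<Rightarrow> int \<Rightarrow> real" where
  "fejer_majorant M H l = 8 * M\<^sup>2 / (\<bar>real_of_int l\<bar> + M / real H)\<^sup>2"

lemma sum_fejer_majorant_le:
  assumes "M > 0" "H > 0"
  shows "(\<Sum>l\<in>{- int L..int L}. fejer_majorant M H l) \<le> 8 * real H * (real H + 2 * M)"
proof -
  define s where "s = M / real H"
  have s: "s > 0" using assms by (simp add: s_def)
  have "(\<Sum>l\<in>{- int L..int L}. fejer_majorant M H l)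
      = 8 * M\<^sup>2 * (\<Sum>l\<in>{- int L..int L}. 1 / (\<bar>real_of_int l\<bar> + s)\<^sup>2)"
    by (simp add: fejer_majorant_def s_def sum_distrib_left)
  also have "\<dots> \<le> 8 * M\<^sup>2 * (1 / s\<^sup>2 + 2 / s)"
  proof (intro mult_left_mono)
    have "2 / (real L + s) \<ge> 0" using s by simp
    then show "(\<Sum>l\<in>{- int L..int L}. 1 / (\<bar>real_of_int l\<bar> + s)\<^sup>2) \<le> 1 / s\<^sup>2 + 2 / s"
      using sum_inverse_square_shift_le[OF s, of L] by linarith
  qed simp
  also have "\<dots> = 8 * real H * (real H + 2 * M)"
    using assms by (simp add: s_def field_simps power2_eq_square)
  finally show ?thesis .
qed

text \<open>Up to a factor 2 for the longer interval, each sum is at most the minimum of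
  \<open>H\<close> and \<open>M / \<bar>l\<bar>\<close>. That minimum is at most
  \<open>2 * M / (\<bar>l\<bar> + M / H)\<close>, since the larger of two numbers is at least half
  their sum. The 8 in \<open>fejer_majorant\<close> is 2 * 2 * 2. Stating the result for any
  \<open>M\<close> above \<open>2 * m\<close> lets one majorant serve all moduli.\<close>

lemma norm_interval_products_le:
  assumes m: "m > 0" "2 * \<bar>l\<bar> \<le> m" and M: "2 * real_of_int m \<le> M" and H: "H > 0"
  shows "norm (\<Sum>u\<in>{c..<c + 2 * int H}. addchar m (l * u)) * norm (\<Sum>v\<in>{0..<int H}. addchar m (l * v))
    \<le> fejer_majorant M H l"
proof -
  define s where "s = M / real H"
  have M0: "M > 0" using m(1) M by linarith
  have s: "s > 0" using M0 H by (simp add: s_def)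
  have triv: "norm (\<Sum>u\<in>{e..<e + int G}. addchar m (l * u)) \<le> real G" for e G
  proof -
    have "norm (\<Sum>u\<in>{e..<e + int G}. addchar m (l * u)) \<le> (\<Sum>u\<in>{e..<e + int G}. 1)"
      by (rule order_trans[OF norm_sum]) simp
    then show ?thesis by simp
  qed
  have bound: "x \<le> 2 * M / (\<bar>real_of_int l\<bar> + s)" if x: "x \<le> real H" "l \<noteq> 0 \<Longrightarrow> x \<le> M / \<bar>real_of_int l\<bar>" for x
  proof (cases "\<bar>real_of_int l\<bar> \<le> s")
    case True
    have "real H = 2 * M / (s + s)" using M0 H by (simp add: s_def)
    also have "\<dots> \<le> 2 * M / (\<bar>real_of_int l\<bar> + s)" using True s M0 by (intro divide_left_mono) auto
    finally show ?thesis using x(1) by linarith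
  next
    case False
    then have l: "l \<noteq> 0" using s by auto
    have "M / \<bar>real_of_int l\<bar> = 2 * M / (\<bar>real_of_int l\<bar> + \<bar>real_of_int l\<bar>)" by simp
    also have "\<dots> \<le> 2 * M / (\<bar>real_of_int l\<bar> + s)" using False s M0 l by (intro divide_left_mono) auto
    finally show ?thesis using x(2)[OF l] by linarith
  qed
  have far: "norm (\<Sum>u\<in>{e..<e + int G}. addchar m (l * u)) \<le> M / \<bar>real_of_int l\<bar>" if "l \<noteq> 0" for e G
    by (rule order_trans[OF norm_sum_addchar_interval_le[OF m that]])
      (use M in \<open>auto intro: divide_right_mono\<close>)
  have 1: "norm (\<Sum>v\<in>{0..<int H}. addchar m (l * v)) \<le> 2 * M / (\<bar>real_of_int l\<bar> + s)"
    using triv[of 0 H] far[of 0 H] by (intro bound) auto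
  have 2: "norm (\<Sum>u\<in>{c..<c + 2 * int H}. addchar m (l * u)) / 2 \<le> 2 * M / (\<bar>real_of_int l\<bar> + s)"
  proof (rule bound)
    show "norm (\<Sum>u\<in>{c..<c + 2 * int H}. addchar m (l * u)) / 2 \<le> real H"
      using triv[of c "2 * H"] by simp
    assume "l \<noteq> 0"
    have half: "x / 2 \<le> y" if "x \<le> y" "0 \<le> x" for x y :: real using that by linarith
    show "norm (\<Sum>u\<in>{c..<c + 2 * int H}. addchar m (l * u)) / 2 \<le> M / \<bar>real_of_int l\<bar>"
      using far[OF \<open>l \<noteq> 0\<close>, of c "2 * H"] by (intro half) simp_all
  qed
  have "norm (\<Sum>u\<in>{c..<c + 2 * int H}. addchar m (l * u)) * norm (\<Sum>v\<in>{0..<int H}. addchar m (l * v))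
     \<le> (2 * (2 * M / (\<bar>real_of_int l\<bar> + s))) * (2 * M / (\<bar>real_of_int l\<bar> + s))"
    using 1 2 by (intro mult_mono) (auto intro!: divide_nonneg_nonneg simp: M0[THEN less_imp_le] s[THEN less_imp_le])
  also have "\<dots> = fejer_majorant M H l"
    by (simp add: fejer_majorant_def s_def power2_eq_square)
  finally show ?thesis .
qed

text \<open>A point of the box with corner \<open>(c, d)\<close> and sides \<open>H\<close>,
  \<open>K\<close> has exactly \<open>H * K\<close> representations as
  \<open>(u - v, u' - v')\<close>: every shift \<open>v\<close> of an element of the short interval
  stays in the interval of double length.\<close>

definition box_correlation :: "nat \<Rightarrow> int \<Rightarrow> nat \<Rightarrow> int \<Rightarrow> nat \<Rightarrow> int \<Rightarrow> int \<Rightarrow> complex" where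
  "box_correlation n c H d K p q = (\<Sum>u\<in>{c..<c + 2 * int H}. \<Sum>v\<in>{0..<int H}. \<Sum>u'\<in>{d..<d + 2 * int K}. \<Sum>v'\<in>{0..<int K}.
     Legendre_Delta n p (u - v) (u' - v') * Legendre_Delta n q (u - v) (u' - v'))"

text \<open>The arguments are ordered: \<open>p\<close> is the modulus and \<open>q\<close> the
  dilation.\<close>

definition dilate_norm :: "nat \<Rightarrow> int \<Rightarrow> int \<Rightarrow> int \<Rightarrow> int \<Rightarrow> real" where
  "dilate_norm n l k p q = norm (dft2 (\<lambda>a b. Legendre_Delta n p (q * a) (q * b)) p l k)"

section \<open>The sieve over the primes of the window \<open>(N, 2 N]\<close>\<close>

context
  fixes n :: nat and N :: int and P :: "int set"
  assumes n: "n \<ge> 5" "odd n" and N: "int n \<le> N" and finP: "finite P"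
    and P: "\<And>p. p \<in> P \<Longrightarrow> prime p" "\<And>p. p \<in> P \<Longrightarrow> N < p" "\<And>p. p \<in> P \<Longrightarrow> p \<le> 2 * N"
begin

private lemma gtn: "p \<in> P \<Longrightarrow> int n < p"
  using P(2) N by (meson le_less_trans)

private lemma coprimeP: "p \<in> P \<Longrightarrow> q \<in> P \<Longrightarrow> p \<noteq> q \<Longrightarrow> coprime p q"
  using P(1) primes_coprime by blast

private lemma LD_periodic:
  assumes "p \<in> P"
  shows "[a = a'] (mod p) \<Longrightarrow> [b = b'] (mod p) \<Longrightarrow> Legendre_Delta n p a b = Legendre_Delta n p a' b'"
  using Legendre_Delta_cong[OF n P(1)[OF assms] gtn[OF assms]] .

text \<open>Completion modulo \<open>p * q\<close> followed by \<open>dft2_crt\<close>. As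
  \<open>p * q\<close> lies between \<open>N ^ 2\<close> and \<open>4 * N ^ 2\<close>, the frequency
  range, the majorants and the normalisation are replaced by ones depending on \<open>N\<close>
  only, so that \<open>p\<close> and \<open>q\<close> can later be averaged at a fixed
  frequency.\<close>

private lemma norm_box_correlation_le:
  assumes pq: "p \<in> P" "q \<in> P" "p \<noteq> q" and HK: "H > 0" "K > 0"
  shows "norm (box_correlation n c H d K p q) * real_of_int N ^ 4
    \<le> (\<Sum>l\<in>{-(2 * N\<^sup>2)..2 * N\<^sup>2}. \<Sum>k\<in>{-(2 * N\<^sup>2)..2 * N\<^sup>2}.
        (dilate_norm n l k p q * dilate_norm n l k q p) * (fejer_majorant (8 * (real_of_int N)\<^sup>2) H l * fejer_majorant (8 * (real_of_int N)\<^sup>2) K k))"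
proof -
  let ?m = "p * q"
  define h where "h = (?m - 1) div 2"
  have p: "p > N" "q > N" "p \<le> 2 * N" "q \<le> 2 * N" "N > 4" using pq P(2,3) N n by auto
  have odd: "odd p" "odd q"
    using prime_odd_int[of p] prime_odd_int[of q] P(1) pq(1,2) p by auto
  then have m: "?m = 2 * h + 1" unfolding h_def by (auto elim!: oddE)
  have m0: "?m > 0" using p by (intro mult_pos_pos) auto
  have h0: "h \<ge> 0" using m m0 by linarith
  have "?m \<le> (2 * N) * (2 * N)" using p by (intro mult_mono) auto
  then have m4: "?m \<le> 4 * N\<^sup>2" by (simp add: power2_eq_square)
  then have hN: "h \<le> 2 * N\<^sup>2" using m by linarith
  let ?F = "\<lambda>a b. Legendre_Delta n p a b * Legendre_Delta n q a b"
  have Fc: "?F a b = ?F a' b'" if "[a = a'] (mod p * q)" "[b = b'] (mod p * q)" for a b a' b'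
  proof -
    have "[a = a'] (mod p)" "[b = b'] (mod p)" using that cong_modulus_mult by blast+
    moreover have "[a = a'] (mod q)" "[b = b'] (mod q)"
      using that cong_modulus_mult[of _ _ q p] by (simp_all add: mult.commute)
    ultimately show ?thesis using LD_periodic[OF pq(1)] LD_periodic[OF pq(2)] by metis
  qed
  have per: "?F (x mod ?m) y = ?F x y" "?F x (y mod ?m) = ?F x y" for x y
    by (rule Fc; simp)+
  have dft: "norm (dft2 ?F ?m l k) = dilate_norm n l k p q * dilate_norm n l k q p" for l k
    unfolding dilate_norm_def
    by (subst dft2_crt) (use p coprimeP[OF pq] LD_periodic pq in \<open>auto simp: norm_mult\<close>)
  have maj: "norm (\<Sum>u\<in>{c..<c + 2 * int H}. addchar ?m (l * u)) * norm (\<Sum>v\<in>{0..<int H}. addchar ?m (l * v))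
     \<le> fejer_majorant (8 * (real_of_int N)\<^sup>2) H l" if "l \<in> {-h..h}" "H > 0" for l c H
  proof (rule norm_interval_products_le[OF m0 _ _ that(2)])
    show "2 * \<bar>l\<bar> \<le> ?m" using that m by auto
    have "real_of_int ?m \<le> real_of_int (4 * N\<^sup>2)" using m4 of_int_le_iff by blast
    then show "2 * real_of_int ?m \<le> 8 * (real_of_int N)\<^sup>2" by simp
  qed
  let ?t = "\<lambda>l k. (dilate_norm n l k p q * dilate_norm n l k q p) * (fejer_majorant (8 * (real_of_int N)\<^sup>2) H l * fejer_majorant (8 * (real_of_int N)\<^sup>2) K k)"
  have t0: "?t l k \<ge> 0" for l k
    by (intro mult_nonneg_nonneg) (auto simp: dilate_norm_def fejer_majorant_def)
  have "N\<^sup>2 \<le> ?m" unfolding power2_eq_square using p by (intro mult_mono) auto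
  then have "real_of_int (N\<^sup>2) \<le> real_of_int ?m" using of_int_le_iff by blast
  then have "real_of_int (N\<^sup>2) ^ 2 \<le> real_of_int ?m ^ 2" by (intro power_mono) auto
  then have "real_of_int N ^ 4 \<le> real_of_int ?m ^ 2" by (simp flip: power_mult)
  then have "norm (box_correlation n c H d K p q) * real_of_int N ^ 4
     \<le> norm (box_correlation n c H d K p q) * real_of_int ?m ^ 2" by (intro mult_left_mono) auto
  also have "\<dots> \<le> (\<Sum>l\<in>{-h..h}. \<Sum>k\<in>{-h..h}. norm (dft2 ?F ?m l k)
        * (norm (\<Sum>u\<in>{c..<c + 2 * int H}. addchar ?m (l * u)) * norm (\<Sum>v\<in>{0..<int H}. addchar ?m (l * v)))
        * (norm (\<Sum>u\<in>{d..<d + 2 * int K}. addchar ?m (k * u)) * norm (\<Sum>v\<in>{0..<int K}. addchar ?m (k * v))))"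
    unfolding box_correlation_def by (rule completion_inequality[where F = ?F, OF m h0 per])
  also have "\<dots> \<le> (\<Sum>l\<in>{-h..h}. \<Sum>k\<in>{-h..h}. ?t l k)"
    unfolding dft mult.assoc[of "dilate_norm n _ _ p q * dilate_norm n _ _ q p"]
    using HK by (intro sum_mono mult_left_mono mult_mono maj) (auto simp: dilate_norm_def fejer_majorant_def)
  also have "\<dots> \<le> (\<Sum>l\<in>{-(2 * N\<^sup>2)..2 * N\<^sup>2}. \<Sum>k\<in>{-h..h}. ?t l k)"
    using hN by (intro sum_mono2 sum_nonneg t0) auto
  also have "\<dots> \<le> (\<Sum>l\<in>{-(2 * N\<^sup>2)..2 * N\<^sup>2}. \<Sum>k\<in>{-(2 * N\<^sup>2)..2 * N\<^sup>2}. ?t l k)"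
    using hN by (intro sum_mono sum_mono2 t0) auto
  finally show ?thesis .
qed

text \<open>Two primes of the window differ by less than \<open>p\<close>, so they are distinct
  dilations modulo \<open>p\<close>.\<close>

private lemma sum_dilate_norm_square_le:
  assumes p: "p \<in> P"
  shows "(\<Sum>q\<in>P - {p}. (dilate_norm n l k p q)\<^sup>2) \<le> (2 * real n + 5) * (8 * real_of_int N ^ 3)"
proof -
  have "(\<Sum>q\<in>P - {p}. (dilate_norm n l k p q)\<^sup>2) \<le> (2 * real n + 5) * real_of_int p ^ 3"
    unfolding dilate_norm_def
  proof (rule sum_norm_dft2_dilate_square_le[OF n P(1)[OF p] gtn[OF p]])
    fix q q' assume q: "q \<in> P - {p}" "q' \<in> P - {p}" "[q = q'] (mod p)"
    then have "p dvd q - q'" by (simp add: cong_iff_dvd_diff)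
    moreover have "\<bar>q - q'\<bar> < p" using q P(2,3)[of q] P(2,3)[of q'] P(2)[OF p] by auto
    ultimately show "q = q'" using zdvd_imp_le[of p "\<bar>q - q'\<bar>"] by auto
  qed (use finP coprimeP p in auto)
  also have "real_of_int p ^ 3 \<le> (2 * real_of_int N) ^ 3"
    using P(3)[OF p] P(2)[OF p] N by (intro power_mono) auto
  then have "(2 * real n + 5) * real_of_int p ^ 3 \<le> (2 * real n + 5) * (8 * real_of_int N ^ 3)"
    by (intro mult_left_mono) (auto simp: power_mult_distrib)
  finally show ?thesis .
qed

text \<open>By the inequality of arithmetic and geometric means and the symmetry of the set of
  pairs, only the mean square over the dilation for a fixed modulus is involved.\<close>

private lemma sum_dilate_norm_products_le:
  "(\<Sum>p\<in>P. \<Sum>q\<in>P - {p}. dilate_norm n l k p q * dilate_norm n l k q p)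
    \<le> real (card P) * ((2 * real n + 5) * (8 * real_of_int N ^ 3))"
proof -
  let ?f = "\<lambda>p q. (dilate_norm n l k p q)\<^sup>2"
  have swap: "(\<Sum>p\<in>P. \<Sum>q\<in>P - {p}. ?f q p) = (\<Sum>p\<in>P. \<Sum>q\<in>P - {p}. ?f p q)"
  proof -
    have "(\<Sum>p\<in>P. \<Sum>q\<in>P - {p}. g p q) = (\<Sum>p\<in>P. \<Sum>q\<in>P. if p \<noteq> q then g p q else 0)" for g :: "int \<Rightarrow> int \<Rightarrow> real"
      using finP by (intro sum.cong refl sum.mono_neutral_cong_left) auto
    then show ?thesis by (simp add: sum.swap[of "\<lambda>p q. if p \<noteq> q then ?f q p else 0"] eq_commute)
  qed
  have "(\<Sum>p\<in>P. \<Sum>q\<in>P - {p}. dilate_norm n l k p q * dilate_norm n l k q p)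
     \<le> (\<Sum>p\<in>P. \<Sum>q\<in>P - {p}. (?f p q + ?f q p) / 2)"
  proof (intro sum_mono)
    fix p q
    have "(dilate_norm n l k p q - dilate_norm n l k q p)\<^sup>2 \<ge> 0" by simp
    then show "dilate_norm n l k p q * dilate_norm n l k q p \<le> (?f p q + ?f q p) / 2"
      by (simp add: power2_eq_square algebra_simps)
  qed
  also have "\<dots> = ((\<Sum>p\<in>P. \<Sum>q\<in>P - {p}. ?f p q) + (\<Sum>p\<in>P. \<Sum>q\<in>P - {p}. ?f q p)) / 2"
    by (simp add: sum.distrib flip: sum_divide_distrib)
  also have "\<dots> = (\<Sum>p\<in>P. \<Sum>q\<in>P - {p}. ?f p q)" by (simp add: swap)
  also have "\<dots> \<le> (\<Sum>p\<in>P. (2 * real n + 5) * (8 * real_of_int N ^ 3))"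
    by (intro sum_mono sum_dilate_norm_square_le)
  finally show ?thesis by simp
qed

text \<open>The mean square contributes \<open>N ^ 3\<close> against the \<open>N ^ 4\<close> of the
  normalisation, which leaves the factor \<open>N\<close> on the left. The 512 is 8 from
  \<open>(2 * N) ^ 3\<close> times 8 from each majorant.\<close>

private lemma sum_box_correlation_le:
  assumes HK: "H > 0" "K > 0"
  shows "(\<Sum>p\<in>P. \<Sum>q\<in>P - {p}. norm (box_correlation n c H d K p q)) * real_of_int N
    \<le> 512 * (2 * real n + 5) * real (card P) * (real H * (real H + 16 * real_of_int N ^ 2)) * (real K * (real K + 16 * real_of_int N ^ 2))"
proof -
  let ?A = "{-(2 * N\<^sup>2)..2 * N\<^sup>2}" and ?M = "8 * (real_of_int N)\<^sup>2"
  let ?W = "fejer_majorant ?M"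
  let ?c = "real (card P) * ((2 * real n + 5) * (8 * real_of_int N ^ 3))"
  have N0: "N > 0" using N n by linarith
  have M0: "?M > 0" using N0 by simp
  have A: "?A = {- int (nat (2 * N\<^sup>2))..int (nat (2 * N\<^sup>2))}" by simp
  have W: "(\<Sum>l\<in>?A. ?W H l) \<le> 8 * real H * (real H + 2 * ?M)" if "H > 0" for H
    unfolding A by (rule sum_fejer_majorant_le[OF M0 that])
  have W0: "?W H l \<ge> 0" for H l by (simp add: fejer_majorant_def)
  have "(\<Sum>p\<in>P. \<Sum>q\<in>P - {p}. norm (box_correlation n c H d K p q)) * real_of_int N ^ 4
    = (\<Sum>p\<in>P. \<Sum>q\<in>P - {p}. norm (box_correlation n c H d K p q) * real_of_int N ^ 4)"
    by (simp add: sum_distrib_right)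
  also have "\<dots> \<le> (\<Sum>p\<in>P. \<Sum>q\<in>P - {p}. \<Sum>l\<in>?A. \<Sum>k\<in>?A.
        (dilate_norm n l k p q * dilate_norm n l k q p) * (?W H l * ?W K k))"
    using norm_box_correlation_le[OF _ _ _ HK] by (intro sum_mono) auto
  also have "\<dots> = (\<Sum>l\<in>?A. \<Sum>k\<in>?A. (\<Sum>p\<in>P. \<Sum>q\<in>P - {p}. dilate_norm n l k p q * dilate_norm n l k q p) * (?W H l * ?W K k))"
  proof -
    have "(\<Sum>p\<in>P. \<Sum>q\<in>P - {p}. \<Sum>l\<in>?A. \<Sum>k\<in>?A. T p q l k) = (\<Sum>l\<in>?A. \<Sum>k\<in>?A. \<Sum>p\<in>P. \<Sum>q\<in>P - {p}. T p q l k)" for T :: "int \<Rightarrow> int \<Rightarrow> int \<Rightarrow> int \<Rightarrow> real"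
    proof -
      have "(\<Sum>p\<in>P. \<Sum>q\<in>P - {p}. g p q) = (\<Sum>z\<in>Sigma P (\<lambda>p. P - {p}). g (fst z) (snd z))" for g :: "int \<Rightarrow> int \<Rightarrow> real"
        using finP by (simp add: sum.Sigma case_prod_beta)
      note g = this
      have "(\<Sum>p\<in>P. \<Sum>q\<in>P - {p}. \<Sum>l\<in>?A. \<Sum>k\<in>?A. T p q l k)
          = (\<Sum>z\<in>Sigma P (\<lambda>p. P - {p}). \<Sum>l\<in>?A. \<Sum>k\<in>?A. T (fst z) (snd z) l k)"
        by (rule g)
      also have "\<dots> = (\<Sum>l\<in>?A. \<Sum>k\<in>?A. \<Sum>z\<in>Sigma P (\<lambda>p. P - {p}). T (fst z) (snd z) l k)"
        by (rule sum_swap2[symmetric])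
      finally show ?thesis by (simp only: g)
    qed
    then show ?thesis by (simp add: sum_distrib_right)
  qed
  also have "\<dots> \<le> (\<Sum>l\<in>?A. \<Sum>k\<in>?A. ?c * (?W H l * ?W K k))"
    by (intro sum_mono mult_right_mono sum_dilate_norm_products_le mult_nonneg_nonneg W0)
  also have "\<dots> = ?c * ((\<Sum>l\<in>?A. ?W H l) * (\<Sum>k\<in>?A. ?W K k))"
    by (simp only: sum_distrib_right) (simp only: sum_distrib_left)
  also have "\<dots> \<le> ?c * ((8 * real H * (real H + 2 * ?M)) * (8 * real K * (real K + 2 * ?M)))"
    using N0 HK by (intro mult_left_mono mult_mono W sum_nonneg W0) auto
  also have "\<dots> = (512 * (2 * real n + 5) * real (card P) * (real H * (real H + 16 * real_of_int N ^ 2)) * (real K * (real K + 16 * real_of_int N ^ 2))) * real_of_int N ^ 3"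
  proof -
    have "(c * (e * (8 * t))) * ((8 * x * (x + 2 * (8 * s))) * (8 * y * (y + 2 * (8 * s))))
      = (512 * e * c * (x * (x + 16 * s)) * (y * (y + 16 * s))) * t" for c e t x y s :: real
      by (simp add: algebra_simps)
    then show ?thesis .
  qed
  finally have "((\<Sum>p\<in>P. \<Sum>q\<in>P - {p}. norm (box_correlation n c H d K p q)) * real_of_int N) * real_of_int N ^ 3
    \<le> (512 * (2 * real n + 5) * real (card P) * (real H * (real H + 16 * real_of_int N ^ 2)) * (real K * (real K + 16 * real_of_int N ^ 2))) * real_of_int N ^ 3"
    by (simp add: mult.assoc power3_eq_cube power4_eq_xxxx)
  then show ?thesis using N0 by (simp add: mult_le_cancel_right)
qed

text \<open>For a point of \<open>S\<close> the product of \<open>s\<close> and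
  \<open>Delta n a b\<close> is the square of \<open>s * r\<close>, so each prime not dividing
  \<open>Delta n a b\<close> contributes 1 to \<open>\<psi>\<close>, and \<open>\<psi>\<close> is at
  least half of \<open>card P\<close>. The weighted second moment of \<open>\<psi>\<close> is
  expanded over pairs of primes: the diagonal is bounded trivially, the rest by
  \<open>sum_box_correlation_le\<close>.\<close>

lemma square_sieve_box:
  assumes HK: "H > 0" "K > 0"
    and S: "S \<subseteq> {c..<c + int H} \<times> {d..<d + int K}"
    and sq: "\<And>a b. (a, b) \<in> S \<Longrightarrow> \<exists>r. Delta n a b = s * r\<^sup>2"
    and few: "\<And>a b. (a, b) \<in> S \<Longrightarrow> 2 * card {p \<in> P. p dvd Delta n a b} \<le> card P"
  shows "real (card S) * real (card P) \<le> 16 * real H * real K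
    + 2048 * (2 * real n + 5) * (real H + 16 * real_of_int N ^ 2) * (real K + 16 * real_of_int N ^ 2) / real_of_int N"
proof (cases "P = {}")
  case True
  have "N > 0" using N n by linarith
  then show ?thesis using True by simp
next
  case False
  then have P0: "real (card P) > 0" using finP by (simp add: card_gt_0_iff)
  have N0: "N > 0" using N n by linarith
  let ?I = "{c..<c + 2 * int H}" and ?J = "{0..<int H}" and ?I' = "{d..<d + 2 * int K}" and ?J' = "{0..<int K}"
  define \<psi> where "\<psi> a b = (\<Sum>p\<in>P. real_of_int (Legendre s p) * real_of_int (Legendre (Delta n a b) p))" for a b
  have big: "\<psi> a b \<ge> real (card P) / 2" if ab: "(a, b) \<in> S" for a b
  proof -
    obtain r where r: "Delta n a b = s * r\<^sup>2" using sq[OF ab] by blast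
    let ?D = "{p \<in> P. p dvd Delta n a b}"
    have "\<psi> a b = (\<Sum>p\<in>P. if p dvd Delta n a b then 0 else 1)"
      unfolding \<psi>_def
    proof (rule sum.cong[OF refl])
      fix p assume p: "p \<in> P"
      then have pp: "prime p" "p > 2" using P(1)[OF p] gtn[OF p] n by linarith+
      show "real_of_int (Legendre s p) * real_of_int (Legendre (Delta n a b) p) = (if p dvd Delta n a b then 0 else 1)"
      proof (cases "p dvd Delta n a b")
        case True
        then show ?thesis by (simp add: Legendre_eq_0_iff[THEN iffD2])
      next
        case False
        then have nd: "\<not> p dvd s * r" unfolding r by (metis dvd_mult2 mult.assoc power2_eq_square)
        have "Legendre s p * Legendre (Delta n a b) p = Legendre ((s * r)\<^sup>2) p"
          unfolding r Legendre_mult[OF pp, symmetric] by (simp add: power2_eq_square mult_ac)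
        also have "\<dots> = 1" using nd pp(1) by (rule Legendre_square)
        finally show ?thesis using False by (simp flip: of_int_mult)
      qed
    qed
    also have "\<dots> = real (card (P - ?D))"
    proof -
      have "(\<Sum>p\<in>P. if p dvd Delta n a b then 0 else 1) = (\<Sum>p\<in>P - ?D. 1 :: real)"
        using finP by (intro sum.mono_neutral_cong_right) auto
      then show ?thesis by simp
    qed
    also have "card (P - ?D) = card P - card ?D" using finP by (intro card_Diff_subset) auto
    finally show ?thesis using few[OF ab] by linarith
  qed
  have lower: "real H * real K * (real (card S) * (real (card P) / 2)\<^sup>2)
     \<le> (\<Sum>v\<in>?J. \<Sum>v'\<in>?J'. \<Sum>u\<in>?I. \<Sum>u'\<in>?I'. (\<psi> (u - v) (u' - v'))\<^sup>2)"
  proof -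
    have "real (card S) * (real (card P) / 2)\<^sup>2 \<le> (\<Sum>u\<in>?I. \<Sum>u'\<in>?I'. (\<psi> (u - v) (u' - v'))\<^sup>2)"
      if v: "v \<in> ?J" "v' \<in> ?J'" for v v'
    proof -
      \<comment> \<open>The translate of \<open>S\<close> by \<open>(v, v')\<close> stays in the
        doubled box, so each of the \<open>H * K\<close> shifts sees all of
        \<open>S\<close>.\<close>
      let ?g = "\<lambda>(a, b). (a + v, b + v')"
      have inj: "inj_on ?g S" by (auto simp: inj_on_def)
      have "real (card S) * (real (card P) / 2)\<^sup>2 = (\<Sum>z\<in>S. (real (card P) / 2)\<^sup>2)" by simp
      also have "\<dots> \<le> (\<Sum>z\<in>S. (\<psi> (fst z) (snd z))\<^sup>2)"
        using big by (intro sum_mono power_mono) auto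
      also have "\<dots> = (\<Sum>z\<in>?g ` S. (\<psi> (fst z - v) (snd z - v'))\<^sup>2)"
        by (subst sum.reindex[OF inj]) (simp add: case_prod_beta)
      also have "\<dots> \<le> (\<Sum>z\<in>?I \<times> ?I'. (\<psi> (fst z - v) (snd z - v'))\<^sup>2)"
        using v S by (intro sum_mono2) fastforce+
      finally show ?thesis by (simp add: sum.cartesian_product case_prod_beta)
    qed
    then have "(\<Sum>v\<in>?J. \<Sum>v'\<in>?J'. real (card S) * (real (card P) / 2)\<^sup>2)
      \<le> (\<Sum>v\<in>?J. \<Sum>v'\<in>?J'. \<Sum>u\<in>?I. \<Sum>u'\<in>?I'. (\<psi> (u - v) (u' - v'))\<^sup>2)"
      by (intro sum_mono)
    then show ?thesis by simp
  qed
  have upper: "(\<Sum>v\<in>?J. \<Sum>v'\<in>?J'. \<Sum>u\<in>?I. \<Sum>u'\<in>?I'. (\<psi> (u - v) (u' - v'))\<^sup>2)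
     \<le> (\<Sum>p\<in>P. \<Sum>q\<in>P. norm (box_correlation n c H d K p q))"
  proof -
    let ?L = "\<lambda>p. real_of_int (Legendre s p)"
    have "complex_of_real (\<Sum>v\<in>?J. \<Sum>v'\<in>?J'. \<Sum>u\<in>?I. \<Sum>u'\<in>?I'. (\<psi> (u - v) (u' - v'))\<^sup>2)
      = complex_of_real (\<Sum>u\<in>?I. \<Sum>v\<in>?J. \<Sum>u'\<in>?I'. \<Sum>v'\<in>?J'. (\<psi> (u - v) (u' - v'))\<^sup>2)"
    proof -
      have "(\<Sum>v\<in>?J. \<Sum>v'\<in>?J'. \<Sum>u\<in>?I. \<Sum>u'\<in>?I'. g u v u' v') = (\<Sum>u\<in>?I. \<Sum>v\<in>?J. \<Sum>u'\<in>?I'. \<Sum>v'\<in>?J'. g u v u' v')" for g :: "int \<Rightarrow> int \<Rightarrow> int \<Rightarrow> int \<Rightarrow> real"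
        by (subst sum_swap2) (intro sum.cong refl sum.swap)
      then show ?thesis by simp
    qed
    also have "\<dots> = (\<Sum>u\<in>?I. \<Sum>v\<in>?J. \<Sum>u'\<in>?I'. \<Sum>v'\<in>?J'. \<Sum>p\<in>P. \<Sum>q\<in>P.
        complex_of_real (?L p * ?L q) * (Legendre_Delta n p (u - v) (u' - v') * Legendre_Delta n q (u - v) (u' - v')))"
      unfolding \<psi>_def power2_eq_square sum_product of_real_sum
      by (intro sum.cong refl) (simp add: Legendre_Delta_def mult_ac)
    also have "\<dots> = (\<Sum>p\<in>P. \<Sum>q\<in>P. \<Sum>u\<in>?I. \<Sum>v\<in>?J. \<Sum>u'\<in>?I'. \<Sum>v'\<in>?J'.
        complex_of_real (?L p * ?L q) * (Legendre_Delta n p (u - v) (u' - v') * Legendre_Delta n q (u - v) (u' - v')))"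
      by (rule sym) ((rule trans[OF sum_swap2], rule sum.cong, rule refl)+, rule refl)
    also have "\<dots> = (\<Sum>p\<in>P. \<Sum>q\<in>P. complex_of_real (?L p * ?L q) * box_correlation n c H d K p q)"
      unfolding box_correlation_def by (simp only: sum_distrib_left)
    finally have eq: "complex_of_real (\<Sum>v\<in>?J. \<Sum>v'\<in>?J'. \<Sum>u\<in>?I. \<Sum>u'\<in>?I'. (\<psi> (u - v) (u' - v'))\<^sup>2)
       = (\<Sum>p\<in>P. \<Sum>q\<in>P. complex_of_real (?L p * ?L q) * box_correlation n c H d K p q)" .
    have le_norm: "x \<le> norm (complex_of_real x)" for x by (simp only: norm_of_real abs_ge_self)
    have "(\<Sum>v\<in>?J. \<Sum>v'\<in>?J'. \<Sum>u\<in>?I. \<Sum>u'\<in>?I'. (\<psi> (u - v) (u' - v'))\<^sup>2)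
       \<le> norm (\<Sum>p\<in>P. \<Sum>q\<in>P. complex_of_real (?L p * ?L q) * box_correlation n c H d K p q)"
      unfolding eq[symmetric] by (rule le_norm)
    also have "\<dots> \<le> (\<Sum>p\<in>P. \<Sum>q\<in>P. norm (complex_of_real (?L p * ?L q) * box_correlation n c H d K p q))"
      by (intro order_trans[OF norm_sum] sum_mono norm_sum)
    also have "\<dots> \<le> (\<Sum>p\<in>P. \<Sum>q\<in>P. norm (box_correlation n c H d K p q))"
    proof (intro sum_mono)
      fix p q
      have L: "\<bar>?L t\<bar> \<le> 1" for t using abs_Legendre_le[of s t] by linarith
      have "\<bar>?L p * ?L q\<bar> \<le> 1" unfolding abs_mult by (intro mult_le_one L) auto
      then show "norm (complex_of_real (?L p * ?L q) * box_correlation n c H d K p q) \<le> norm (box_correlation n c H d K p q)"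
        unfolding norm_mult norm_of_real by (intro mult_left_le_one_le) auto
    qed
    finally show ?thesis .
  qed
  let ?R = "\<Sum>p\<in>P. \<Sum>q\<in>P - {p}. norm (box_correlation n c H d K p q)"
  have diag: "norm (box_correlation n c H d K p p) \<le> 4 * (real H * real K)\<^sup>2" for p
  proof -
    have L: "norm (Legendre_Delta n p a b) \<le> 1" for a b
      using abs_Legendre_le[of "Delta n a b" p] unfolding Legendre_Delta_def norm_of_int by linarith
    have "norm (box_correlation n c H d K p p) \<le> (\<Sum>u\<in>?I. \<Sum>v\<in>?J. \<Sum>u'\<in>?I'. \<Sum>v'\<in>?J'. 1)"
      unfolding box_correlation_def
      by (intro order_trans[OF norm_sum] sum_mono) (simp add: norm_mult mult_le_one L)
    then show ?thesis by (simp add: power2_eq_square mult_ac)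
  qed
  have "(\<Sum>p\<in>P. \<Sum>q\<in>P. norm (box_correlation n c H d K p q))
      = (\<Sum>p\<in>P. norm (box_correlation n c H d K p p) + (\<Sum>q\<in>P - {p}. norm (box_correlation n c H d K p q)))"
    using finP by (intro sum.cong refl sum.remove)
  also have "\<dots> \<le> (\<Sum>p\<in>P. 4 * (real H * real K)\<^sup>2) + ?R"
    using diag by (simp only: sum.distrib) (intro add_right_mono sum_mono)
  finally have fin: "real H * real K * (real (card S) * (real (card P) / 2)\<^sup>2) \<le> real (card P) * (4 * (real H * real K)\<^sup>2) + ?R"
    using lower upper by simp
  have R: "?R \<le> real (card P) * (real H * real K) * (512 * (2 * real n + 5) * (real H + 16 * real_of_int N ^ 2) * (real K + 16 * real_of_int N ^ 2) / real_of_int N)"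
    using sum_box_correlation_le[OF HK, of c d] N0 by (simp add: field_simps)
  define E where "E = 512 * (2 * real n + 5) * (real H + 16 * real_of_int N ^ 2) * (real K + 16 * real_of_int N ^ 2) / real_of_int N"
  define X where "X = real H * real K"
  have X: "X > 0" using HK by (simp add: X_def)
  have "X * (real (card S) * (real (card P) / 2)\<^sup>2) \<le> real (card P) * (4 * X\<^sup>2) + real (card P) * X * E"
    using fin R unfolding X_def E_def by linarith
  \<comment> \<open>Multiplied by 4, the square of \<open>card P / 2\<close> loses its denominator;
    hence the constants 16 and 4.\<close>
  then have "(X * real (card P)) * (real (card S) * real (card P)) \<le> (X * real (card P)) * (16 * X + 4 * E)"
    by (simp add: power2_eq_square algebra_simps)
  then have "real (card S) * real (card P) \<le> 16 * X + 4 * E"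
    using X P0 by (simp add: mult_le_cancel_left)
  moreover have "4 * (512 * e * x * y / z) = 2048 * e * x * y / z" for e x y z :: real by simp
  ultimately show ?thesis by (simp only: X_def E_def mult.assoc)
qed

end

section \<open>Primes in dyadic windows\<close>

lemma primes_prod_dvd:
  assumes "finite A" "\<And>p. p \<in> A \<Longrightarrow> prime p" "\<And>p. p \<in> A \<Longrightarrow> p dvd (m :: nat)"
  shows "\<Prod>A dvd m"
  using assms
proof (induction A rule: finite_induct)
  case (insert p A)
  have "coprime p (\<Prod>A)"
    using insert by (intro prod_coprime_right primes_coprime) auto
  moreover have "p dvd m" "\<Prod>A dvd m" using insert by auto
  ultimately have "p * \<Prod>A dvd m" by (rule divides_mult[rotated 2])
  then show ?case using insert by simp
qed simp

text \<open>Induction by doubling: the primes between \<open>m\<close> and \<open>2 * m\<close> all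
  divide the central binomial coefficient, which is at most \<open>2 ^ (2 * m)\<close>.\<close>

lemma primorial_dyadic_le: "\<Prod>{p::nat. prime p \<and> p \<le> 2 ^ k} \<le> 2 ^ (2 * 2 ^ k)"
proof (induction k)
  case 0
  have "{p::nat. prime p \<and> p \<le> 2 ^ 0} = {}" by (auto dest: prime_gt_1_nat)
  then show ?case by (simp only: prod.empty) simp
next
  case (Suc k)
  let ?m = "2 ^ k :: nat"
  let ?A = "{p::nat. prime p \<and> ?m < p \<and> p \<le> 2 * ?m}"
  have fin: "finite ?A" by (rule finite_subset[of _ "{..2 * ?m}"]) auto
  have "\<Prod>?A dvd (2 * ?m) choose ?m"
  proof (rule primes_prod_dvd[OF fin])
    fix p assume p: "p \<in> ?A"
    have "p dvd fact (2 * ?m)" using p by (simp add: prime_dvd_fact_iff)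
    also have "fact (2 * ?m) = fact ?m * fact ?m * ((2 * ?m) choose ?m)"
      using binomial_fact_lemma[of ?m "2 * ?m"] by simp
    finally show "p dvd (2 * ?m) choose ?m"
      using p by (auto simp: prime_dvd_mult_iff prime_dvd_fact_iff)
  qed simp
  then have "\<Prod>?A \<le> (2 * ?m) choose ?m" by (rule dvd_imp_le) (simp add: zero_less_binomial)
  also have "\<dots> \<le> 2 ^ (2 * ?m)" by (rule binomial_le_pow2)
  finally have A: "\<Prod>?A \<le> 2 ^ (2 * ?m)" .
  have "{p::nat. prime p \<and> p \<le> 2 ^ Suc k} = {p. prime p \<and> p \<le> ?m} \<union> ?A" by auto
  then have "\<Prod>{p::nat. prime p \<and> p \<le> 2 ^ Suc k} = \<Prod>{p. prime p \<and> p \<le> ?m} * \<Prod>?A"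
    by (simp only:) (rule prod.union_disjoint, auto)
  also have "\<dots> \<le> 2 ^ (2 * ?m) * 2 ^ (2 * ?m)" using Suc A by (rule mult_le_mono)
  also have "\<dots> = 2 ^ (2 * 2 ^ Suc k)" by (simp flip: power_add)
  finally show ?case .
qed

text \<open>Legendre's formula. From \<open>n\<close> to \<open>Suc n\<close> the quotient by
  \<open>p ^ i\<close> grows by 1 exactly when \<open>p ^ i\<close> divides \<open>Suc n\<close>;
  powers beyond \<open>K\<close> exceed \<open>n\<close> and contribute nothing.\<close>

lemma multiplicity_fact_eq:
  fixes p :: nat
  assumes p: "prime p" and "n < p ^ Suc K"
  shows "multiplicity p (fact n) = (\<Sum>i\<in>{1..K}. n div p ^ i)"
  using assms(2)
proof (induction n)
  case (Suc n)
  have p1: "\<not> is_unit p" using p by auto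
  have "multiplicity p (Suc n) = card {i \<in> {1..K}. p ^ i dvd Suc n}"
  proof -
    have "multiplicity p (Suc n) \<le> K"
    proof (rule ccontr)
      assume "\<not> multiplicity p (Suc n) \<le> K"
      then have "p ^ Suc K dvd Suc n" by (intro multiplicity_dvd') simp
      then show False using Suc.prems by (auto dest: dvd_imp_le)
    qed
    then have "{i \<in> {1..K}. p ^ i dvd Suc n} = {1..multiplicity p (Suc n)}"
      using p1 by (auto simp: power_dvd_iff_le_multiplicity)
    then show ?thesis by simp
  qed
  moreover have "Suc n div p ^ i = n div p ^ i + (if p ^ i dvd Suc n then 1 else 0)" for i
    by (auto simp: div_Suc dvd_eq_mod_eq_0)
  then have "(\<Sum>i\<in>{1..K}. Suc n div p ^ i) = (\<Sum>i\<in>{1..K}. n div p ^ i) + card {i \<in> {1..K}. p ^ i dvd Suc n}"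
    by (simp add: sum.distrib sum.inter_filter[symmetric])
  moreover have "multiplicity p (fact (Suc n)) = multiplicity p (Suc n) + multiplicity p (fact n)"
    using p by (simp only: fact_Suc of_nat_id, subst prime_elem_multiplicity_mult_distrib) auto
  ultimately show ?case using Suc by simp
qed simp

text \<open>By Legendre's formula each \<open>i \<le> K\<close> contributes
  \<open>2 * m div p ^ i - 2 * (m div p ^ i)\<close>, which is at most 1, and
  \<open>p ^ K \<le> 2 * m\<close>.\<close>

lemma prime_power_multiplicity_central_binomial_le:
  fixes p :: nat
  assumes p: "prime p" and m: "m > 0"
  shows "p ^ multiplicity p ((2 * m) choose m) \<le> 2 * m"
proof -
  obtain K where K: "p ^ K \<le> 2 * m" "2 * m < p ^ (K + 1)"
    using ex_power_ivl1[of p "2 * m"] p m prime_ge_2_nat by auto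
  let ?C = "(2 * m) choose m"
  have "multiplicity p (fact (2 * m)) = multiplicity p (fact m * fact m * ?C)"
    using binomial_fact_lemma[of m "2 * m"] by simp
  also have "\<dots> = 2 * multiplicity p (fact m) + multiplicity p ?C"
    using p by (simp add: prime_elem_multiplicity_mult_distrib)
  finally have "(\<Sum>i\<in>{1..K}. 2 * m div p ^ i) = 2 * (\<Sum>i\<in>{1..K}. m div p ^ i) + multiplicity p ?C"
    using multiplicity_fact_eq[OF p, of "2 * m" K] multiplicity_fact_eq[OF p, of m K] K(2) by simp
  moreover have "(\<Sum>i\<in>{1..K}. 2 * m div p ^ i) \<le> (\<Sum>i\<in>{1..K}. 2 * (m div p ^ i) + 1)"
  proof (rule sum_mono)
    fix i
    have d: "p ^ i > 0" using p by (simp add: prime_gt_0_nat)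
    have "m < (m div p ^ i + 1) * p ^ i" using d dividend_less_div_times by auto
    then have "2 * m < (2 * (m div p ^ i) + 2) * p ^ i" by (simp add: algebra_simps)
    then have "2 * m div p ^ i < 2 * (m div p ^ i) + 2" using d by (simp add: div_less_iff_less_mult)
    then show "2 * m div p ^ i \<le> 2 * (m div p ^ i) + 1" by simp
  qed
  ultimately have "multiplicity p ?C \<le> K" by (simp add: sum_Suc sum_distrib_left)
  then have "p ^ multiplicity p ?C \<le> p ^ K" using p prime_ge_1_nat by (intro power_increasing) auto
  then show ?thesis using K(1) by linarith
qed

lemma central_binomial_prime_product:
  "(2 * m) choose m = (\<Prod>p\<in>{p. prime p \<and> p \<le> 2 * m}. p ^ multiplicity p ((2 * m) choose m))"
proof -
  let ?C = "(2 * m) choose m"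
  have C: "?C > 0" by (simp add: zero_less_binomial)
  have "?C = (\<Prod>p\<in>prime_factors ?C. p ^ multiplicity p ?C)"
    using prod_prime_factors[of ?C] C by simp
  also have "\<dots> = (\<Prod>p\<in>{p. prime p \<and> p \<le> 2 * m}. p ^ multiplicity p ?C)"
  proof (rule prod.mono_neutral_left)
    have "p \<le> 2 * m" if "prime p" "p dvd ?C" for p
    proof -
      have "?C dvd fact (2 * m)"
        using binomial_fact_lemma[of m "2 * m"] by (metis dvd_triv_right diff_add_inverse le_add1 mult_2)
      then have "p dvd fact (2 * m)" using that(2) dvd_trans by blast
      then show ?thesis using that(1) by (simp add: prime_dvd_fact_iff)
    qed
    then show "prime_factors ?C \<subseteq> {p. prime p \<and> p \<le> 2 * m}" by (auto simp: prime_factors_dvd)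
    show "\<forall>p\<in>{p. prime p \<and> p \<le> 2 * m} - prime_factors ?C. p ^ multiplicity p ?C = 1"
      using C by (auto simp: prime_factors_dvd not_dvd_imp_multiplicity_0)
  qed simp
  finally show ?thesis .
qed

text \<open>With \<open>m = 2 ^ j\<close> the central binomial coefficient is at least
  \<open>4 ^ m / (2 * m)\<close>. Primes up to \<open>r\<close> contribute at most
  \<open>(2 * m) ^ r\<close>, and those between \<open>r\<close> and \<open>m / 2\<close> at most
  the primorial bound \<open>2 ^ m\<close>. The remaining factor of about \<open>2 ^ m\<close> must
  come from primes above \<open>m / 2\<close>, each contributing at most \<open>2 * m\<close>.
  Starting at \<open>m / 2\<close> is what keeps the primorial below \<open>4 ^ m\<close>.\<close>

lemma chebyshev_dyadic_window:
  assumes j: "j \<ge> 1"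
  shows "2 ^ j \<le> (j + 1) * (1 + 2 ^ (j div 2 + 1) + card {p::nat. prime p \<and> 2 ^ (j - 1) < p \<and> p \<le> 2 ^ (j + 1)})"
proof -
  define m where "m = (2::nat) ^ j"
  \<comment> \<open>The rounded exponent ensures \<open>r * r \<ge> 2 * m\<close>, so primes above
    \<open>r\<close> divide the binomial coefficient at most once.\<close>
  define r where "r = (2::nat) ^ (j div 2 + 1)"
  let ?C = "(2 * m) choose m"
  let ?f = "\<lambda>p. p ^ multiplicity p ?C"
  let ?A1 = "{p. prime p \<and> p \<le> 2 ^ (j - 1) \<and> p \<le> r}"
  let ?A2 = "{p. prime p \<and> r < p \<and> p \<le> 2 ^ (j - 1)}"
  let ?A3 = "{p::nat. prime p \<and> 2 ^ (j - 1) < p \<and> p \<le> 2 * m}"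
  have m: "m > 0" by (simp add: m_def)
  have half: "2 * 2 ^ (j - 1) = m" using j unfolding m_def by (cases j) auto
  have C: "?C > 0" by (simp add: zero_less_binomial)
  have le: "?f p \<le> 2 * m" if "prime p" for p
    using prime_power_multiplicity_central_binomial_le[OF that m] .
  have "2 * m < Suc r * Suc r"
  proof -
    have "2 * m \<le> r * r"
      unfolding m_def r_def by (simp flip: power_add power_Suc add: power_increasing)
    then show ?thesis by simp
  qed
  have f2: "?f p \<le> p" if p: "p \<in> ?A2" for p
  proof -
    have "multiplicity p ?C \<le> 1"
    proof (rule ccontr)
      assume "\<not> multiplicity p ?C \<le> 1"
      then have "p ^ 2 \<le> ?f p" using p prime_ge_1_nat by (intro power_increasing) auto
      then have "p ^ 2 \<le> 2 * m" using p by (intro order_trans[OF _ le]) auto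
      moreover have "Suc r * Suc r \<le> p * p" using p by (intro mult_le_mono) auto
      ultimately show False using \<open>2 * m < Suc r * Suc r\<close> by (simp add: power2_eq_square)
    qed
    then have "?f p \<le> p ^ 1" using p prime_ge_1_nat by (intro power_increasing) auto
    then show ?thesis by simp
  qed
  have low: "2 ^ (2 * m) \<le> 2 * m * ?C"
  proof -
    have "4 ^ m / (2 * real m) \<le> real ?C" by (rule central_binomial_lower_bound[OF m])
    then have "4 ^ m \<le> 2 * real m * real ?C" using m by (simp add: field_simps)
    then have "real (4 ^ m) \<le> real (2 * m * ?C)" by simp
    then have "4 ^ m \<le> 2 * m * ?C" by (simp only: of_nat_le_iff)
    then show ?thesis by (simp add: power_mult)
  qed
  have up: "?C \<le> (2 * m) ^ r * (2 ^ m * (2 * m) ^ card ?A3)"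
  proof -
    have fin: "finite {p. prime p \<and> p \<le> x}" for x :: nat
      by (rule finite_subset[of _ "{..x}"]) auto
    have fins: "finite ?A1" "finite ?A2" "finite ?A3"
      by (rule finite_subset[OF _ fin[of "2 * m"]], use half in auto)+
    have "{p. prime p \<and> p \<le> 2 * m} = ?A1 \<union> (?A2 \<union> ?A3)" using half by auto
    then have "?C = (\<Prod>p\<in>?A1 \<union> (?A2 \<union> ?A3). ?f p)" using central_binomial_prime_product[of m] by simp
    also have "\<dots> = prod ?f ?A1 * prod ?f (?A2 \<union> ?A3)" by (rule prod.union_disjoint) (use fins in auto)
    also have "prod ?f (?A2 \<union> ?A3) = prod ?f ?A2 * prod ?f ?A3" by (rule prod.union_disjoint) (use fins in auto)
    finally have C_eq: "?C = prod ?f ?A1 * (prod ?f ?A2 * prod ?f ?A3)" .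
    have "prod ?f ?A1 \<le> (\<Prod>p\<in>?A1. 2 * m)" using le by (intro prod_mono) auto
    also have "\<dots> = (2 * m) ^ card ?A1" by simp
    also have "\<dots> \<le> (2 * m) ^ r"
    proof (intro power_increasing)
      have "?A1 \<subseteq> {1..r}" using prime_ge_1_nat by auto
      then show "card ?A1 \<le> r" using card_mono[of "{1..r}" ?A1] by simp
    qed (use m in simp)
    finally have 1: "prod ?f ?A1 \<le> (2 * m) ^ r" .
    have "prod ?f ?A2 \<le> \<Prod>?A2" using f2 by (intro prod_mono) simp
    also have "\<dots> \<le> \<Prod>{p. prime p \<and> p \<le> 2 ^ (j - 1)}"
      by (intro dvd_imp_le prod_dvd_prod_subset fin prod_pos) (auto dest: prime_gt_0_nat)
    also have "\<dots> \<le> 2 ^ m" using primorial_dyadic_le[of "j - 1"] half by simp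
    finally have 2: "prod ?f ?A2 \<le> 2 ^ m" .
    have "prod ?f ?A3 \<le> (\<Prod>p\<in>?A3. 2 * m)" using le by (intro prod_mono) auto
    then have 3: "prod ?f ?A3 \<le> (2 * m) ^ card ?A3" by simp
    show ?thesis by (rule order_trans[OF eq_refl[OF C_eq] mult_le_mono[OF 1 mult_le_mono[OF 2 3]]])
  qed
  let ?e = "1 + r + card ?A3"
  have "2 ^ m * 2 ^ m = (2::nat) ^ (2 * m)" by (simp only: mult_2 power_add)
  also have "\<dots> \<le> 2 * m * ((2 * m) ^ r * (2 ^ m * (2 * m) ^ card ?A3))"
    using low mult_le_mono2[OF up] by (rule order_trans)
  also have "\<dots> = 2 ^ m * (2 * m) ^ ?e" by (simp only: power_add power_one_right mult_ac)
  finally have "2 ^ m \<le> (2 * m) ^ ?e"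
    by (simp only: mult_le_cancel1) simp
  also have "(2 * m) ^ ?e = 2 ^ ((j + 1) * ?e)" by (simp only: power_mult) (simp add: m_def)
  finally have "m \<le> (j + 1) * ?e" by (rule power_le_imp_le_exp[rotated]) simp
  then show ?thesis unfolding m_def r_def by simp
qed

text \<open>One of the two dyadic halves of the window contains at least half of its primes. From
  \<open>j = 14\<close>, that is \<open>t = 7\<close>, on, the error term is at most half of
  \<open>2 ^ j\<close>.\<close>

lemma chebyshev_dyadic:
  assumes j: "j \<ge> 14"
  obtains i where "i = j - 1 \<or> i = j" "2 ^ j \<le> 4 * (j + 1) * card {p::nat. prime p \<and> 2 ^ i < p \<and> p \<le> 2 * 2 ^ i}"
proof -
  define t where "t = j div 2"
  let ?B = "\<lambda>i. {p::nat. prime p \<and> 2 ^ i < p \<and> p \<le> 2 * 2 ^ i}"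
  have t: "t \<ge> 7" "j \<le> 2 * t + 1" "2 * t \<le> j" using j by (auto simp: t_def)
  have "12 * (t + 1) \<le> 2 ^ t"
    using t(1) by (induction t rule: dec_induct) auto
  have "2 * ((j + 1) * (1 + 2 ^ (t + 1))) \<le> 2 * ((2 * t + 2) * (3 * 2 ^ t))"
    using t(2) by (intro mult_le_mono) auto
  also have "\<dots> = 12 * (t + 1) * 2 ^ t" by (simp add: algebra_simps)
  also have "\<dots> \<le> 2 ^ t * 2 ^ t" using \<open>12 * (t + 1) \<le> 2 ^ t\<close> by (intro mult_le_mono) auto
  also have "\<dots> = 2 ^ (2 * t)" by (simp flip: power_add add: mult_2)
  also have "\<dots> \<le> 2 ^ j" using t(3) by (intro power_increasing) auto
  finally have small: "2 * ((j + 1) * (1 + 2 ^ (t + 1))) \<le> 2 ^ j" .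
  let ?A = "{p::nat. prime p \<and> 2 ^ (j - 1) < p \<and> p \<le> 2 ^ (j + 1)}"
  have A: "2 ^ j \<le> (j + 1) * (1 + 2 ^ (t + 1)) + (j + 1) * card ?A"
    using chebyshev_dyadic_window[of j] j by (simp add: t_def add_mult_distrib2)
  have "2 * 2 ^ (j - 1) = (2::nat) ^ j" using j by (cases j) auto
  then have "?A = ?B (j - 1) \<union> ?B j" using j by auto
  then have "card ?A \<le> card (?B (j - 1)) + card (?B j)" by (simp only: card_Un_le)
  then have "(j + 1) * card ?A \<le> (j + 1) * (card (?B (j - 1)) + card (?B j))" by (rule mult_le_mono2)
  then have "2 ^ j \<le> 2 * ((j + 1) * card (?B (j - 1))) + 2 * ((j + 1) * card (?B j))"
    using A small by (simp add: add_mult_distrib2)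
  then have "2 ^ j \<le> 4 * (j + 1) * card (?B (j - 1)) \<or> 2 ^ j \<le> 4 * (j + 1) * card (?B j)"
    unfolding mult.assoc by linarith
  then show thesis
  proof
    assume "2 ^ j \<le> 4 * (j + 1) * card (?B (j - 1))"
    then show thesis by (intro that[of "j - 1"]) auto
  next
    assume "2 ^ j \<le> 4 * (j + 1) * card (?B j)"
    then show thesis by (intro that[of j]) auto
  qed
qed

section \<open>Counting discriminants in a square class\<close>

lemma plog_ge_1: "plog x \<ge> 1"
proof (cases "x \<le> exp 1")
  case False
  then have "exp 1 \<le> x" by simp
  then have "ln (exp 1) \<le> ln x" using exp_gt_zero[of "1::real"] by (subst ln_le_cancel_iff) linarith+
  then show ?thesis using False by (simp add: plog_def)
qed (simp add: plog_def)

lemma ln_le_plog: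
  assumes "x > 0"
  shows "ln x \<le> plog x"
proof (cases "x \<le> exp 1")
  case True
  then have "ln x \<le> ln (exp 1)" using assms by (subst ln_le_cancel_iff) auto
  then show ?thesis using True by (simp add: plog_def)
qed (simp add: plog_def)

lemma plog_mono:
  assumes "x \<le> y"
  shows "plog x \<le> plog y"
proof (cases "x \<le> exp 1")
  case True
  then show ?thesis using plog_ge_1[of y] by (simp add: plog_def)
next
  case False
  then have "x > 0" using exp_gt_zero[of "1::real"] by linarith
  then show ?thesis using False assms by (simp add: plog_def)
qed

lemma plog_le_two_sqrt:
  assumes "x \<ge> 1"
  shows "plog x \<le> 2 * sqrt x"
proof (cases "x \<le> exp 1")
  case True
  have "sqrt x \<ge> 1" using assms by simp
  then have "1 \<le> 2 * sqrt x" by linarith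
  then show ?thesis using True by (simp add: plog_def)
next
  case False
  have "ln x = 2 * ln (sqrt x)" using assms by (simp add: ln_sqrt)
  also have "ln (sqrt x) \<le> sqrt x - 1" using assms by (intro ln_le_minus_one) auto
  finally show ?thesis using False by (simp add: plog_def)
qed

text \<open>Here \<open>y - x\<close> is \<open>s\<close> times the product of
  \<open>\<bar>t\<bar> + \<bar>r\<bar>\<close> and
  \<open>\<bar>t\<bar> - \<bar>r\<bar> \<ge> 1\<close>, hence at least
  \<open>s * \<bar>t\<bar>\<close>, whose square is \<open>s * y\<close>.\<close>

lemma scaled_squares_gap:
  fixes s :: int
  assumes "x = s * r\<^sup>2" "y = s * t\<^sup>2" "0 \<le> x" "x < y"
  shows "y \<le> (y - x)\<^sup>2"
proof -
  have s: "s \<ge> 1" using assms by (smt (verit) mult_nonpos_nonneg zero_le_power2)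
  have "r\<^sup>2 < t\<^sup>2" using assms s by simp
  then have lt: "\<bar>r\<bar> < \<bar>t\<bar>" by (metis abs_le_square_iff not_le)
  have "s * \<bar>t\<bar> \<le> s * (\<bar>t\<bar> + \<bar>r\<bar>) * (\<bar>t\<bar> - \<bar>r\<bar>)"
  proof -
    have "s * \<bar>t\<bar> * 1 \<le> s * (\<bar>t\<bar> + \<bar>r\<bar>) * (\<bar>t\<bar> - \<bar>r\<bar>)"
      using s lt by (intro mult_mono mult_left_mono) auto
    then show ?thesis by simp
  qed
  also have "\<dots> = y - x"
    unfolding assms(1,2) by (simp add: algebra_simps power2_eq_square)
  finally have "(s * \<bar>t\<bar>)\<^sup>2 \<le> (y - x)\<^sup>2" using s by (intro power_mono) auto
  moreover have "y * 1 \<le> y * s" using s assms by (intro mult_left_mono) auto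
  ultimately show ?thesis unfolding assms(2) by (simp add: power2_eq_square mult_ac)
qed

text \<open>The bracket is the coefficient of \<open>plog x\<close> in \<open>ln_Delta_le\<close>,
  with \<open>\<kappa>\<close> written out. The 64 turns a bound for \<open>2 ^ j / 32\<close> into
  one for \<open>Z < 2 ^ (j + 1)\<close>.\<close>

definition log_Delta_const :: "nat \<Rightarrow> real" where
  "log_Delta_const n = 64 * (ln (3 * (2 ^ (3 * n) * ((real n - 1) ^ (n - 1) * real n ^ n) ^ 3)) + 2 * real n)"

text \<open>The summands belong to the cases of \<open>card_Q_bound\<close>: a small box, the sieve,
  and a large discriminant measured by \<open>A B\<close> or by \<open>A B C D\<close>. The 3
  absorbs the origin and the cases with one solution per row or column.\<close>

definition count_const :: "nat \<Rightarrow> real" where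
  "count_const n = 8 * 2 ^ (n + 15) + 8 * (64 + 4194304 * (2 * real n + 5))
     + 4 * log_Delta_const n + 4 * (log_Delta_const n + 2)\<^sup>2 + 3"

definition square_class_points :: "nat \<Rightarrow> real \<Rightarrow> real \<Rightarrow> real \<Rightarrow> real \<Rightarrow> int \<Rightarrow> (int \<times> int) set" where
  "square_class_points n A B C D s = {(a::int, b::int).
      C \<le> real_of_int a \<and> real_of_int a \<le> C + A \<and>
      D \<le> real_of_int b \<and> real_of_int b \<le> D + B \<and>
      (\<exists>r::int. Delta n a b = s * r ^ 2)}"

lemma Tn_eq_card: "Tn n A B C D s = card (square_class_points n A B C D s)"
  by (simp add: Tn_def square_class_points_def)

section \<open>Solutions in a fixed box\<close>

context
  fixes n :: nat and A B C D :: real and s :: int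
  assumes n: "n \<ge> 5" "odd n" and AB: "A \<ge> 1" "B \<ge> 1" and CD: "C \<ge> 0" "D \<ge> 0"
begin

private definition "Q = square_class_points n A B C D s"
text \<open>A closed interval of length \<open>A\<close> can contain one integer more than the
  integer part of \<open>A\<close>.\<close>

private definition "H = nat (\<lfloor>A\<rfloor> + 1)"
private definition "K = nat (\<lfloor>B\<rfloor> + 1)"
private definition "\<alpha> = (real n - 1) ^ (n - 1)"
private definition "\<beta> = real n ^ n"

private lemma \<alpha>\<beta>: "\<alpha> \<ge> 1" "\<beta> \<ge> 1"
  using n by (auto simp: \<alpha>_def \<beta>_def intro!: one_le_power)

private lemma HK: "H > 0" "K > 0" "real H \<le> 2 * A" "real K \<le> 2 * B"
  using AB unfolding H_def K_def by linarith+

private lemma Q_bounds: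
  assumes "(a, b) \<in> Q"
  shows "C \<le> real_of_int a" "real_of_int a \<le> C + A" "D \<le> real_of_int b" "real_of_int b \<le> D + B"
    "0 \<le> a" "0 \<le> b" "a \<in> {\<lceil>C\<rceil>..<\<lceil>C\<rceil> + int H}" "b \<in> {\<lceil>D\<rceil>..<\<lceil>D\<rceil> + int K}"
proof -
  show 1: "C \<le> real_of_int a" "real_of_int a \<le> C + A" "D \<le> real_of_int b" "real_of_int b \<le> D + B"
    using assms by (auto simp: Q_def square_class_points_def)
  then show "0 \<le> a" "0 \<le> b" using CD by linarith+
  show "a \<in> {\<lceil>C\<rceil>..<\<lceil>C\<rceil> + int H}" "b \<in> {\<lceil>D\<rceil>..<\<lceil>D\<rceil> + int K}"
    using 1 AB unfolding H_def K_def by (simp_all; linarith)+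
qed

private lemma Q_subset: "Q \<subseteq> {\<lceil>C\<rceil>..<\<lceil>C\<rceil> + int H} \<times> {\<lceil>D\<rceil>..<\<lceil>D\<rceil> + int K}"
  using Q_bounds(7,8) by auto

private lemma finite_Q: "finite Q"
  by (rule finite_subset[OF Q_subset]) auto

private lemma card_Q_le: "real (card Q) \<le> 4 * (A * B)"
proof -
  have "card Q \<le> H * K"
    using card_mono[OF _ Q_subset] by (simp add: card_cartesian_product)
  then have "real (card Q) \<le> real H * real K" by (metis of_nat_le_iff of_nat_mult)
  also have "\<dots> \<le> (2 * A) * (2 * B)" using HK AB by (intro mult_mono) auto
  finally show ?thesis by simp
qed

private lemma real_Delta: "real_of_int (Delta n a b) = \<alpha> * real_of_int a ^ n + \<beta> * real_of_int b ^ (n - 1)"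
  by (simp add: Delta_def \<alpha>_def \<beta>_def)

private lemma Delta_nonneg: "(a, b) \<in> Q \<Longrightarrow> 0 \<le> Delta n a b"
  using Q_bounds(5,6)[of a b] n by (simp add: Delta_def)

private lemma Delta_pos: 
  assumes "(a, b) \<in> Q" "(a, b) \<noteq> (0, 0)"
  shows "0 < Delta n a b"
proof -
  have "0 \<le> a" "0 \<le> b" "a > 0 \<or> b > 0" using Q_bounds(5,6)[OF assms(1)] assms(2) by auto
  then have "0 < int n ^ n * b ^ (n - 1) \<or> 0 < (int n - 1) ^ (n - 1) * a ^ n"
    using n by (auto intro!: mult_pos_pos)
  moreover have "0 \<le> int n ^ n * b ^ (n - 1)" "0 \<le> (int n - 1) ^ (n - 1) * a ^ n"
    using \<open>0 \<le> a\<close> \<open>0 \<le> b\<close> n by auto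
  ultimately show ?thesis unfolding Delta_def by linarith
qed

private lemma gap:
  assumes "(a, b) \<in> Q" "(a', b') \<in> Q" "Delta n a b < Delta n a' b'"
  shows "real_of_int (Delta n a' b') \<le> (real_of_int (Delta n a' b') - real_of_int (Delta n a b))\<^sup>2"
proof -
  obtain r t where "Delta n a b = s * r\<^sup>2" "Delta n a' b' = s * t\<^sup>2"
    using assms by (auto simp: Q_def square_class_points_def)
  from scaled_squares_gap[OF this Delta_nonneg[OF assms(1)] assms(3)]
  have "real_of_int (Delta n a' b') \<le> real_of_int ((Delta n a' b' - Delta n a b)\<^sup>2)" by (simp only: of_int_le_iff)
  then show ?thesis by simp
qed

text \<open>Two solutions with the same \<open>b\<close> have discriminants differing by at most
  \<open>\<alpha> * (C + A) ^ n\<close>. When the \<open>b\<close>-term exceeds the square of this,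
  \<open>gap\<close> forbids it, so every \<open>b\<close> occurs at most once.\<close>

private lemma card_Q_le_height:
  assumes big: "\<beta> * D ^ (n - 1) > (\<alpha> * (C + A) ^ n)\<^sup>2"
  shows "real (card Q) \<le> 2 * B"
proof -
  have key: "\<not> a < a'" if ab: "(a, b) \<in> Q" "(a', b) \<in> Q" for a a' b
  proof
    assume lt: "a < a'"
    have q: "0 \<le> a" "0 \<le> b" "real_of_int a' \<le> C + A" "D \<le> real_of_int b" "0 \<le> a'"
      using Q_bounds[OF ab(1)] Q_bounds[OF ab(2)] by auto
    have pw: "real_of_int a ^ n < real_of_int a' ^ n" using lt q n by (intro power_strict_mono) auto
    have diff: "real_of_int (Delta n a' b) - real_of_int (Delta n a b) = \<alpha> * (real_of_int a' ^ n - real_of_int a ^ n)"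
      by (simp add: real_Delta algebra_simps)
    have d0: "\<alpha> * (real_of_int a' ^ n - real_of_int a ^ n) > 0" using pw \<alpha>\<beta> by (intro mult_pos_pos) auto
    then have "Delta n a b < Delta n a' b" using diff by linarith
    from gap[OF ab this] have "real_of_int (Delta n a' b) \<le> (\<alpha> * (real_of_int a' ^ n - real_of_int a ^ n))\<^sup>2"
      by (simp only: diff)
    also have "\<dots> \<le> (\<alpha> * (C + A) ^ n)\<^sup>2"
    proof (rule power_mono)
      have "real_of_int a' ^ n - real_of_int a ^ n \<le> real_of_int a' ^ n" using q by simp
      also have "\<dots> \<le> (C + A) ^ n" using q by (intro power_mono) auto
      finally show "\<alpha> * (real_of_int a' ^ n - real_of_int a ^ n) \<le> \<alpha> * (C + A) ^ n"
        using \<alpha>\<beta> by (intro mult_left_mono) auto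
    qed (use d0 in simp)
    also have "\<dots> < \<beta> * D ^ (n - 1)" by (rule big)
    also have "\<dots> \<le> \<beta> * real_of_int b ^ (n - 1)"
      using q CD \<alpha>\<beta> by (intro mult_left_mono power_mono) auto
    also have "\<dots> \<le> real_of_int (Delta n a' b)" using q \<alpha>\<beta> by (simp add: real_Delta)
    finally show False by simp
  qed
  have "inj_on snd Q"
    using key by (auto simp: inj_on_def) (metis linorder_neqE)+
  then have "card Q = card (snd ` Q)" by (simp add: card_image)
  also have "\<dots> \<le> card {\<lceil>D\<rceil>..<\<lceil>D\<rceil> + int K}" using Q_subset by (intro card_mono) auto
  finally show ?thesis using HK by simp
qed

text \<open>The mirror image of \<open>card_Q_le_height\<close>: two solutions with the same
  \<open>a\<close> would be too close.\<close>

private lemma card_Q_le_width: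
  assumes big: "\<alpha> * C ^ n > (\<beta> * (D + B) ^ (n - 1))\<^sup>2"
  shows "real (card Q) \<le> 2 * A"
proof -
  have key: "\<not> b < b'" if ab: "(a, b) \<in> Q" "(a, b') \<in> Q" for a b b'
  proof
    assume lt: "b < b'"
    have q: "0 \<le> a" "0 \<le> b" "real_of_int b' \<le> D + B" "C \<le> real_of_int a" "0 \<le> b'"
      using Q_bounds[OF ab(1)] Q_bounds[OF ab(2)] by auto
    have pw: "real_of_int b ^ (n - 1) < real_of_int b' ^ (n - 1)" using lt q n by (intro power_strict_mono) auto
    have diff: "real_of_int (Delta n a b') - real_of_int (Delta n a b) = \<beta> * (real_of_int b' ^ (n - 1) - real_of_int b ^ (n - 1))"
      by (simp add: real_Delta algebra_simps)
    have d0: "\<beta> * (real_of_int b' ^ (n - 1) - real_of_int b ^ (n - 1)) > 0" using pw \<alpha>\<beta> by (intro mult_pos_pos) auto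
    then have "Delta n a b < Delta n a b'" using diff by linarith
    from gap[OF ab this] have "real_of_int (Delta n a b') \<le> (\<beta> * (real_of_int b' ^ (n - 1) - real_of_int b ^ (n - 1)))\<^sup>2"
      by (simp only: diff)
    also have "\<dots> \<le> (\<beta> * (D + B) ^ (n - 1))\<^sup>2"
    proof (rule power_mono)
      have "real_of_int b' ^ (n - 1) - real_of_int b ^ (n - 1) \<le> real_of_int b' ^ (n - 1)" using q by simp
      also have "\<dots> \<le> (D + B) ^ (n - 1)" using q by (intro power_mono) auto
      finally show "\<beta> * (real_of_int b' ^ (n - 1) - real_of_int b ^ (n - 1)) \<le> \<beta> * (D + B) ^ (n - 1)"
        using \<alpha>\<beta> by (intro mult_left_mono) auto
    qed (use d0 in simp)
    also have "\<dots> < \<alpha> * C ^ n" by (rule big)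
    also have "\<dots> \<le> \<alpha> * real_of_int a ^ n"
      using q CD \<alpha>\<beta> by (intro mult_left_mono power_mono) auto
    also have "\<dots> \<le> real_of_int (Delta n a b')" using q \<alpha>\<beta> by (simp add: real_Delta)
    finally show False by simp
  qed
  have "inj_on fst Q"
    using key by (auto simp: inj_on_def) (metis linorder_neqE)+
  then have "card Q = card (fst ` Q)" by (simp add: card_image)
  also have "\<dots> \<le> card {\<lceil>C\<rceil>..<\<lceil>C\<rceil> + int H}" using Q_subset by (intro card_mono) auto
  finally show ?thesis using HK by simp
qed

text \<open>A common bound for the coefficients \<open>2 ^ k * \<alpha>\<close>,
  \<open>2 ^ k * \<beta>\<close> and their variants with squared \<open>\<alpha>\<close> or
  \<open>\<beta>\<close> that occur in \<open>Delta_le\<close>, where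
  \<open>k \<le> 3 * n\<close>.\<close>

private definition "\<kappa> = 2 ^ (3 * n) * (\<alpha> * \<beta>) ^ 3"

private lemma \<kappa>1: "\<kappa> \<ge> 1"
proof -
  have "1 * 1 \<le> \<alpha> * \<beta>" using \<alpha>\<beta> by (intro mult_mono) auto
  then have "1 \<le> (\<alpha> * \<beta>) ^ 3" by (intro one_le_power) simp
  then have "1 * 1 \<le> 2 ^ (3 * n) * (\<alpha> * \<beta>) ^ 3" by (intro mult_mono) auto
  then show ?thesis by (simp add: \<kappa>_def)
qed

private lemma power_add_le: "0 \<le> x \<Longrightarrow> 0 \<le> y \<Longrightarrow> (x + y) ^ k \<le> 2 ^ k * (x ^ k + y ^ k)" for x y :: real
proof (induction x y rule: linorder_wlog)
  case (le x y)
  have "(x + y) ^ k \<le> (2 * y) ^ k" using le by (intro power_mono) auto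
  also have "\<dots> \<le> 2 ^ k * (x ^ k + y ^ k)" using le by (simp add: power_mult_distrib)
  finally show ?case .
qed (simp add: add.commute)

private lemma term_le: "c * w ^ k \<le> \<kappa> * x ^ (2 * n)"
  if "c \<le> \<kappa>" "0 \<le> w" "w \<le> x" "1 \<le> x" "k \<le> 2 * n" for c w x :: real
proof -
  have "w ^ k \<le> x ^ k" using that by (intro power_mono) auto
  also have "x ^ k \<le> x ^ (2 * n)" using that by (intro power_increasing) auto
  finally show ?thesis using that \<kappa>1 by (intro mult_mono) auto
qed

private lemma coefficients_le:
  assumes "k \<le> 3 * n"
  shows "2 ^ k * \<alpha> \<le> \<kappa>" "2 ^ k * \<beta> \<le> \<kappa>" "2 ^ k * \<alpha>\<^sup>2 \<le> \<kappa>" "2 ^ k * \<beta>\<^sup>2 \<le> \<kappa>"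
proof -
  let ?g = "\<alpha> * \<beta>"
  have g: "1 * \<beta> \<le> ?g" "\<alpha> * 1 \<le> ?g" using \<alpha>\<beta> by (intro mult_mono; simp)+
  have g3: "x ^ i \<le> ?g ^ 3" if "1 \<le> x" "x \<le> ?g" "i \<le> 3" for x i
  proof -
    have "x ^ i \<le> ?g ^ i" using that by (intro power_mono) auto
    also have "\<dots> \<le> ?g ^ 3" using that by (intro power_increasing) auto
    finally show ?thesis .
  qed
  have k: "(2::real) ^ k \<le> 2 ^ (3 * n)" using assms by (intro power_increasing) auto
  have *: "2 ^ k * x ^ i \<le> \<kappa>" if "1 \<le> x" "x \<le> ?g" "i \<le> 3" for x i
    unfolding \<kappa>_def using k g3[OF that] that by (intro mult_mono) auto
  show "2 ^ k * \<alpha> \<le> \<kappa>" "2 ^ k * \<beta> \<le> \<kappa>" "2 ^ k * \<alpha>\<^sup>2 \<le> \<kappa>" "2 ^ k * \<beta>\<^sup>2 \<le> \<kappa>"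
    using *[of \<alpha> 1] *[of \<beta> 1] *[of \<alpha> 2] *[of \<beta> 2] g \<alpha>\<beta> by simp_all
qed

text \<open>If \<open>C \<le> A\<close>, the \<open>a\<close>-term is controlled by
  \<open>A\<close>, and the first smallness hypothesis then controls \<open>D\<close>; the case
  \<open>D \<le> B\<close> is symmetric. Otherwise \<open>C\<close> and \<open>D\<close> exceed 1
  and all four parameters are at most \<open>A * B * C * D\<close>. The alternative
  \<open>A * B\<close> is there because \<open>A * B * C * D\<close> can be arbitrarily small when
  \<open>C\<close> or \<open>D\<close> is.\<close>

private lemma Delta_le:
  assumes ab: "(a, b) \<in> Q"
    and small: "\<beta> * D ^ (n - 1) \<le> (\<alpha> * (C + A) ^ n)\<^sup>2" "\<alpha> * C ^ n \<le> (\<beta> * (D + B) ^ (n - 1))\<^sup>2"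
  obtains x where "x = A * B \<or> x = A * B * C * D" "1 \<le> x" "real_of_int (Delta n a b) \<le> 3 * \<kappa> * x ^ (2 * n)"
proof -
  note q = Q_bounds(1-6)[OF ab]
  have X: "A \<le> A * B" "B \<le> A * B" "1 \<le> A * B"
    using AB mult_mono[of A A 1 B] mult_mono[of 1 A B B] mult_mono[of 1 A 1 B] by simp_all
  have le: "real_of_int (Delta n a b) \<le> \<alpha> * (C + A) ^ n + \<beta> * (D + B) ^ (n - 1)"
    unfolding real_Delta using q \<alpha>\<beta> by (intro add_mono mult_left_mono power_mono) auto
  consider "C \<le> A" | "D \<le> B" | "C > A" "D > B" by linarith
  then show thesis
  proof cases
    case 1
    have CA: "(C + A) ^ n \<le> 2 ^ n * A ^ n"
      unfolding power_mult_distrib[symmetric] using 1 CD AB by (intro power_mono) auto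
    have "\<beta> * (D + B) ^ (n - 1) \<le> \<beta> * (2 ^ (n - 1) * (D ^ (n - 1) + B ^ (n - 1)))"
      using \<alpha>\<beta> CD AB by (intro mult_left_mono power_add_le) auto
    also have "\<dots> = 2 ^ (n - 1) * (\<beta> * D ^ (n - 1)) + 2 ^ (n - 1) * \<beta> * B ^ (n - 1)"
      by (simp add: algebra_simps)
    also have "2 ^ (n - 1) * (\<beta> * D ^ (n - 1)) \<le> 2 ^ (n - 1) * (\<alpha> * (2 ^ n * A ^ n))\<^sup>2"
    proof (rule mult_left_mono[OF order_trans[OF small(1)]])
      show "(\<alpha> * (C + A) ^ n)\<^sup>2 \<le> (\<alpha> * (2 ^ n * A ^ n))\<^sup>2"
        using CA \<alpha>\<beta> CD AB by (intro power_mono mult_left_mono) auto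
    qed simp
    also have "2 ^ (n - 1) * (\<alpha> * (2 ^ n * A ^ n))\<^sup>2 = 2 ^ (n - 1 + 2 * n) * \<alpha>\<^sup>2 * A ^ (2 * n)"
      by (simp add: power_mult_distrib power_add power_mult[symmetric] mult.commute[of n 2])
    also have "\<dots> \<le> \<kappa> * (A * B) ^ (2 * n)" using X AB by (intro term_le coefficients_le) auto
    also have "2 ^ (n - 1) * \<beta> * B ^ (n - 1) \<le> \<kappa> * (A * B) ^ (2 * n)"
      using X AB by (intro term_le coefficients_le) auto
    finally have 2: "\<beta> * (D + B) ^ (n - 1) \<le> 2 * (\<kappa> * (A * B) ^ (2 * n))" by simp
    have "\<alpha> * (C + A) ^ n \<le> \<alpha> * (2 ^ n * A ^ n)" using CA \<alpha>\<beta> by (intro mult_left_mono) auto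
    also have "\<dots> = 2 ^ n * \<alpha> * A ^ n" by simp
    also have "\<dots> \<le> \<kappa> * (A * B) ^ (2 * n)" using X AB by (intro term_le coefficients_le) auto
    finally show thesis using 2 le X by (intro that[of "A * B"]) auto
  next
    case 2
    have DB: "(D + B) ^ (n - 1) \<le> 2 ^ (n - 1) * B ^ (n - 1)"
      unfolding power_mult_distrib[symmetric] using 2 CD AB by (intro power_mono) auto
    have "\<alpha> * (C + A) ^ n \<le> \<alpha> * (2 ^ n * (C ^ n + A ^ n))"
      using \<alpha>\<beta> CD AB by (intro mult_left_mono power_add_le) auto
    also have "\<dots> = 2 ^ n * (\<alpha> * C ^ n) + 2 ^ n * \<alpha> * A ^ n"
      by (simp add: algebra_simps)
    also have "2 ^ n * (\<alpha> * C ^ n) \<le> 2 ^ n * (\<beta> * (2 ^ (n - 1) * B ^ (n - 1)))\<^sup>2"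
    proof (rule mult_left_mono[OF order_trans[OF small(2)]])
      show "(\<beta> * (D + B) ^ (n - 1))\<^sup>2 \<le> (\<beta> * (2 ^ (n - 1) * B ^ (n - 1)))\<^sup>2"
        using DB \<alpha>\<beta> CD AB by (intro power_mono mult_left_mono) auto
    qed simp
    also have "2 ^ n * (\<beta> * (2 ^ (n - 1) * B ^ (n - 1)))\<^sup>2 = 2 ^ (n + 2 * (n - 1)) * \<beta>\<^sup>2 * B ^ (2 * (n - 1))"
      by (simp add: power_mult_distrib power_add power_mult[symmetric] mult.commute[of _ 2] del: One_nat_def)
    also have "\<dots> \<le> \<kappa> * (A * B) ^ (2 * n)" using X AB by (intro term_le coefficients_le) auto
    also have "2 ^ n * \<alpha> * A ^ n \<le> \<kappa> * (A * B) ^ (2 * n)"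
      using X AB by (intro term_le coefficients_le) auto
    finally have 3: "\<alpha> * (C + A) ^ n \<le> 2 * (\<kappa> * (A * B) ^ (2 * n))" by simp
    have "\<beta> * (D + B) ^ (n - 1) \<le> \<beta> * (2 ^ (n - 1) * B ^ (n - 1))" using DB \<alpha>\<beta> by (intro mult_left_mono) auto
    also have "\<dots> = 2 ^ (n - 1) * \<beta> * B ^ (n - 1)" by simp
    also have "\<dots> \<le> \<kappa> * (A * B) ^ (2 * n)" using X AB by (intro term_le coefficients_le) auto
    finally show thesis using 3 le X by (intro that[of "A * B"]) auto
  next
    case 3
    let ?x = "A * B * C * D"
    have CD1: "1 \<le> C * D" "C \<le> C * D" "D \<le> C * D"
      using 3 AB mult_mono[of C C 1 D] mult_mono[of 1 C D D] mult_mono[of 1 C 1 D] by simp_all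
    have "1 * (C * D) \<le> (A * B) * (C * D)" using X CD1 by (intro mult_right_mono) auto
    then have x: "1 \<le> ?x" "C \<le> ?x" "D \<le> ?x" using CD1 by (auto simp: mult.assoc)
    have "\<alpha> * (C + A) ^ n \<le> \<alpha> * (2 * C) ^ n"
      using 3 AB \<alpha>\<beta> by (intro mult_left_mono power_mono) auto
    also have "\<dots> = 2 ^ n * \<alpha> * C ^ n" by (simp add: power_mult_distrib)
    also have "\<dots> \<le> \<kappa> * ?x ^ (2 * n)" using x CD by (intro term_le coefficients_le) auto
    finally have 1: "\<alpha> * (C + A) ^ n \<le> \<kappa> * ?x ^ (2 * n)" .
    have "\<beta> * (D + B) ^ (n - 1) \<le> \<beta> * (2 * D) ^ (n - 1)"
      using 3 AB \<alpha>\<beta> by (intro mult_left_mono power_mono) auto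
    also have "\<dots> = 2 ^ (n - 1) * \<beta> * D ^ (n - 1)" by (simp add: power_mult_distrib)
    also have "\<dots> \<le> \<kappa> * ?x ^ (2 * n)" using x CD by (intro term_le coefficients_le) auto
    finally have "\<beta> * (D + B) ^ (n - 1) \<le> \<kappa> * ?x ^ (2 * n)" .
    moreover have "0 \<le> \<kappa> * ?x ^ (2 * n)" using \<kappa>1 x by simp
    ultimately show thesis using 1 le x by (intro that[of ?x]) auto
  qed
qed

private lemma ln_Delta_le:
  assumes "0 < real_of_int (Delta n a b)" "1 \<le> x" "real_of_int (Delta n a b) \<le> 3 * \<kappa> * x ^ (2 * n)"
  shows "ln (real_of_int (Delta n a b)) \<le> (ln (3 * \<kappa>) + 2 * real n) * plog x"
proof -
  have "ln (real_of_int (Delta n a b)) \<le> ln (3 * \<kappa> * x ^ (2 * n))"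
    using assms by (subst ln_le_cancel_iff) linarith+
  also have "\<dots> = ln (3 * \<kappa>) * 1 + 2 * real n * ln x"
    using assms \<kappa>1 by (simp add: ln_mult ln_realpow)
  also have "\<dots> \<le> ln (3 * \<kappa>) * plog x + 2 * real n * plog x"
    using plog_ge_1 ln_le_plog assms \<kappa>1 by (intro add_mono mult_left_mono) auto
  finally show ?thesis by (simp add: algebra_simps)
qed

text \<open>The product of the window primes dividing \<open>\<Delta>\<close> divides it too, and
  each exceeds \<open>2 ^ i\<close>. The number of these primes is more than half of the Chebyshev
  count; the 32 comes from \<open>8 * (j + 1) \<le> 16 * i\<close> and
  \<open>ln 2 \<ge> 1 / 2\<close>.\<close>

private lemma few_or_ln_Delta_ge:
  assumes j: "j \<ge> 14" and i: "i = j - 1 \<or> i = j"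
    and P: "2 ^ j \<le> 4 * (j + 1) * card {p::nat. prime p \<and> 2 ^ i < p \<and> p \<le> 2 * 2 ^ i}"
    and \<Delta>: "\<Delta> > 0"
    and many: "card {p::nat. prime p \<and> 2 ^ i < p \<and> p \<le> 2 * 2 ^ i} < 2 * card {p::nat. (prime p \<and> 2 ^ i < p \<and> p \<le> 2 * 2 ^ i) \<and> p dvd \<Delta>}"
  shows "2 ^ j / 32 \<le> ln (real \<Delta>)"
proof -
  let ?P = "{p::nat. prime p \<and> 2 ^ i < p \<and> p \<le> 2 * 2 ^ i}"
  let ?D = "{p::nat. (prime p \<and> 2 ^ i < p \<and> p \<le> 2 * 2 ^ i) \<and> p dvd \<Delta>}"
  have fin: "finite ?D" by (rule finite_subset[of _ "{..2 * 2 ^ i}"]) auto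
  have "(2 ^ i) ^ card ?D = (\<Prod>p\<in>?D. 2 ^ i :: nat)" by simp
  also have "\<dots> \<le> \<Prod>?D" by (intro prod_mono) auto
  also have "\<dots> \<le> \<Delta>" using \<Delta> by (intro dvd_imp_le primes_prod_dvd fin) auto
  finally have "real ((2 ^ i) ^ card ?D) \<le> real \<Delta>" by (simp only: of_nat_le_iff)
  then have "ln (real ((2 ^ i) ^ card ?D)) \<le> ln (real \<Delta>)" using \<Delta> by (subst ln_le_cancel_iff) auto
  then have ln: "real (card ?D) * (real i * ln 2) \<le> ln (real \<Delta>)" by (simp add: ln_realpow)
  have ln2: "ln 2 \<ge> (1 / 2 :: real)" using ln_le_minus_one[of "1 / 2 :: real"] by (simp add: ln_div)
  have "2 ^ j \<le> 4 * (j + 1) * (2 * card ?D)"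
    by (rule order_trans[OF P]) (use many in \<open>intro mult_le_mono2, simp\<close>)
  then have "real (2 ^ j) \<le> real (4 * (j + 1) * (2 * card ?D))" by (simp only: of_nat_le_iff)
  then have "2 ^ j \<le> 8 * (real j + 1) * real (card ?D)" by (simp add: algebra_simps)
  also have "\<dots> \<le> 8 * (2 * real i) * real (card ?D)"
    using i j by (intro mult_right_mono mult_left_mono) auto
  also have "\<dots> = 16 * (real (card ?D) * real i)" by simp
  also have "real (card ?D) * real i \<le> 2 * (real (card ?D) * (real i * ln 2))"
  proof -
    have "real (card ?D) * real i * 1 \<le> real (card ?D) * real i * (2 * ln 2)"
      using ln2 by (intro mult_left_mono) auto
    then show ?thesis by simp
  qed
  finally show ?thesis using ln by simp
qed

text \<open>With \<open>N\<close> of the size of \<open>Z\<close> and \<open>Z ^ 3 = A * B\<close>,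
  both the diagonal term \<open>A B\<close> and the off-diagonal term become at most a constant
  times \<open>Z * (Z ^ 2 + A + B)\<close>. Dividing by the number of primes, about
  \<open>Z / L\<close>, gives the bound.\<close>

private lemma card_Q_sieve:
  assumes j: "j \<ge> 14" "n \<le> 2 ^ (j - 1)" and Z: "2 ^ j \<le> Z" "Z < 2 ^ (j + 1)" "Z ^ 3 = A * B"
    and small: "\<And>a b. (a, b) \<in> Q \<Longrightarrow> (a, b) \<noteq> (0, 0) \<Longrightarrow> ln (real_of_int (Delta n a b)) < 2 ^ j / 32"
  shows "real (card Q) \<le> 1 + 8 * plog (A * B) * (64 + 4194304 * (2 * real n + 5)) * (Z\<^sup>2 + A + B)"
proof -
  obtain i where i: "i = j - 1 \<or> i = j"
    and cheb: "2 ^ j \<le> 4 * (j + 1) * card {p::nat. prime p \<and> 2 ^ i < p \<and> p \<le> 2 * 2 ^ i}"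
    using chebyshev_dyadic[OF j(1)] by blast
  let ?P0 = "{p::nat. prime p \<and> 2 ^ i < p \<and> p \<le> 2 * 2 ^ i}"
  define P where "P = int ` ?P0"
  define N where "N = (2::int) ^ i"
  \<comment> \<open>At the origin \<open>Delta\<close> vanishes and every prime divides it. This
    point is removed and counted by the summand 1.\<close>
  define S where "S = Q - {(0, 0)}"
  define L where "L = plog (A * B)"
  define E where "E = 2048 * (2 * real n + 5)"
  have L1: "L \<ge> 1" by (simp add: L_def plog_ge_1)
  have E0: "E \<ge> 0" by (simp add: E_def)
  have fin0: "finite ?P0" by (rule finite_subset[of _ "{..2 * 2 ^ i}"]) auto
  have cardP: "card P = card ?P0" unfolding P_def by (intro card_image) simp
  have Z1: "Z \<ge> 1" using Z(1) by (rule order_trans[rotated]) simp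
  have nN: "int n \<le> N"
  proof -
    have "n \<le> 2 ^ i" using j i by (auto intro: order_trans power_increasing)
    then have "int n \<le> int (2 ^ i)" by (simp only: of_nat_le_iff)
    then show ?thesis by (simp add: N_def)
  qed
  have "real (card S) * real (card P) \<le> 16 * real H * real K
    + 2048 * (2 * real n + 5) * (real H + 16 * real_of_int N ^ 2) * (real K + 16 * real_of_int N ^ 2) / real_of_int N"
  proof (rule square_sieve_box[OF n nN])
    show "finite P" using fin0 by (simp add: P_def)
    show "prime p" "N < p" "p \<le> 2 * N" if p: "p \<in> P" for p
    proof -
      obtain q where q: "p = int q" "prime q" "2 ^ i < q" "q \<le> 2 * 2 ^ i" using p by (auto simp: P_def)
      have "int (2 ^ i) < int q" "int q \<le> int (2 * 2 ^ i)" using q by (simp_all only: of_nat_less_iff of_nat_le_iff)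
      then show "prime p" "N < p" "p \<le> 2 * N" using q by (simp_all add: N_def)
    qed
    show "S \<subseteq> {\<lceil>C\<rceil>..<\<lceil>C\<rceil> + int H} \<times> {\<lceil>D\<rceil>..<\<lceil>D\<rceil> + int K}" using Q_subset by (auto simp: S_def)
    show "\<exists>r. Delta n a b = s * r\<^sup>2" if "(a, b) \<in> S" for a b
      using that by (auto simp: S_def Q_def square_class_points_def)
    show "2 * card {p \<in> P. p dvd Delta n a b} \<le> card P" if ab: "(a, b) \<in> S" for a b
    proof (rule ccontr)
      assume "\<not> 2 * card {p \<in> P. p dvd Delta n a b} \<le> card P"
      define \<delta> where "\<delta> = nat (Delta n a b)"
      have "0 < Delta n a b" using ab Delta_pos by (auto simp: S_def)
      then have \<delta>: "Delta n a b = int \<delta>" "\<delta> > 0" by (auto simp: \<delta>_def)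
      have "{p \<in> P. p dvd Delta n a b} = int ` {p. (prime p \<and> 2 ^ i < p \<and> p \<le> 2 * 2 ^ i) \<and> p dvd \<delta>}"
        unfolding P_def \<delta>(1) by auto
      then have "card {p \<in> P. p dvd Delta n a b} = card {p. (prime p \<and> 2 ^ i < p \<and> p \<le> 2 * 2 ^ i) \<and> p dvd \<delta>}"
        by (simp add: card_image)
      then have "2 ^ j / 32 \<le> ln (real \<delta>)"
        using \<open>\<not> 2 * card {p \<in> P. p dvd Delta n a b} \<le> card P\<close> cardP
        by (intro few_or_ln_Delta_ge[OF j(1) i cheb \<delta>(2)]) simp
      moreover have "ln (real_of_int (Delta n a b)) < 2 ^ j / 32" using ab by (intro small) (auto simp: S_def)
      ultimately show False using \<delta> by simp
    qed
  qed (rule HK)+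
  then have sieve: "real (card S) * real (card P) \<le> 16 * real H * real K
    + E * (real H + 16 * real_of_int N ^ 2) * (real K + 16 * real_of_int N ^ 2) / real_of_int N"
    by (simp only: E_def)
  have Nj: "real_of_int N \<le> 2 ^ j" "2 ^ j / 2 \<le> real_of_int N"
  proof -
    have "(2::real) ^ j = 2 * 2 ^ (j - 1)" using j by (cases j) auto
    then show "real_of_int N \<le> 2 ^ j" "2 ^ j / 2 \<le> real_of_int N" using i by (auto simp: N_def)
  qed
  have NZ: "real_of_int N \<le> Z" "Z / 4 \<le> real_of_int N" "real_of_int N > 0"
    using Nj(2) Z(2) Z1 by (auto intro: order_trans[OF Nj(1) Z(1)])
  have N2: "real_of_int N ^ 2 \<le> Z\<^sup>2" using NZ by (intro power_mono) auto
  have "16 * real H * real K \<le> 16 * (2 * A) * (2 * B)" using HK AB by (intro mult_mono) auto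
  also have "\<dots> = 64 * Z ^ 3" by (simp add: Z)
  finally have 1: "16 * real H * real K \<le> 64 * Z ^ 3" .
  \<comment> \<open>Here \<open>N\<close> is traded for \<open>Z\<close> through
    \<open>Z / 4 \<le> N \<le> Z\<close>; the resulting constant 1024 is 16 * 16 * 4.\<close>
  have "E * (real H + 16 * real_of_int N ^ 2) * (real K + 16 * real_of_int N ^ 2) / real_of_int N
      \<le> E * (16 * (A + Z\<^sup>2)) * (16 * (B + Z\<^sup>2)) / (Z / 4)"
  proof (intro frac_le mult_mono)
    show "real H + 16 * real_of_int N ^ 2 \<le> 16 * (A + Z\<^sup>2)" "real K + 16 * real_of_int N ^ 2 \<le> 16 * (B + Z\<^sup>2)"
      using HK AB N2 by argo+
  qed (use AB NZ E0 Z1 in auto)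
  also have "\<dots> = 1024 * E * ((A * B + Z\<^sup>2 * (A + B) + Z ^ 4) / Z)"
    by (simp add: algebra_simps power4_eq_xxxx power2_eq_square)
  also have "(A * B + Z\<^sup>2 * (A + B) + Z ^ 4) / Z = Z * (Z + A + B + Z\<^sup>2)"
    unfolding Z(3)[symmetric] using Z1 by (simp add: field_simps power4_eq_xxxx power2_eq_square power3_eq_cube)
  also have "1024 * E * (Z * (Z + A + B + Z\<^sup>2)) \<le> 1024 * E * (Z * (2 * (Z\<^sup>2 + A + B)))"
  proof -
    have "Z * 1 \<le> Z * Z" using Z1 by (intro mult_left_mono) auto
    then have "Z + A + B + Z\<^sup>2 \<le> 2 * (Z\<^sup>2 + A + B)" using AB by (simp add: power2_eq_square)
    then show ?thesis using E0 Z1 by (intro mult_left_mono) auto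
  qed
  also have "\<dots> = Z * (2048 * E * (Z\<^sup>2 + A + B))" by simp
  finally have 2: "E * (real H + 16 * real_of_int N ^ 2) * (real K + 16 * real_of_int N ^ 2) / real_of_int N
     \<le> Z * (2048 * E * (Z\<^sup>2 + A + B))" .
  have "64 * Z ^ 3 \<le> Z * (64 * (Z\<^sup>2 + A + B))"
    using Z1 AB by (simp add: power2_eq_square power3_eq_cube distrib_left)
  then have "real (card S) * real (card P) \<le> Z * ((64 + 2048 * E) * (Z\<^sup>2 + A + B))"
    using sieve 1 2 by (simp add: algebra_simps)
  \<comment> \<open>From \<open>2 ^ (3 * j) \<le> A * B\<close> follows
    \<open>3 * j / 2 \<le> L\<close>, hence \<open>j + 1 \<le> L\<close>. The Chebyshev factor 4 and
    \<open>Z < 2 * 2 ^ j\<close> make 8.\<close>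
  moreover have "Z / (8 * L) \<le> real (card P)"
  proof -
    have "2 ^ (3 * j) \<le> A * B"
    proof -
      have "(2 ^ j) ^ 3 \<le> Z ^ 3" using Z by (intro power_mono) auto
      then show ?thesis by (simp add: Z(3) mult.commute flip: power_mult)
    qed
    moreover have "0 < A * B" using AB by (intro mult_pos_pos) auto
    ultimately have "ln (2 ^ (3 * j)) \<le> ln (A * B)" by (subst ln_le_cancel_iff) auto
    then have "3 * real j * ln 2 \<le> ln (A * B)" by (simp add: ln_realpow)
    also have "\<dots> \<le> L" unfolding L_def using AB by (intro ln_le_plog) auto
    finally have "3 * real j * ln 2 \<le> L" .
    moreover have "ln 2 \<ge> (1 / 2 :: real)" using ln_le_minus_one[of "1 / 2 :: real"] by (simp add: ln_div)
    then have "3 * real j * (1 / 2) \<le> 3 * real j * ln 2" by (intro mult_left_mono) auto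
    ultimately have jL: "real j + 1 \<le> L" using j by linarith
    have "real (2 ^ j) \<le> real (4 * (j + 1) * card P)" unfolding cardP using cheb by (simp only: of_nat_le_iff)
    then have "2 ^ j \<le> 4 * (real j + 1) * real (card P)" by (simp add: add.commute)
    also have "\<dots> \<le> 4 * L * real (card P)" using jL by (intro mult_right_mono) auto
    finally show ?thesis using Z(2) L1 by (simp add: field_simps)
  qed
  then have "real (card S) * (Z / (8 * L)) \<le> real (card S) * real (card P)" by (intro mult_left_mono) auto
  ultimately have "real (card S) * (Z / (8 * L)) \<le> Z * ((64 + 2048 * E) * (Z\<^sup>2 + A + B))" by linarith
  then have "Z * real (card S) \<le> Z * (8 * L * (64 + 2048 * E) * (Z\<^sup>2 + A + B))"
    using L1 by (simp add: field_simps)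
  then have "real (card S) \<le> 8 * L * (64 + 2048 * E) * (Z\<^sup>2 + A + B)" using Z1 by (simp add: mult_le_cancel_left)
  moreover have "card Q \<le> 1 + card S" unfolding S_def using finite_Q by (auto simp: card_Diff_singleton_if)
  moreover have E_eq: "2048 * E = 4194304 * (2 * real n + 5)" by (simp add: E_def)
  ultimately show ?thesis unfolding L_def E_eq by linarith
qed

private lemma log_Delta_const_eq: "log_Delta_const n = 64 * (ln (3 * \<kappa>) + 2 * real n)"
  by (simp add: log_Delta_const_def \<kappa>_def \<alpha>_def \<beta>_def)

lemma log_Delta_const_nonneg: "0 \<le> log_Delta_const n"
  using \<kappa>1 by (simp add: log_Delta_const_eq)

text \<open>The trivial bound is \<open>4 * Z ^ 3\<close>. It suffices when \<open>Z\<close> is at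
  most a constant times \<open>L\<close> or times \<open>Y * L / plog Y\<close>, which happens
  whenever some nonzero discriminant is too large for the sieve and neither of its terms
  dominates.\<close>

private lemma card_Q_bound:
  fixes j :: nat
  assumes Z: "Z = (A * B) powr (1 / 3)" and j: "2 ^ j \<le> Z" "Z < 2 ^ (j + 1)"
  defines "L \<equiv> plog (A * B)" and "Y \<equiv> plog (A * B * C * D)"
  shows "real (card Q) \<le> count_const n
    * (Z\<^sup>2 * L + A * L + B * L + Z * (Y * L / plog Y)\<^sup>2)"
proof -
  define T where "T = Z\<^sup>2 * L + A * L + B * L + Z * (Y * L / plog Y)\<^sup>2"
  define \<mu> where "\<mu> = log_Delta_const n"
  have \<mu>: "\<mu> = 64 * (ln (3 * \<kappa>) + 2 * real n)"
    by (simp only: \<mu>_def log_Delta_const_eq)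
  define E where "E = 8 * (64 + 4194304 * (2 * real n + 5))"
  let ?c = "8 * 2 ^ (n + 15) + E + 4 * \<mu> + 4 * (\<mu> + 2)\<^sup>2 + 3"
  have "1 * 1 \<le> A * B" using AB by (intro mult_mono) auto
  then have X1: "1 \<le> A * B" by simp
  have Z1: "1 \<le> Z" unfolding Z using X1 by (intro ge_one_powr_ge_zero) auto
  have "Z ^ 3 = Z powr real 3" using Z1 by (intro powr_realpow[symmetric]) simp
  also have "\<dots> = A * B" unfolding Z powr_powr using X1 by simp
  finally have Z3: "Z ^ 3 = A * B" .
  have L1: "1 \<le> L" "1 \<le> Y" "1 \<le> plog Y" by (simp_all add: L_def Y_def plog_ge_1)
  have \<mu>0: "0 \<le> \<mu>" by (simp add: \<mu>_def log_Delta_const_nonneg)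
  have E0: "0 \<le> E" by (simp add: E_def)
  have "0 \<le> Z\<^sup>2 * L" "0 \<le> A * L" "0 \<le> B * L" "0 \<le> Z * (Y * L / plog Y)\<^sup>2"
    using L1 AB Z1 by auto
  then have T: "Z\<^sup>2 * L \<le> T" "A * L \<le> T" "B * L \<le> T" "Z * (Y * L / plog Y)\<^sup>2 \<le> T" "0 \<le> T"
    "(Z\<^sup>2 + A + B) * L \<le> T"
    by (simp_all add: T_def algebra_simps)
  have le: "x \<le> ?c * T" if "x \<le> c * T" "c \<le> ?c" for x c
    using that mult_right_mono[of c ?c T] T by linarith
  have pos: "(0::real) \<le> 8 * 2 ^ (n + 15)" "0 \<le> 4 * (\<mu> + 2)\<^sup>2" by auto
  have triv: "real (card Q) \<le> 4 * (Z\<^sup>2 * Z)" using card_Q_le by (simp flip: Z3 add: power2_eq_square power3_eq_cube)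
  have ZL: "Z\<^sup>2 \<le> Z\<^sup>2 * L" using L1 Z1 mult_left_mono[of 1 L "Z\<^sup>2"] by simp
  have trivial_bound: "real (card Q) \<le> 4 * w * T" if "Z \<le> w * L" "0 \<le> w" for w
  proof -
    have "4 * (Z\<^sup>2 * Z) \<le> 4 * (Z\<^sup>2 * (w * L))" using that Z1 by (intro mult_left_mono) auto
    also have "\<dots> = 4 * w * (Z\<^sup>2 * L)" by simp
    also have "\<dots> \<le> 4 * w * T" using T that by (intro mult_left_mono) auto
    finally show ?thesis using triv by linarith
  qed
  have "real (card Q) \<le> ?c * T"
  \<comment> \<open>Above this threshold \<open>j \<ge> 14\<close> for the Chebyshev bound and
    \<open>n \<le> 2 ^ (j - 1)\<close>, so that all window primes exceed \<open>n\<close>. Below it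
    \<open>Z\<close> is bounded in terms of \<open>n\<close>.\<close>
  proof (cases "j \<ge> n + 15")
    case False
    then have "(2::real) ^ (j + 1) \<le> 2 ^ (n + 15)" by (intro power_increasing) auto
    then have "Z \<le> 2 ^ (n + 15) * 1" using j by simp
    also have "\<dots> \<le> 2 ^ (n + 15) * L" using L1 by (intro mult_left_mono) auto
    finally have "real (card Q) \<le> 4 * 2 ^ (n + 15) * T" by (intro trivial_bound) auto
    then show ?thesis using pos \<mu>0 E0 by (intro le[of _ "4 * 2 ^ (n + 15)"]) linarith+
  next
    case True
    have nj: "n \<le> 2 ^ (j - 1)"
    proof -
      have "n < 2 ^ n" by simp
      also have "(2::nat) ^ n \<le> 2 ^ (j - 1)" using True by (intro power_increasing) auto
      finally show ?thesis by simp
    qed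
    consider "\<beta> * D ^ (n - 1) > (\<alpha> * (C + A) ^ n)\<^sup>2" | "\<alpha> * C ^ n > (\<beta> * (D + B) ^ (n - 1))\<^sup>2"
      | (few) "\<And>a b. (a, b) \<in> Q \<Longrightarrow> (a, b) \<noteq> (0, 0) \<Longrightarrow> ln (real_of_int (Delta n a b)) < 2 ^ j / 32"
      | (many) a b where "(a, b) \<in> Q" "(a, b) \<noteq> (0, 0)" "2 ^ j / 32 \<le> ln (real_of_int (Delta n a b))"
        "\<beta> * D ^ (n - 1) \<le> (\<alpha> * (C + A) ^ n)\<^sup>2" "\<alpha> * C ^ n \<le> (\<beta> * (D + B) ^ (n - 1))\<^sup>2"
      by (meson not_le)
    then show ?thesis
    proof cases
      case 1
      have "B * 1 \<le> B * L" using L1 AB by (intro mult_left_mono) auto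
      then show ?thesis using card_Q_le_height[OF 1] T pos \<mu>0 E0 by (intro le[of _ 2]) linarith+
    next
      case 2
      have "A * 1 \<le> A * L" using L1 AB by (intro mult_left_mono) auto
      then show ?thesis using card_Q_le_width[OF 2] T pos \<mu>0 E0 by (intro le[of _ 2]) linarith+
    next
      case few
      have "real (card Q) \<le> 1 + 8 * L * (64 + 4194304 * (2 * real n + 5)) * (Z\<^sup>2 + A + B)"
        unfolding L_def using True by (intro card_Q_sieve[OF _ nj j Z3 few]) auto
      also have "\<dots> = 1 + E * ((Z\<^sup>2 + A + B) * L)" by (simp add: E_def)
      also have "\<dots> \<le> 1 * T + E * T"
      proof -
        have "1 \<le> Z\<^sup>2" using Z1 by simp
        then show ?thesis using ZL T mult_left_mono[OF T(6) E0] by linarith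
      qed
      finally have "real (card Q) \<le> (1 + E) * T" by (simp add: algebra_simps)
      then show ?thesis using pos \<mu>0 E0 by (intro le[of _ "1 + E"]) linarith+
    next
      case many
      obtain x where x: "x = A * B \<or> x = A * B * C * D" "1 \<le> x" "real_of_int (Delta n a b) \<le> 3 * \<kappa> * x ^ (2 * n)"
        using Delta_le[OF many(1,4,5)] by blast
      have "Z / 64 < 2 ^ j / 32" using j by simp
      also have "\<dots> \<le> (ln (3 * \<kappa>) + 2 * real n) * plog x"
        using many(3) ln_Delta_le[OF _ x(2,3)] Delta_pos[OF many(1,2)] by simp
      finally have Zx: "Z \<le> \<mu> * plog x" by (simp add: \<mu> algebra_simps)
      from x(1) show ?thesis
      proof
        assume "x = A * B"
        then have "Z \<le> \<mu> * L" using Zx by (simp add: L_def)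
        from trivial_bound[OF this \<mu>0] show ?thesis using pos \<mu>0 E0 by (intro le[of _ "4 * \<mu>"]) linarith+
      next
        assume "x = A * B * C * D"
        then have ZY: "Z \<le> \<mu> * Y" using Zx by (simp add: Y_def)
        have "Z \<le> (\<mu> + 2) * (Y * L / plog Y)"
        \<comment> \<open>If \<open>Y\<close> is at most the square of \<open>Z\<close>, it is at
          most \<open>A * B\<close>, so \<open>plog Y \<le> L\<close> and the quotient is at least
          \<open>Y\<close>. Otherwise \<open>Z\<close> is at most the square root of
          \<open>Y\<close>, which is of lower order than \<open>Y / plog Y\<close>.\<close>
        proof (cases "Y \<le> Z\<^sup>2")
          case True
          have "Z\<^sup>2 \<le> Z ^ 3" using Z1 by (intro power_increasing) auto
          then have "plog Y \<le> L" unfolding L_def Z3[symmetric] using True by (intro plog_mono) linarith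
          then have "Y * plog Y \<le> Y * L" using L1 by (intro mult_left_mono) auto
          then have "Y \<le> Y * L / plog Y" using L1 by (simp add: field_simps)
          then have "\<mu> * Y \<le> (\<mu> + 2) * (Y * L / plog Y)" using \<mu>0 L1 by (intro mult_mono) auto
          then show ?thesis using ZY by linarith
        next
          case False
          have "Z = sqrt (Z\<^sup>2)" using Z1 by simp
          also have "\<dots> \<le> sqrt Y" using False by (intro real_sqrt_le_mono) simp
          finally have ZsY: "Z \<le> sqrt Y" .
          have "Y * 1 = sqrt Y * sqrt Y" using L1 by simp
          have "sqrt Y * plog Y \<le> sqrt Y * (2 * sqrt Y)" using plog_le_two_sqrt[OF L1(2)] L1 by (intro mult_left_mono) auto
          also have "\<dots> = 2 * Y * 1" using \<open>Y * 1 = sqrt Y * sqrt Y\<close> by simp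
          also have "\<dots> \<le> 2 * Y * L" using L1 by (intro mult_left_mono) auto
          finally have "sqrt Y \<le> 2 * (Y * L / plog Y)" using L1 by (simp add: field_simps)
          also have "\<dots> \<le> (\<mu> + 2) * (Y * L / plog Y)" using \<mu>0 L1 by (intro mult_right_mono) auto
          finally show ?thesis using ZsY by linarith
        qed
        then have "Z\<^sup>2 \<le> ((\<mu> + 2) * (Y * L / plog Y))\<^sup>2" using Z1 by (intro power_mono) auto
        then have "4 * (Z\<^sup>2 * Z) \<le> 4 * (((\<mu> + 2) * (Y * L / plog Y))\<^sup>2 * Z)" using Z1 by (intro mult_left_mono mult_right_mono) auto
        also have "\<dots> = 4 * (\<mu> + 2)\<^sup>2 * (Z * (Y * L / plog Y)\<^sup>2)" by (simp only: power_mult_distrib mult_ac)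
        also have "\<dots> \<le> 4 * (\<mu> + 2)\<^sup>2 * T" using T by (intro mult_left_mono) auto
        finally have "real (card Q) \<le> 4 * (\<mu> + 2)\<^sup>2 * T" using triv by linarith
        then show ?thesis using pos \<mu>0 E0 by (intro le[of _ "4 * (\<mu> + 2)\<^sup>2"]) linarith+
      qed
    qed
  qed
  then show ?thesis by (simp only: T_def E_def count_const_def \<mu>_def)
qed

lemma Tn_bound:
  "real (Tn n A B C D s) \<le> count_const n
    * ((A * B) powr (2/3) * plog (A * B) + A * plog (A * B) + B * plog (A * B)
      + (A * B) powr (1/3) * (plog (A * B * C * D) * plog (A * B) / plog (plog (A * B * C * D)))\<^sup>2)"
proof -
  define Z where "Z = (A * B) powr (1 / 3)"
  have "1 * 1 \<le> A * B" using AB by (intro mult_mono) auto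
  then have "1 \<le> A * B" by simp
  then have Z1: "1 \<le> Z" unfolding Z_def by (intro ge_one_powr_ge_zero) auto
  then have "1 \<le> nat \<lfloor>Z\<rfloor>" by linarith
  \<comment> \<open>The integer part of the binary logarithm of \<open>Z\<close>, found through the
    integer part of \<open>Z\<close>.\<close>
  then obtain j where j: "2 ^ j \<le> nat \<lfloor>Z\<rfloor>" "nat \<lfloor>Z\<rfloor> < 2 ^ (j + 1)"
    using ex_power_ivl1[of 2 "nat \<lfloor>Z\<rfloor>"] by auto
  have "2 ^ j \<le> Z"
  proof -
    have "real (2 ^ j) \<le> real (nat \<lfloor>Z\<rfloor>)" using j(1) by (simp only: of_nat_le_iff)
    also have "\<dots> \<le> Z" using Z1 by linarith
    finally show ?thesis by simp
  qed
  moreover have "Z < 2 ^ (j + 1)"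
  proof -
    have "nat \<lfloor>Z\<rfloor> + 1 \<le> 2 ^ (j + 1)" using j(2) by simp
    then have "real (nat \<lfloor>Z\<rfloor> + 1) \<le> real (2 ^ (j + 1))" by (simp only: of_nat_le_iff)
    moreover have "Z < real (nat \<lfloor>Z\<rfloor> + 1)" using Z1 by linarith
    ultimately show ?thesis by simp
  qed
  moreover have "Z\<^sup>2 = (A * B) powr (2 / 3)"
  proof -
    have "Z\<^sup>2 = Z powr real 2" using Z1 by (intro powr_realpow[symmetric]) simp
    also have "\<dots> = (A * B) powr (2 / 3)" unfolding Z_def powr_powr by simp
    finally show ?thesis .
  qed
  ultimately show ?thesis
    using card_Q_bound[OF Z_def, of j] unfolding Tn_eq_card Q_def
    by (simp only: Z_def[symmetric])
qed

end

theorem theorem1: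
  fixes n :: nat
  assumes "n \<ge> 5" and "n mod 4 = 1"
  shows "\<exists>c>0. \<forall>(A::real) (B::real) (C::real) (D::real) (s::int).
    A \<ge> 1 \<longrightarrow> B \<ge> 1 \<longrightarrow> C \<ge> 0 \<longrightarrow> D \<ge> 0 \<longrightarrow> squarefree s \<longrightarrow>
    real (Tn n A B C D s) \<le> c * ((A * B) powr (2/3) * plog (A * B)
      + A * plog (A * B) + B * plog (A * B)
      + (A * B) powr (1/3) *
        (plog (A * B * C * D) * plog (A * B) / plog (plog (A * B * C * D))) ^ 2)"
proof -
  have "odd n" using assms(2) by presburger
  note bound = Tn_bound[OF assms(1) this]
  have "0 \<le> log_Delta_const n"
    \<comment> \<open>The constant depends on \<open>n\<close> only, so the context may be
      instantiated with the unit box at the origin.\<close>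
    by (rule log_Delta_const_nonneg[OF assms(1) \<open>odd n\<close>, of 1 1 0 0]) auto
  then have "0 < count_const n" unfolding count_const_def
    by (intro add_nonneg_pos add_nonneg_nonneg mult_nonneg_nonneg) auto
  then show ?thesis using bound by blast
qed

end
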